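(* Let $Y$ be a real-valued Lévy process with characteristic exponent $\psi$, let $\beta>0$, and let $\mathcal{R}_\beta$, $H_\beta$, $\sigma_\beta$ and the $\beta$-potential density $u^\beta$ be as defined in the context. Suppose that $\mathcal{R}_\beta(\lambda)\in L^1(\mathbb{R}_+)$ and that, for some constant $C<1/2$, $$|H_\beta(z)|\le C\,\sigma_\beta^2(z)$$ for all $|z|$ sufficiently small. Suppose, in addition, that $\sigma_\beta^2(z)\ge f(|z|)$ for some increasing function $f$, for all $|z|$ sufficiently small. Then $$\limsup_{n\to\infty} f(1/n)\log n=\infty$$ implies that the $\alpha$-permanental process with kernel $u^\beta$ is unbounded almost surely, for every $\alpha>0$.
   Context: Write $E e^{i\lambda Y_t}=e^{-t\psi(\lambda)}$. Set $\mathcal{R}_\beta(\lambda)=\mathrm{Re}\left(1/(\beta+\psi(\lambda))\right)$ and $\mathcal{I}_\beta(\lambda)=\mathrm{Im}\left(1/(\beta+\psi(\lambda))\right)$. When $\mathcal{R}_\beta\in L^1(\mathbb{R}_+)$, put $$R_\beta(z)=\frac1\pi\int_0^\infty\cos(\lambda z)\mathcal{R}_\beta(\lambda)\,d\lambda,\qquad H_\beta(z)=\frac1\pi\int_0^\infty\sin(\lambda z)\mathcal{I}_\beta(\lambda)\,d\lambda .$$ In this case (known fact) the $\beta$-potential density of $Y$ is $u^\beta(x,y)=u^\beta(y-x)$ with $u^\beta(z)=R_\beta(z)+H_\beta(z)$ and $u^\beta(-z)=R_\beta(z)-H_\beta(z)$; it is the $0$-potential density of the transient process obtained by killing $Y$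 at an independent exponential time with mean $1/\beta$. Set $$\sigma_\beta(z)=\left(2u^\beta(0)-u^\beta(z)-u^\beta(-z)\right)^{1/2}=\left(\frac2\pi\int_0^\infty(1-\cos(\lambda z))\mathcal{R}_\beta(\lambda)\,d\lambda\right)^{1/2}.$$ For $\alpha>0$, the $\alpha$-permanental process with kernel $u^\beta$ is the non-negative process $\{X_x,x\in\mathbb{R}\}$ such that for all $x_1,\dots,x_n$ and $s_1,\dots,s_n\ge0$, $E\left(e^{-\sum_i s_iX_{x_i}}\right)=|I+KS|^{-\alpha}$ with $K=\{u^\beta(x_j-x_i)\}_{i,j=1}^n$, $S=\mathrm{diag}(s_1,\dots,s_n)$ and $|\cdot|$ the determinant (such a process exists). "Unbounded almost surely" means $\sup_x X_x=\infty$ almost surely (the event contains a measurable event of probability one). *)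

theory Defs
  imports
    "HOL-Probability.Probability"
    "Jordan_Normal_Form.Determinant"
begin

definition levy_process :: "'a measure \<Rightarrow> (real \<Rightarrow> 'a \<Rightarrow> real) \<Rightarrow> bool" where
  "levy_process M Y \<longleftrightarrow>
     prob_space M \<and>
     (\<forall>t\<ge>0. Y t \<in> borel_measurable M) \<and>
     (AE \<omega> in M. Y 0 \<omega> = 0) \<and>
     (\<forall>(n::nat) (t :: nat \<Rightarrow> real). 0 \<le> t 0 \<and> (\<forall>i<n. t i \<le> t (Suc i)) \<longrightarrow>
        prob_space.indep_vars M (\<lambda>_. borel) (\<lambda>i \<omega>. Y (t (Suc i)) \<omega> - Y (t i) \<omega>) {..<n}) \<and>
     (\<forall>s\<ge>0. \<forall>t\<ge>0. distr M borel (\<lambda>\<omega>. Y (s + t) \<omega> - Y s \<omega>) = distr M borel (Y t)) \<and>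
     (AE \<omega> in M. \<forall>t\<ge>0.
        ((\<lambda>s. Y s \<omega>) \<longlongrightarrow> Y t \<omega>) (at_right t) \<and>
        (t > 0 \<longrightarrow> (\<exists>l. ((\<lambda>s. Y s \<omega>) \<longlongrightarrow> l) (at_left t))))"

(* The exponent is determined uniquely because the identity is required for all t \<ge> 0. *)
definition characteristic_exponent ::
    "'a measure \<Rightarrow> (real \<Rightarrow> 'a \<Rightarrow> real) \<Rightarrow> (real \<Rightarrow> complex) \<Rightarrow> bool" where
  "characteristic_exponent M Y \<psi> \<longleftrightarrow>
     (\<forall>t\<ge>0. \<forall>v. char (distr M borel (Y t)) v = exp (- (complex_of_real t * \<psi> v)))"

definition resolvent_re :: "real \<Rightarrow> (real \<Rightarrow> complex) \<Rightarrow> real \<Rightarrow> real" where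
  "resolvent_re \<beta> \<psi> v = Re (1 / (complex_of_real \<beta> + \<psi> v))"

definition resolvent_im :: "real \<Rightarrow> (real \<Rightarrow> complex) \<Rightarrow> real \<Rightarrow> real" where
  "resolvent_im \<beta> \<psi> v = Im (1 / (complex_of_real \<beta> + \<psi> v))"

definition R_part :: "real \<Rightarrow> (real \<Rightarrow> complex) \<Rightarrow> real \<Rightarrow> real" where
  "R_part \<beta> \<psi> z = 1 / pi * (LBINT v:{0..}. cos (v * z) * resolvent_re \<beta> \<psi> v)"

(* Integrability of the real part does not make the imaginary part Lebesgue integrable
   (asymmetric Cauchy processes, for example), so the integral defining H is improper.  The
   Henstock-Kurzweil integral over {0..} is the limit of the integrals over {0..T}. *)
definition H_part :: "real \<Rightarrow> (real \<Rightarrow> complex) \<Rightarrow> real \<Rightarrow> real" where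
  "H_part \<beta> \<psi> z = 1 / pi * integral {0..} (\<lambda>v. sin (v * z) * resolvent_im \<beta> \<psi> v)"

(* Potential densities are determined by the process only up to null sets; this formula is the
   version of the beta-potential density of a Levy process with exponent \<psi> that is meant
   when the real part of the resolvent is integrable. *)
definition potential_density :: "real \<Rightarrow> (real \<Rightarrow> complex) \<Rightarrow> real \<Rightarrow> real" where
  "potential_density \<beta> \<psi> z = R_part \<beta> \<psi> z + H_part \<beta> \<psi> z"

definition sigma_pot :: "real \<Rightarrow> (real \<Rightarrow> complex) \<Rightarrow> real \<Rightarrow> real" where
  "sigma_pot \<beta> \<psi> z =
     sqrt (2 * potential_density \<beta> \<psi> 0 - potential_density \<beta> \<psi> z - potential_density \<beta> \<psi> (- z))"

definition permanental_process ::
    "'b measure \<Rightarrow> (real \<Rightarrow> 'b \<Rightarrow> real) \<Rightarrow> real \<Rightarrow> (real \<Rightarrow> real \<Rightarrow> real) \<Rightarrow> bool" where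
  "permanental_process N X \<alpha> u \<longleftrightarrow>
     prob_space N \<and>
     (\<forall>x. X x \<in> borel_measurable N) \<and>
     (\<forall>x. \<forall>\<omega>\<in>space N. 0 \<le> X x \<omega>) \<and>
     (\<forall>(n::nat) (x :: nat \<Rightarrow> real) (s :: nat \<Rightarrow> real). (\<forall>i<n. 0 \<le> s i) \<longrightarrow>
        prob_space.expectation N (\<lambda>\<omega>. exp (- (\<Sum>i<n. s i * X (x i) \<omega>))) =
        Determinant.det (1\<^sub>m n + Matrix.mat n n (\<lambda>(i, j). u (x i) (x j)) * mat_diag n s)
          powr (- \<alpha>))"

end

(*
  Expanding the Laplace transform shows that a permanental vector whose kernel matrix K is the inverse of d (I - Q), with Q a
  substochastic matrix, is a mixture of vectors of independent gamma variables of shapes at least alpha and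
  rate d.  Hence its maximum dominates that of independent gamma(alpha, d) variables, which for n points is
  of order (log n) / d.

  For the potential density u of a Levy process, the maximum principle for the resolvent makes K of this form,
  and the relation (I - Q) K = I / d shows that d = 1 / (u 0 - max u) is possible, the maximum being over
  the differences of distinct points.  Since u 0 - u z = sigma(z)^2 / 2 - H(z) >= (1/2 - C) sigma(z)^2, points at
  mutual distance at least 1/n give 1/d >= (1/2 - C) f(1/n), and the maximum of X over about n such points is
  of order f(1/n) log n.

  The potential density is given by an improper Fourier integral.  From
  |psi(a+s) - psi(a) - psi(s)| <= r Re psi(a) + Re psi(s) / r one finds that the increments of 1/(beta+psi)
  are integrable as soon as its real part is, so that shifting by half a period makes the integral converge
  locally uniformly away from 0; Levy's inversion formula then identifies its value.
*)

theory Submission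
  imports Defs "HOL-Real_Asymp.Real_Asymp"
begin

section \<open>Alternating sums of gamma Laplace transforms\<close>

text \<open>The gamma mixture is never constructed. It is tested only on products of the functions 1
  - (1 - exp (- (\<theta> * x))) ^ m, which are polynomials in exp (- (\<theta> * x)): the mean of
  such a product is a finite signed combination of Laplace transforms, that is, of powers of the
  determinants in the definition of the process. With \<theta> proportional to log m these functions
  approach a decreasing step function as m grows. Shapes above \<alpha> only lower the mean, since
  gamma variables grow with their shape. The maximum principle does not by itself make K invertible,
  so K + \<eta> I is inverted and \<eta> sent to 0. The origin is the delicate point of the Fourier
  analysis, as the convergence is shown to be uniform only away from it. There the oddness of the
  sine part excludes an atom of the resolvent measure, and the hypothesis on H supplies the
  continuity of u that the passage to point charges needs.\<close>

definition gamma_alt_sum :: "real \<Rightarrow> real \<Rightarrow> nat \<Rightarrow> real \<Rightarrow> real" where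
  "gamma_alt_sum c \<tau> m a = (\<Sum>k\<le>m. (- 1) ^ k * real (m choose k) * (c + \<tau> * real k) powr (- a))"

lemma has_bochner_integral_Gamma:
  fixes a c :: real
  assumes "a > 0" "c > 0"
  shows "has_bochner_integral lborel (\<lambda>t. indicator {0..} t * t powr (a - 1) * exp (- (c * t)))
           (Gamma a * c powr (- a))"
proof -
  have 1: "has_bochner_integral lborel (\<lambda>t. indicator {0..} t * t powr (a - 1) / exp t) (Gamma a)"
    by (rule has_bochner_integral_nn_integral)
      (use assms in \<open>auto simp: Gamma_conv_nn_integral_real less_imp_le Gamma_real_pos\<close>)
  then have "has_bochner_integral lborel
      (\<lambda>t. indicator {0..} (0 + c * t) * (0 + c * t) powr (a - 1) / exp (0 + c * t)) (Gamma a /\<^sub>R \<bar>c\<bar>)"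
    using assms by (subst (asm) lborel_has_bochner_integral_real_affine_iff[where c = c and t = 0]) auto
  then have 2: "has_bochner_integral lborel
      (\<lambda>t. c powr (1 - a) * (indicator {0..} (0 + c * t) * (0 + c * t) powr (a - 1) / exp (0 + c * t)))
      (c powr (1 - a) * (Gamma a /\<^sub>R \<bar>c\<bar>))"
    by (intro has_bochner_integral_mult_right) auto
  have 3: "c powr (1 - a) * (indicator {0..} (0 + c * t) * (0 + c * t) powr (a - 1) / exp (0 + c * t)) =
      indicator {0..} t * t powr (a - 1) * exp (- (c * t))" for t
  proof (cases "t \<ge> 0")
    case True
    have "c powr (1 - a) * c powr (a - 1) = 1" using assms by (simp flip: powr_add)
    with True show ?thesis using assms
      by (simp add: powr_mult exp_minus divide_inverse mult_ac indicator_def)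
  next
    case False
    then show ?thesis using assms by (simp add: indicator_def zero_le_mult_iff)
  qed
  have 4: "c powr (1 - a) * (Gamma a /\<^sub>R \<bar>c\<bar>) = Gamma a * c powr (- a)"
    using assms by (simp add: powr_diff powr_minus field_simps)
  show ?thesis using 2 unfolding 3 4 .
qed

lemma has_bochner_integral_mono':
  fixes f g :: "'a \<Rightarrow> real"
  assumes "has_bochner_integral M f x" "has_bochner_integral M g y" "\<And>t. f t \<le> g t"
  shows "x \<le> y"
  using integral_mono[of M f g] assms by (auto simp: has_bochner_integral_iff)

text \<open>Binomial expansion of the power, integrated termwise. For c = 1 the alternating sum is
  thus the mean of (1 - exp (- (\<tau> * G))) ^ m, where G is gamma distributed with shape a and
  rate 1.\<close>

lemma has_bochner_integral_gamma_alt_sum: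
  assumes "a > 0" "c > 0" "\<tau> \<ge> 0"
  shows "has_bochner_integral lborel
           (\<lambda>t. indicator {0..} t * t powr (a - 1) * exp (- (c * t)) * (1 - exp (- (\<tau> * t))) ^ m)
           (Gamma a * gamma_alt_sum c \<tau> m a)"
proof -
  have 1: "has_bochner_integral lborel
     (\<lambda>t. \<Sum>k\<le>m. ((- 1) ^ k * real (m choose k)) *
            (indicator {0..} t * t powr (a - 1) * exp (- ((c + \<tau> * real k) * t))))
     (\<Sum>k\<le>m. ((- 1) ^ k * real (m choose k)) * (Gamma a * (c + \<tau> * real k) powr (- a)))"
    by (intro has_bochner_integral_sum has_bochner_integral_mult_right has_bochner_integral_Gamma)
      (use assms in \<open>auto intro: add_pos_nonneg\<close>)
  have 2: "(\<Sum>k\<le>m. ((- 1) ^ k * real (m choose k)) *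
            (indicator {0..} t * t powr (a - 1) * exp (- ((c + \<tau> * real k) * t)))) =
     indicator {0..} t * t powr (a - 1) * exp (- (c * t)) * (1 - exp (- (\<tau> * t))) ^ m" for t
  proof -
    have "(1 - exp (- (\<tau> * t))) ^ m = (- exp (- (\<tau> * t)) + 1) ^ m" by simp
    also have "\<dots> = (\<Sum>k\<le>m. real (m choose k) * (- exp (- (\<tau> * t))) ^ k * 1 ^ (m - k))"
      by (rule binomial_ring)
    also have "\<dots> = (\<Sum>k\<le>m. (- 1) ^ k * real (m choose k) * exp (- (\<tau> * real k * t)))"
      by (intro sum.cong refl)
        (simp add: power_minus[of "exp (- (\<tau> * t))"] exp_of_nat_mult[symmetric] mult_ac)
    moreover have "exp (- ((c + \<tau> * real k) * t)) = exp (- (c * t)) * exp (- (\<tau> * real k * t))" for k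
      by (simp add: algebra_simps flip: exp_add)
    ultimately show ?thesis
      by (simp only: sum_distrib_left) (intro sum.cong refl, simp add: mult_ac minus_add_distrib flip: exp_add distrib_left)
  qed
  show ?thesis
    using 1 unfolding 2 gamma_alt_sum_def sum_distrib_left by (simp add: mult_ac)
qed

lemma gamma_alt_sum_nonneg:
  assumes "a > 0" "c > 0" "\<tau> \<ge> 0"
  shows "0 \<le> gamma_alt_sum c \<tau> m a"
proof -
  have "0 \<le> Gamma a * gamma_alt_sum c \<tau> m a"
    unfolding has_bochner_integral_integral_eq[OF has_bochner_integral_gamma_alt_sum[OF assms], symmetric]
    by (rule integral_nonneg_AE) (use assms in \<open>auto simp: indicator_def\<close>)
  then show ?thesis using Gamma_real_pos[OF assms(1)] by (simp add: zero_le_mult_iff)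
qed

lemma gamma_alt_sum_le_1:
  assumes "a > 0" "\<tau> \<ge> 0"
  shows "gamma_alt_sum 1 \<tau> m a \<le> 1"
proof -
  have "Gamma a * gamma_alt_sum 1 \<tau> m a \<le> Gamma a * 1 powr (- a)"
    using has_bochner_integral_gamma_alt_sum[of a 1 \<tau> m] has_bochner_integral_Gamma[of a 1]
    by (rule has_bochner_integral_mono') (use assms in \<open>auto simp: indicator_def intro!: mult_left_le power_le_one\<close>)
  then show ?thesis using Gamma_real_pos[OF assms(1)] by simp
qed

text \<open>Integration by parts in disguise: the gamma densities of shapes a + 1 and a differ by
  the derivative of - t^a exp (- t) / Gamma (a + 1), and differentiating the power of 1 - exp (-
  (\<tau> * t)) gives the right-hand side. On coefficients this is the absorption identity for
  binomials.\<close>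

lemma gamma_alt_sum_Suc_arg:
  assumes "\<tau> \<ge> 0"
  shows "gamma_alt_sum 1 \<tau> (Suc m) (a + 1) - gamma_alt_sum 1 \<tau> (Suc m) a =
           \<tau> * real (Suc m) * gamma_alt_sum (1 + \<tau>) \<tau> m (a + 1)"
proof -
  define w where "w k = (1 + \<tau> * real k) powr (- (a + 1))" for k
  have w: "(1 + \<tau> * real k) powr (- a) = (1 + \<tau> * real k) * w k" for k
  proof -
    have "1 + \<tau> * real k > 0" using assms by (auto intro: add_pos_nonneg)
    then show ?thesis unfolding w_def by (simp add: powr_diff powr_minus powr_add divide_simps)
  qed
  have "gamma_alt_sum 1 \<tau> (Suc m) (a + 1) - gamma_alt_sum 1 \<tau> (Suc m) a =
     (\<Sum>k\<le>Suc m. - ((- 1) ^ k) * (real (Suc m choose k) * real k) * \<tau> * w k)"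
    unfolding gamma_alt_sum_def w w_def[symmetric] sum_subtractf[symmetric]
    by (intro sum.cong refl) (simp add: algebra_simps)
  also have "\<dots> = (\<Sum>k\<le>m. ((- 1) ^ k) * (real (Suc m choose Suc k) * real (Suc k)) * \<tau> * w (Suc k))"
    by (subst sum.atMost_Suc_shift) simp
  also have "\<dots> = (\<Sum>k\<le>m. ((- 1) ^ k) * (real (Suc m) * real (m choose k)) * \<tau> * w (Suc k))"
  proof (intro sum.cong refl)
    fix k
    have "real (Suc m choose Suc k) * real (Suc k) = real (Suc m) * real (m choose k)"
      using Suc_times_binomial_eq[of m k] by (metis of_nat_mult)
    then show "((- 1) ^ k) * (real (Suc m choose Suc k) * real (Suc k)) * \<tau> * w (Suc k) =
      ((- 1) ^ k) * (real (Suc m) * real (m choose k)) * \<tau> * w (Suc k)" by simp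
  qed
  also have "\<dots> = \<tau> * real (Suc m) * gamma_alt_sum (1 + \<tau>) \<tau> m (a + 1)"
    unfolding gamma_alt_sum_def sum_distrib_left w_def
    by (intro sum.cong refl) (simp add: algebra_simps)
  finally show ?thesis .
qed

text \<open>A gamma variable of larger shape is stochastically larger, and an increasing function is
  averaged; the nonnegative right-hand side of the preceding identity replaces a coupling. Integer
  steps suffice because the shapes that occur are \<alpha> plus natural numbers.\<close>

lemma gamma_alt_sum_mono:
  assumes "a > 0" "\<tau> \<ge> 0" "m > 0"
  shows "gamma_alt_sum 1 \<tau> m a \<le> gamma_alt_sum 1 \<tau> m (a + real k)"
proof (induction k)
  case (Suc k)
  obtain m' where m: "m = Suc m'" using \<open>m > 0\<close> by (cases m) auto
  have "0 \<le> \<tau> * real m * gamma_alt_sum (1 + \<tau>) \<tau> m' (a + real k + 1)"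
    using assms by (intro mult_nonneg_nonneg gamma_alt_sum_nonneg) auto
  then have "gamma_alt_sum 1 \<tau> m (a + real k) \<le> gamma_alt_sum 1 \<tau> m (a + real k + 1)"
    using gamma_alt_sum_Suc_arg[of \<tau> m' "a + real k"] assms m by simp
  with Suc show ?case by (simp add: algebra_simps)
qed simp

lemma gamma_alt_sum_lower_bound:
  assumes "a > 0" "\<tau> \<ge> 0" "z \<ge> 1"
  shows "exp (- 2 * z - 2) / Gamma a * (1 - exp (- (\<tau> * z))) ^ m \<le> gamma_alt_sum 1 \<tau> m a"
proof -
  define b where "b = exp (- 2 * z - 2) * (1 - exp (- (\<tau> * z))) ^ m"
  have 1: "has_bochner_integral lborel (\<lambda>t. b * indicator {z..z+1} t) (b * measure lborel {z..z+1})"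
    by (intro has_bochner_integral_mult_right has_bochner_integral_real_indicator) auto
  have 2: "b * indicator {z..z+1} t \<le>
      indicator {0..} t * t powr (a - 1) * exp (- (1 * t)) * (1 - exp (- (\<tau> * t))) ^ m" for t
  proof (cases "t \<in> {z..z+1}")
    case True
    then have t: "t \<ge> 1" "t \<ge> z" "t \<le> z + 1" using assms by auto
    \<comment> \<open>One factor exp (- t) is spent on bounding \<open>t powr (a - 1)\<close> from
      below, uniformly over all shapes a > 0. The two factors at t = z + 1 give the exponent - 2 * z
      - 2.\<close>
    have "exp (- t) \<le> t powr (- 1)"
      using t exp_ge_add_one_self[of t] by (simp add: powr_minus exp_minus del: exp_ge_add_one_self)
    also have "\<dots> \<le> t powr (a - 1)" using t assms by (intro powr_mono) auto
    finally have "exp (- t) * exp (- t) \<le> t powr (a - 1) * exp (- t)" by simp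
    moreover have "exp (- 2 * z - 2) \<le> exp (- t) * exp (- t)"
      using t by (simp flip: exp_add)
    ultimately have 1: "exp (- 2 * z - 2) \<le> t powr (a - 1) * exp (- t)" by (rule order.trans[rotated])
    have "(1 - exp (- (\<tau> * z))) ^ m \<le> (1 - exp (- (\<tau> * t))) ^ m"
      using t assms by (intro power_mono) (auto intro!: mult_left_mono)
    with 1 show ?thesis unfolding b_def using True t assms
      by (auto simp: indicator_def intro!: mult_mono)
  next
    case False
    then show ?thesis using assms by (auto simp: indicator_def)
  qed
  have "b * measure lborel {z..z+1} \<le> Gamma a * gamma_alt_sum 1 \<tau> m a"
    by (rule has_bochner_integral_mono'[OF 1 has_bochner_integral_gamma_alt_sum 2]) (use assms in auto)
  then have "b \<le> Gamma a * gamma_alt_sum 1 \<tau> m a" by simp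
  then show ?thesis using Gamma_real_pos[OF assms(1)] unfolding b_def by (simp add: divide_simps mult_ac)
qed

section \<open>Matrices satisfying the maximum principle\<close>

text \<open>Block elimination: \<open>E\<close> is the identity except for its last column, so it is
  unipotent, and \<open>F\<close> is block lower triangular. This is the induction step for
  determinants of the form det (I - T).\<close>

lemma det_Schur_last:
  fixes A :: "nat \<Rightarrow> nat \<Rightarrow> real"
  assumes "A n n \<noteq> 0"
  shows "Determinant.det (Matrix.mat (Suc n) (Suc n) (\<lambda>(i, j). A i j)) =
    A n n * Determinant.det (Matrix.mat n n (\<lambda>(i, j). A i j - A i n * A n j / A n n))"
proof -
  define E where "E = Matrix.mat (Suc n) (Suc n)
    (\<lambda>(i, k). if k = i then 1 else if k = n then A i n / A n n else 0 :: real)"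
  define B where "B = Matrix.mat n n (\<lambda>(i, j). A i j - A i n * A n j / A n n)"
  define F where "F = four_block_mat B (0\<^sub>m n 1) (Matrix.mat 1 n (\<lambda>(i, j). A n j)) (Matrix.mat 1 1 (\<lambda>_. A n n))"
  have F: "F \<in> carrier_mat (Suc n) (Suc n)" unfolding F_def B_def by auto
  have E: "E \<in> carrier_mat (Suc n) (Suc n)" unfolding E_def by auto
  have "Matrix.mat (Suc n) (Suc n) (\<lambda>(i, j). A i j) = E * F"
  proof (rule eq_matI)
    fix i j assume "i < dim_row (E * F)" "j < dim_col (E * F)"
    then have ij: "i < Suc n" "j < Suc n" using E F by auto
    have Fn: "F $$ (n, j) = A n j" using ij by (auto simp: F_def B_def less_Suc_eq)
    have Fk: "F $$ (k, j) = (if j < n then A k j - A k n * A n j / A n n else 0)" if "k < n" for k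
      using ij that by (auto simp: F_def B_def less_Suc_eq)
    have "(E * F) $$ (i, j) = (\<Sum>k<Suc n. E $$ (i, k) * F $$ (k, j))"
      using ij E F by (auto simp: scalar_prod_def lessThan_atLeast0 intro!: sum.cong)
    also have "\<dots> = (\<Sum>k<n. E $$ (i, k) * F $$ (k, j)) + E $$ (i, n) * A n j"
      by (simp add: Fn)
    also have "(\<Sum>k<n. E $$ (i, k) * F $$ (k, j)) = (\<Sum>k<n. if k = i then F $$ (i, j) else 0)"
      using ij by (intro sum.cong refl) (auto simp: E_def)
    also have "\<dots> = (if i < n then F $$ (i, j) else 0)"
      by (simp add: sum.delta)
    also have "\<dots> + E $$ (i, n) * A n j = A i j"
      using ij assms Fk by (cases "i = n"; cases "j = n") (auto simp: E_def less_Suc_eq)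
    finally show "Matrix.mat (Suc n) (Suc n) (\<lambda>(i, j). A i j) $$ (i, j) = (E * F) $$ (i, j)"
      using ij by simp
  qed (use E F in auto)
  then have "Determinant.det (Matrix.mat (Suc n) (Suc n) (\<lambda>(i, j). A i j)) = Determinant.det E * Determinant.det F"
    by (simp add: det_mult[OF E F])
  also have "Determinant.det E = 1"
    by (subst det_upper_triangular[OF _ E]) (auto simp: E_def prod_list_diag_prod)
  also have "Determinant.det F = Determinant.det B * Determinant.det (Matrix.mat 1 1 (\<lambda>_. A n n))"
    unfolding F_def by (rule det_four_block_mat_upper_right_zero) (auto simp: B_def)
  also have "Determinant.det (Matrix.mat 1 1 (\<lambda>_. A n n)) = A n n"
    by (subst det_single) auto
  finally show ?thesis by (simp add: B_def)
qed

lemma inverse_mult_mat_entries: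
  fixes A B :: "real mat"
  assumes "A \<in> carrier_mat n n" "B \<in> carrier_mat n n" "A * B = 1\<^sub>m n" "i < n" "j < n"
  shows "(\<Sum>k<n. A $$ (i, k) * B $$ (k, j)) = (if i = j then 1 else 0)"
proof -
  have "(A * B) $$ (i, j) = (\<Sum>k<n. A $$ (i, k) * B $$ (k, j))"
    using assms(1,2,4,5) by (auto simp: scalar_prod_def lessThan_atLeast0 intro!: sum.cong)
  then show ?thesis using assms by auto
qed

text \<open>\<open>cmp\<close> is a maximum principle for signed charges c with potential K c.
  Applied to charges read off from the inverse matrix, it yields the signs of a row diagonally
  dominant M-matrix; the gap \<delta> between diagonal and off-diagonal entries of K then bounds the
  diagonal of the inverse.\<close>

lemma max_principle_inverse:
  fixes K :: "nat \<Rightarrow> nat \<Rightarrow> real"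
  assumes cmp: "\<And>c a. 0 \<le> a \<Longrightarrow> \<forall>i<n. 0 < c i \<longrightarrow> (\<Sum>j<n. K i j * c j) \<le> a \<Longrightarrow>
                   \<forall>i<n. (\<Sum>j<n. K i j * c j) \<le> a"
    and diag: "\<And>i. i < n \<Longrightarrow> K i i = u"
    and off: "\<And>i j. i < n \<Longrightarrow> j < n \<Longrightarrow> i \<noteq> j \<Longrightarrow> K i j \<le> u - \<delta>"
    and n: "2 \<le> n" and \<delta>: "0 < \<delta>" and \<eta>: "0 < \<eta>"
  shows "\<exists>Q. (\<forall>i<n. \<forall>j<n. 0 \<le> Q i j) \<and> (\<forall>i<n. (\<Sum>j<n. Q i j) \<le> 1) \<and>
    Matrix.mat n n (\<lambda>(i, j). (if i = j then 1 else 0) - Q i j) *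
      Matrix.mat n n (\<lambda>(i, j). K i j + (if i = j then \<eta> else 0)) = \<delta> \<cdot>\<^sub>m 1\<^sub>m n"
proof -
  define L where "L = Matrix.mat n n (\<lambda>(i, j). K i j + (if i = j then \<eta> else 0))"
  have L: "L \<in> carrier_mat n n" by (simp add: L_def)
  have L_sum: "(\<Sum>k<n. L $$ (i, k) * c k) = (\<Sum>k<n. K i k * c k) + \<eta> * c i" if "i < n" for i and c :: "nat \<Rightarrow> real"
  proof -
    have "(\<Sum>k<n. L $$ (i, k) * c k) = (\<Sum>k<n. K i k * c k + (if k = i then \<eta> * c i else 0))"
      using that by (intro sum.cong) (auto simp: L_def algebra_simps)
    then show ?thesis using that by (simp add: sum.distrib)
  qed
  have "Determinant.det L \<noteq> 0"
  proof
    assume "Determinant.det L = 0"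
    then obtain w where w: "w \<in> carrier_vec n" "w \<noteq> 0\<^sub>v n" "L *\<^sub>v w = 0\<^sub>v n"
      using det_0_iff_vec_prod_zero[OF L] by auto
    define c where "c i = w $ i" for i
    have eq: "(\<Sum>k<n. K i k * c k) = - \<eta> * c i" if "i < n" for i
    proof -
      have "(L *\<^sub>v w) $ i = (\<Sum>k<n. L $$ (i, k) * c k)"
        using that L w(1) by (auto simp: scalar_prod_def c_def lessThan_atLeast0 intro!: sum.cong)
      then show ?thesis using w(3) that L_sum[OF that, of c] by simp
    qed
    \<comment> \<open>Since K c = - \<eta> c, the potential is negative where the charge is
      positive; the principle for c and for - c leaves only c = 0.\<close>
    have "\<forall>i<n. (\<Sum>k<n. K i k * c k) \<le> 0"
      by (rule cmp) (use eq \<eta> in \<open>auto simp: less_imp_le\<close>)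
    moreover have "\<forall>i<n. (\<Sum>k<n. K i k * - c k) \<le> 0"
      by (rule cmp) (use eq \<eta> in \<open>auto simp: less_imp_le sum_negf mult_le_0_iff\<close>)
    ultimately have "\<forall>i<n. c i = 0"
      using eq \<eta> by (fastforce simp: sum_negf zero_le_mult_iff mult_le_0_iff)
    then have "w = 0\<^sub>v n" using w(1) by (intro eq_vecI) (auto simp: c_def)
    with w(2) show False by simp
  qed
  from det_non_zero_imp_unit[OF L this, of "()"]
  obtain B where B: "B \<in> carrier_mat n n" "B * L = 1\<^sub>m n" "L * B = 1\<^sub>m n"
    unfolding Units_def ring_mat_def by auto
  define b where "b i j = B $$ (i, j)" for i j
  \<comment> \<open>The charge c = B g has potential K c = g - \<eta> c, which lies below g wherever
    c is positive, so \<open>cmp\<close> applies with any nonnegative upper bound a of g.\<close>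
  have bound: "g i - \<eta> * (\<Sum>j<n. b i j * g j) \<le> a" if "0 \<le> a" "\<forall>i<n. g i \<le> a" "i < n" for g a i
  proof -
    define c where "c i = (\<Sum>j<n. b i j * g j)" for i
    have eq: "(\<Sum>k<n. K i k * c k) = g i - \<eta> * c i" if "i < n" for i
    proof -
      have "(\<Sum>k<n. L $$ (i, k) * c k) = (\<Sum>j<n. (\<Sum>k<n. L $$ (i, k) * b k j) * g j)"
        unfolding c_def sum_distrib_left sum_distrib_right by (subst sum.swap) (simp add: mult_ac)
      also have "\<dots> = (\<Sum>j<n. if i = j then g j else 0)"
        using inverse_mult_mat_entries[OF L B(1,3) that] by (intro sum.cong) (auto simp: b_def)
      finally show ?thesis using L_sum[OF that, of c] that by simp
    qed
    have "\<forall>i<n. (\<Sum>k<n. K i k * c k) \<le> a"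
    proof (rule cmp)
      have "g i - \<eta> * c i \<le> a" if "i < n" "0 < c i" for i
        using mult_pos_pos[OF \<eta> that(2)] \<open>\<forall>i<n. g i \<le> a\<close> that(1) by fastforce
      then show "\<forall>i<n. 0 < c i \<longrightarrow> (\<Sum>k<n. K i k * c k) \<le> a"
        using eq by simp
    qed fact
    then show ?thesis using eq that(3) by (simp add: c_def)
  qed
  \<comment> \<open>The negative of the j-th unit vector, with a = 0, gives the off-diagonal signs;
    the constant 1, with a = 1, gives the row sums below.\<close>
  have b_off: "b i j \<le> 0" if "i < n" "j < n" "i \<noteq> j" for i j
  proof -
    have "(\<Sum>k<n. b i k * (if k = j then - 1 else 0)) = - b i j"
      using that by (simp add: if_distrib[of "\<lambda>x. b i _ * x"] sum.delta cong: if_cong)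
    then show ?thesis
      using bound[of 0 "\<lambda>k. if k = j then - 1 else 0" i] that \<eta> by (simp add: mult_le_0_iff)
  qed
  have b_row: "0 \<le> (\<Sum>j<n. b i j)" if "i < n" for i
    using bound[of 1 "\<lambda>_. 1" i] that \<eta> by (simp add: zero_le_mult_iff)
  have K_nonneg: "0 \<le> K i j" if "i < n" "j < n" for i j
  proof -
    have "\<forall>i<n. (\<Sum>k<n. K i k * (if k = j then - 1 else 0)) \<le> 0"
      by (rule cmp) auto
    moreover have "(\<Sum>k<n. K i k * (if k = j then - 1 else 0)) = - K i j"
      using that by (simp add: if_distrib[of "\<lambda>x. K i _ * x"] sum.delta cong: if_cong)
    ultimately show ?thesis using that by fastforce
  qed
  have u: "0 \<le> u - \<delta>"
    using K_nonneg[of 0 1] off[of 0 1] n by simp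
  have b_split: "(\<Sum>k<n. b i k * f k) = b i i * f i + (\<Sum>k\<in>{..<n} - {i}. b i k * f k)" if "i < n" for i f
    using that by (subst sum.remove[of _ i]) auto
  have b_diag: "\<delta> * b i i \<le> 1" if "i < n" for i
  proof -
    have *: "0 \<le> b i i + (\<Sum>k\<in>{..<n} - {i}. b i k)" using b_row[OF that] b_split[OF that, of "\<lambda>_. 1"] by simp
    then have "0 \<le> b i i" using sum_nonpos[of "{..<n} - {i}" "b i"] b_off that by fastforce
    \<comment> \<open>In the diagonal entry of B L = I, the off-diagonal entries of K are replaced
      by their bound u - \<delta> and the off-diagonal row sum of B by its lower bound - b i i. What
      remains is b i i * (\<eta> + \<delta>) \<le> 1.\<close>
    have "1 = (\<Sum>k<n. b i k * L $$ (k, i))"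
      using inverse_mult_mat_entries[OF B(1) L B(2) that that] by (simp add: b_def)
    also have "\<dots> = b i i * (u + \<eta>) + (\<Sum>k\<in>{..<n} - {i}. b i k * K k i)"
      unfolding b_split[OF that] using that by (auto simp: L_def diag intro!: sum.cong)
    also have "\<dots> \<ge> b i i * (u + \<eta>) + (\<Sum>k\<in>{..<n} - {i}. b i k * (u - \<delta>))"
      using that off b_off by (intro add_left_mono sum_mono mult_left_mono_neg) auto
    also have "(\<Sum>k\<in>{..<n} - {i}. b i k * (u - \<delta>)) = (\<Sum>k\<in>{..<n} - {i}. b i k) * (u - \<delta>)"
      by (simp add: sum_distrib_right)
    finally have "b i i * (u + \<eta>) + (\<Sum>k\<in>{..<n} - {i}. b i k) * (u - \<delta>) \<le> 1" .
    moreover have "(- b i i) * (u - \<delta>) \<le> (\<Sum>k\<in>{..<n} - {i}. b i k) * (u - \<delta>)"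
      using * u by (intro mult_right_mono) auto
    ultimately have "b i i * (\<eta> + \<delta>) \<le> 1" by (simp add: algebra_simps)
    then show ?thesis using mult_nonneg_nonneg[OF \<open>0 \<le> b i i\<close> less_imp_le[OF \<eta>]] by (simp add: algebra_simps)
  qed
  define Q where "Q i j = (if i = j then 1 else 0) - \<delta> * b i j" for i j
  have "\<forall>i<n. \<forall>j<n. 0 \<le> Q i j"
    using b_diag b_off \<delta> by (auto simp: Q_def mult_le_0_iff)
  moreover have "\<forall>i<n. (\<Sum>j<n. Q i j) \<le> 1"
    using b_row \<delta> by (simp add: Q_def sum_subtractf sum_distrib_left[symmetric])
  moreover have "Matrix.mat n n (\<lambda>(i, j). (if i = j then 1 else 0) - Q i j) * L = \<delta> \<cdot>\<^sub>m 1\<^sub>m n"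
  proof -
    have "Matrix.mat n n (\<lambda>(i, j). (if i = j then 1 else 0) - Q i j) = \<delta> \<cdot>\<^sub>m B"
      using B(1) by (intro eq_matI) (auto simp: Q_def b_def)
    then show ?thesis using B L by (metis mult_smult_assoc_mat)
  qed
  ultimately show ?thesis unfolding L_def by blast
qed

lemma tendsto_det_mat:
  assumes "\<And>i j. i < n \<Longrightarrow> j < n \<Longrightarrow> (\<lambda>k. A k i j) \<longlonglongrightarrow> (B i j :: real)"
  shows "(\<lambda>k. Determinant.det (Matrix.mat n n (\<lambda>(i, j). A k i j))) \<longlonglongrightarrow>
    Determinant.det (Matrix.mat n n (\<lambda>(i, j). B i j))"
proof -
  have *: "Determinant.det (Matrix.mat n n (\<lambda>(i, j). C i j)) =
      (\<Sum>p | p permutes {0..<n}. signof p * (\<Prod>i = 0..<n. C i (p i)))" for C :: "nat \<Rightarrow> nat \<Rightarrow> real"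
    by (subst det_def'[of _ n]) (auto intro!: sum.cong prod.cong dest: permutes_in_image)
  show ?thesis unfolding *
    using assms by (intro tendsto_intros) (auto dest: permutes_in_image)
qed

lemma one_plus_mult_mat_diag:
  "1\<^sub>m n + Matrix.mat n n (\<lambda>(i, j). K i j) * mat_diag n s =
    Matrix.mat n n (\<lambda>(i, j). (if i = j then 1 else 0) + K i j * (s j :: real))"
  by (subst mat_diag_mult_right[of _ n]) (auto intro!: eq_matI)

section \<open>Comparison with independent gamma variables\<close>

locale gamma_functional =
  fixes \<alpha> \<tau> :: real and n m :: nat
  assumes alpha: "\<alpha> > 0" and tau: "\<tau> \<ge> 0" and m: "m > 0"
begin

text \<open>
  The coefficients of \<open>1 - (1 - exp (- t)) ^ m\<close> as a polynomial in \<open>exp (- t)\<close>. Applied to a Laplace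
  transform sampled on a grid, \<open>Lam\<close> therefore returns the expectation of a product of decreasing
  functions of the coordinates.
\<close>

definition coef :: "nat \<Rightarrow> real" where
  "coef k = (if k = 0 then 0 else (- 1) ^ (k + 1) * real (m choose k))"

definition Lam :: "((nat \<Rightarrow> nat) \<Rightarrow> real) \<Rightarrow> real" where
  "Lam F = (\<Sum>h\<in>PiE {..<n} (\<lambda>_. {..m}). (\<Prod>i<n. coef (h i)) * F h)"

definition v :: "nat \<Rightarrow> (nat \<Rightarrow> nat) \<Rightarrow> real" where
  "v i h = 1 / (1 + \<tau> * real (h i))"

text \<open>\<open>v i h\<close> is the Laplace transform at \<tau> * h i of a standard exponential
  variable, so this is the transform of independent gamma variables with shapes \<alpha> + k
  i.\<close>

definition mon :: "(nat \<Rightarrow> nat) \<Rightarrow> (nat \<Rightarrow> nat) \<Rightarrow> real" where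
  "mon k h = (\<Prod>i<n. v i h powr (\<alpha> + real (k i)))"

text \<open>If F is a power series in the \<open>v i\<close> with nonnegative coefficients, its
  value at 0 is the sum of the coefficients, and the inequality bounds every monomial by the case of
  shapes \<alpha>. Quantifying over all k lets a factor \<open>v i\<close> be absorbed into the
  exponents.\<close>

definition good :: "((nat \<Rightarrow> nat) \<Rightarrow> real) \<Rightarrow> bool" where
  "good F \<longleftrightarrow> (\<forall>k. Lam (\<lambda>h. mon k h * F h) \<le> F (\<lambda>_. 0) * (1 - gamma_alt_sum 1 \<tau> m \<alpha>) ^ n)"

text \<open>
  Defining the cone by multiplication of good functions makes its closure under products and pointwise limits
  immediate, so that no expansion into multivariate power series in the \<open>v i\<close> is needed.
\<close>

definition pos_cone :: "((nat \<Rightarrow> nat) \<Rightarrow> real) set" where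
  "pos_cone = {F. \<forall>G. good G \<longrightarrow> good (\<lambda>h. F h * G h)}"

lemma Lam_add: "Lam (\<lambda>h. F h + G h) = Lam F + Lam G"
  by (simp add: Lam_def algebra_simps sum.distrib)

lemma Lam_cmult: "Lam (\<lambda>h. c * F h) = c * Lam F"
  by (simp add: Lam_def algebra_simps sum_distrib_left)

lemma Lam_tendsto:
  assumes "\<And>h. (\<lambda>j. F j h) \<longlonglongrightarrow> G h"
  shows "(\<lambda>j. Lam (F j)) \<longlonglongrightarrow> Lam G"
  unfolding Lam_def by (intro tendsto_intros assms)

lemma v_pos: "v i h > 0"
  using tau by (auto simp: v_def intro!: divide_pos_pos add_pos_nonneg)

lemma v_zero: "v i (\<lambda>_. 0) = 1"
  by (simp add: v_def)

lemma good_add: "good F \<Longrightarrow> good G \<Longrightarrow> good (\<lambda>h. F h + G h)"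
  unfolding good_def distrib_left distrib_right Lam_add by (blast intro: add_mono)

lemma good_cmult:
  assumes "good F" "c \<ge> 0"
  shows "good (\<lambda>h. c * F h)"
  unfolding good_def
proof
  fix k
  have "Lam (\<lambda>h. mon k h * (c * F h)) = c * Lam (\<lambda>h. mon k h * F h)"
    by (subst Lam_cmult[symmetric]) (simp only: mult.left_commute)
  then show "Lam (\<lambda>h. mon k h * (c * F h)) \<le> c * F (\<lambda>_. 0) * (1 - gamma_alt_sum 1 \<tau> m \<alpha>) ^ n"
    using assms mult_left_mono[of "Lam (\<lambda>h. mon k h * F h)" _ c] unfolding good_def
    by (simp only: mult.assoc)
qed

lemma good_tendsto:
  assumes "\<And>j. good (F j)" and lim: "\<And>h. (\<lambda>j. F j h) \<longlonglongrightarrow> G h"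
  shows "good G"
  unfolding good_def
proof
  fix k
  show "Lam (\<lambda>h. mon k h * G h) \<le> G (\<lambda>_. 0) * (1 - gamma_alt_sum 1 \<tau> m \<alpha>) ^ n"
  proof (rule LIMSEQ_le)
    show "(\<lambda>j. Lam (\<lambda>h. mon k h * F j h)) \<longlonglongrightarrow> Lam (\<lambda>h. mon k h * G h)"
      by (intro Lam_tendsto tendsto_intros lim)
    show "(\<lambda>j. F j (\<lambda>_. 0) * (1 - gamma_alt_sum 1 \<tau> m \<alpha>) ^ n) \<longlonglongrightarrow>
        G (\<lambda>_. 0) * (1 - gamma_alt_sum 1 \<tau> m \<alpha>) ^ n"
      by (intro tendsto_intros lim)
    show "\<exists>N. \<forall>j\<ge>N. Lam (\<lambda>h. mon k h * F j h) \<le> F j (\<lambda>_. 0) * (1 - gamma_alt_sum 1 \<tau> m \<alpha>) ^ n"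
      using assms(1) unfolding good_def by blast
  qed
qed

lemma good_v: assumes "good F" "i < n" shows "good (\<lambda>h. v i h * F h)"
  unfolding good_def
proof
  fix k
  have *: "(\<lambda>h. mon k h * (v i h * F h)) = (\<lambda>h. mon (k(i := Suc (k i))) h * F h)"
  proof
    fix h
    have "mon (k(i := Suc (k i))) h = mon k h * v i h"
      using assms(2) v_pos[of i h] unfolding mon_def
      by (simp add: prod.remove[of "{..<n}" i] powr_add powr_realpow algebra_simps)
    then show "mon k h * (v i h * F h) = mon (k(i := Suc (k i))) h * F h" by simp
  qed
  show "Lam (\<lambda>h. mon k h * (v i h * F h)) \<le> v i (\<lambda>_. 0) * F (\<lambda>_. 0) * (1 - gamma_alt_sum 1 \<tau> m \<alpha>) ^ n"
    using assms(1) unfolding * by (simp add: good_def v_zero)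
qed

lemma sum_coef: "(\<Sum>k\<le>m. coef k * (1 / (1 + \<tau> * real k)) powr a) = 1 - gamma_alt_sum 1 \<tau> m a"
proof -
  have "(1 / (1 + \<tau> * real k)) powr a = (1 + \<tau> * real k) powr (- a)" for k
    using tau by (subst powr_minus_divide) (simp add: powr_divide add_nonneg_nonneg)
  then have "(\<Sum>k\<le>m. coef k * (1 / (1 + \<tau> * real k)) powr a) + gamma_alt_sum 1 \<tau> m a =
    (\<Sum>k\<le>m. if k = 0 then 1 else 0)"
    unfolding gamma_alt_sum_def sum.distrib[symmetric] coef_def
    by (intro sum.cong refl) auto
  then show ?thesis by simp
qed

lemma Lam_prod: "Lam (\<lambda>h. \<Prod>i<n. f i (h i)) = (\<Prod>i<n. \<Sum>k\<le>m. coef k * f i k)"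
  unfolding Lam_def by (subst prod_sum_PiE) (auto simp: prod.distrib)

text \<open>On a product of one-dimensional transforms the functional factorises, and each factor
  decreases when its shape grows. This is where the stochastic ordering of gamma laws
  enters.\<close>

lemma good_1: "good (\<lambda>_. 1)"
  unfolding good_def
proof
  fix k
  have "Lam (\<lambda>h. mon k h * 1) = (\<Prod>i<n. 1 - gamma_alt_sum 1 \<tau> m (\<alpha> + real (k i)))"
    unfolding mon_def v_def mult_1_right
    by (subst Lam_prod[of "\<lambda>i j. (1 / (1 + \<tau> * real j)) powr (\<alpha> + real (k i))"])
      (simp add: sum_coef)
  also have "\<dots> \<le> (\<Prod>i<n. 1 - gamma_alt_sum 1 \<tau> m \<alpha>)"
    using alpha tau m
    by (intro prod_mono) (auto intro!: gamma_alt_sum_le_1 gamma_alt_sum_mono)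
  finally show "Lam (\<lambda>h. mon k h * 1) \<le> 1 * (1 - gamma_alt_sum 1 \<tau> m \<alpha>) ^ n"
    by simp
qed

lemma pos_cone_const: "c \<ge> 0 \<Longrightarrow> (\<lambda>_. c) \<in> pos_cone"
  by (auto simp: pos_cone_def good_cmult)

lemma pos_cone_v: "i < n \<Longrightarrow> v i \<in> pos_cone"
  by (auto simp: pos_cone_def good_v)

lemma pos_cone_add: "F \<in> pos_cone \<Longrightarrow> G \<in> pos_cone \<Longrightarrow> (\<lambda>h. F h + G h) \<in> pos_cone"
  by (auto simp: pos_cone_def distrib_right intro: good_add)

lemma pos_cone_mult: "F \<in> pos_cone \<Longrightarrow> G \<in> pos_cone \<Longrightarrow> (\<lambda>h. F h * G h) \<in> pos_cone"
  by (auto simp: pos_cone_def mult.assoc)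

lemma pos_cone_sum: "(\<And>j. j \<in> J \<Longrightarrow> F j \<in> pos_cone) \<Longrightarrow> (\<lambda>h. \<Sum>j\<in>J. F j h) \<in> pos_cone"
  by (induction J rule: infinite_finite_induct) (auto intro: pos_cone_const pos_cone_add)

lemma pos_cone_power: "F \<in> pos_cone \<Longrightarrow> (\<lambda>h. F h ^ j) \<in> pos_cone"
  by (induction j) (auto intro: pos_cone_const pos_cone_mult)

lemma pos_cone_tendsto:
  assumes "\<And>j. F j \<in> pos_cone" "\<And>h. (\<lambda>j. F j h) \<longlonglongrightarrow> G h"
  shows "G \<in> pos_cone"
  unfolding pos_cone_def
proof (clarify)
  fix H assume "good H"
  show "good (\<lambda>h. G h * H h)"
    by (rule good_tendsto[where F = "\<lambda>j h. F j h * H h"])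
      (use assms \<open>good H\<close> in \<open>auto simp: pos_cone_def intro!: tendsto_intros\<close>)
qed

lemma pos_cone_sums:
  assumes "\<And>j. F j \<in> pos_cone" "\<And>h. (\<lambda>j. F j h) sums G h"
  shows "G \<in> pos_cone"
  by (rule pos_cone_tendsto[where F = "\<lambda>j h. \<Sum>i<j. F i h"])
    (use assms in \<open>auto simp: sums_def intro: pos_cone_sum\<close>)

text \<open>The binomial series of (1 - x) powr (- a) has the nonnegative coefficients pochhammer a
  j / fact j.\<close>

lemma pos_cone_one_minus_powr:
  assumes F: "F \<in> pos_cone" and rng: "\<And>h. 0 \<le> F h" "\<And>h. F h < 1" and "a > 0"
  shows "(\<lambda>h. (1 - F h) powr (- a)) \<in> pos_cone"
proof (rule pos_cone_sums[where F = "\<lambda>j h. pochhammer a j / fact j * F h ^ j"])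
  show "(\<lambda>h. pochhammer a j / fact j * F h ^ j) \<in> pos_cone" for j
    using assms by (intro pos_cone_mult pos_cone_const pos_cone_power) (auto intro!: divide_nonneg_pos pochhammer_nonneg)
  fix h
  have "(\<lambda>j. (- a gchoose j) * (- F h) ^ j) sums (1 + - F h) powr (- a)"
    using rng[of h] by (intro gen_binomial_real) auto
  moreover have "(- a gchoose j) * (- F h) ^ j = pochhammer a j / fact j * F h ^ j" for j
  proof -
    have "(- a gchoose j) * (- F h) ^ j = ((- 1) ^ j * (- 1) ^ j) * pochhammer a j / fact j * F h ^ j"
      by (simp add: gbinomial_pochhammer power_minus[of "F h"])
    then show ?thesis by (simp flip: power_mult_distrib)
  qed
  ultimately show "(\<lambda>j. pochhammer a j / fact j * F h ^ j) sums (1 - F h) powr (- a)"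
    by simp
qed

text \<open>Eliminating the last index replaces T by the kernel of the chain watched on the
  remaining states, where excursions to N contribute T i N * T N j / (1 - T N N). This kernel
  inherits all three hypotheses, and the pivot 1 - T N N contributes a factor to which the binomial
  series applies.\<close>

lemma det_one_minus_pos_cone:
  assumes "\<And>i j. i < N \<Longrightarrow> j < N \<Longrightarrow> T i j \<in> pos_cone"
    and "\<And>i j h. i < N \<Longrightarrow> j < N \<Longrightarrow> 0 \<le> T i j h"
    and "\<And>i h. i < N \<Longrightarrow> (\<Sum>j<N. T i j h) < 1"
  shows "(\<forall>h. 0 < Determinant.det (Matrix.mat N N (\<lambda>(i, j). (if i = j then 1 else 0) - T i j h))) \<and>
    (\<lambda>h. Determinant.det (Matrix.mat N N (\<lambda>(i, j). (if i = j then 1 else 0) - T i j h)) powr (- \<alpha>)) \<in> pos_cone"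
  using assms
proof (induction N arbitrary: T)
  case 0
  then show ?case by (simp add: pos_cone_const)
next
  case (Suc N)
  define p where "p h = 1 - T N N h" for h
  have p: "0 < p h" "p h \<le> 1" for h
  proof -
    have "T N N h \<le> (\<Sum>j<Suc N. T N j h)"
      using Suc.prems(2) by (intro member_le_sum) auto
    then show "0 < p h" using Suc.prems(3)[of N h] by (simp add: p_def)
    show "p h \<le> 1" using Suc.prems(2)[of N N h] by (simp add: p_def)
  qed
  define T' where "T' i j h = T i j h + T i N h * T N j h * p h powr (- 1)" for i j h
  have p1: "(\<lambda>h. p h powr (- a)) \<in> pos_cone" if "a > 0" for a
    unfolding p_def using p Suc.prems that
    by (intro pos_cone_one_minus_powr) (auto simp: p_def)
  have schur: "Determinant.det (Matrix.mat (Suc N) (Suc N) (\<lambda>(i, j). (if i = j then 1 else 0) - T i j h)) =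
     p h * Determinant.det (Matrix.mat N N (\<lambda>(i, j). (if i = j then 1 else 0) - T' i j h))" for h
  proof -
    have "Matrix.mat N N (\<lambda>(i, j). (if i = j then 1 else 0) - T i j h -
        ((if i = N then 1 else 0) - T i N h) * ((if N = j then 1 else 0) - T N j h) /
        ((if N = N then 1 else 0) - T N N h)) =
      Matrix.mat N N (\<lambda>(i, j). (if i = j then 1 else 0) - T' i j h)"
      using p[of h] by (intro cong_mat) (auto simp: T'_def p_def powr_minus divide_simps algebra_simps)
    then show ?thesis
      using p[of h] det_Schur_last[of "\<lambda>i j. (if i = j then 1 else 0) - T i j h" N] by (simp add: p_def)
  qed
  have IH: "(\<forall>h. 0 < Determinant.det (Matrix.mat N N (\<lambda>(i, j). (if i = j then 1 else 0) - T' i j h))) \<and>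
    (\<lambda>h. Determinant.det (Matrix.mat N N (\<lambda>(i, j). (if i = j then 1 else 0) - T' i j h)) powr (- \<alpha>)) \<in> pos_cone"
  proof (rule Suc.IH)
    show "T' i j \<in> pos_cone" if "i < N" "j < N" for i j
      unfolding T'_def using that Suc.prems(1) p1[of 1]
      by (intro pos_cone_add pos_cone_mult) auto
    show "0 \<le> T' i j h" if "i < N" "j < N" for i j h
      unfolding T'_def using that Suc.prems(2) by auto
    show "(\<Sum>j<N. T' i j h) < 1" if "i < N" for i h
    proof -
      \<comment> \<open>Row N leaves at most 1 - T N N for the other columns, so an excursion to N
        returns at most the mass that entered it.\<close>
      have "(\<Sum>j<N. T N j h) \<le> p h" using Suc.prems(3)[of N h] by (simp add: p_def)
      then have "(\<Sum>j<N. T N j h) / p h \<le> 1" using p[of h] by simp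
      then have "T i N h * ((\<Sum>j<N. T N j h) / p h) \<le> T i N h * 1"
        using Suc.prems(2)[of i N h] that by (intro mult_left_mono) auto
      moreover have "(\<Sum>j<N. T' i j h) = (\<Sum>j<N. T i j h) + T i N h * ((\<Sum>j<N. T N j h) / p h)"
        using p[of h]
        by (simp add: T'_def sum.distrib sum_distrib_left sum_divide_distrib powr_minus divide_inverse mult_ac)
      ultimately show ?thesis using Suc.prems(3)[of i h] that by simp
    qed
  qed
  have "(\<lambda>h. p h powr (- \<alpha>) * Determinant.det (Matrix.mat N N (\<lambda>(i, j). (if i = j then 1 else 0) - T' i j h)) powr (- \<alpha>)) \<in> pos_cone"
    using IH alpha by (intro pos_cone_mult p1) auto
  then show ?case
    unfolding schur using IH p by (auto simp: powr_mult less_imp_le)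
qed

text \<open>
  Shifting the arguments by \<open>\<eta>\<close> makes the row sums of \<open>T\<close> strictly less than 1; the shift disappears
  in the limit below.
\<close>

lemma Lam_det_le:
  fixes K Q :: "nat \<Rightarrow> nat \<Rightarrow> real"
  assumes d: "d > 0" and \<eta>: "\<eta> > 0"
    and Q: "\<And>i j. i < n \<Longrightarrow> j < n \<Longrightarrow> 0 \<le> Q i j" "\<And>i. i < n \<Longrightarrow> (\<Sum>j<n. Q i j) \<le> 1"
    and inv: "Matrix.mat n n (\<lambda>(i, j). (if i = j then 1 else 0) - Q i j) * Matrix.mat n n (\<lambda>(i, j). K i j) =
      (1 / d) \<cdot>\<^sub>m 1\<^sub>m n"
  defines "D \<equiv> \<lambda>h. Determinant.det (1\<^sub>m n + Matrix.mat n n (\<lambda>(i, j). K i j) *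
      mat_diag n (\<lambda>i. \<tau> * (d + \<eta>) * real (h i) + \<eta>))"
  shows "Lam (\<lambda>h. (D h / D (\<lambda>_. 0)) powr (- \<alpha>)) \<le> (1 - gamma_alt_sum 1 \<tau> m \<alpha>) ^ n"
proof -
  define T where "T i j h = v i h * (Q i j * (d / (d + \<eta>)))" for i j h
  define IT where "IT h = Matrix.mat n n (\<lambda>(i, j). (if i = j then 1 else 0) - T i j h)" for h
  define IQ where "IQ = Matrix.mat n n (\<lambda>(i, j). (if i = j then 1 else 0) - Q i j)"
  have v_le: "v i h \<le> 1" for i h
    using mult_nonneg_nonneg[OF tau, of "real (h i)"] by (simp add: v_def divide_le_eq)
  have r: "0 < d / (d + \<eta>)" "d / (d + \<eta>) < 1" using d \<eta> by auto
  have IT: "(\<forall>h. 0 < Determinant.det (IT h)) \<and> (\<lambda>h. Determinant.det (IT h) powr (- \<alpha>)) \<in> pos_cone"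
    unfolding IT_def
  proof (rule det_one_minus_pos_cone)
    show "T i j \<in> pos_cone" if "i < n" "j < n" for i j
      unfolding T_def using that Q r by (intro pos_cone_mult pos_cone_v pos_cone_const) auto
    show "0 \<le> T i j h" if "i < n" "j < n" for i j h
      unfolding T_def using that Q r v_pos[of i h] by (intro mult_nonneg_nonneg) auto
    show "(\<Sum>j<n. T i j h) < 1" if "i < n" for i h
    proof -
      have "(\<Sum>j<n. T i j h) = v i h * ((\<Sum>j<n. Q i j) * (d / (d + \<eta>)))"
        by (simp only: T_def sum_distrib_left sum_distrib_right)
      also have "\<dots> \<le> 1 * (1 * (d / (d + \<eta>)))"
        using that Q v_le[of i h] v_pos[of i h] r
        by (intro mult_mono mult_nonneg_nonneg sum_nonneg) auto
      finally show ?thesis using r by simp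
    qed
  qed
  define e where "e h i = (d + \<eta>) / (d * v i h)" for h i
  \<comment> \<open>Since (I - Q) K = I / d, multiplying I + K S by I - Q gives I - Q + S / d.
    Factoring the coefficient \<open>e h i\<close> = 1 + s_i / d out of row i turns Q into
    T.\<close>
  have key: "Determinant.det IQ * D h = ((d + \<eta>) / d) ^ n * (\<Prod>i<n. 1 / v i h) * Determinant.det (IT h)" for h
  proof -
    have v: "1 / v i h = 1 + \<tau> * real (h i)" for i by (simp add: v_def)
    let ?K = "Matrix.mat n n (\<lambda>(i, j). K i j)"
    let ?S = "mat_diag n (\<lambda>i. \<tau> * (d + \<eta>) * real (h i) + \<eta>)"
    have S: "?S \<in> carrier_mat n n" by simp
    have KS: "?K * ?S \<in> carrier_mat n n" by (rule mult_carrier_mat[of _ n n]) auto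
    have "IQ * (1\<^sub>m n + ?K * ?S) = IQ * 1\<^sub>m n + IQ * (?K * ?S)"
      by (rule mult_add_distrib_mat[of _ n n _ n]) (use KS in \<open>auto simp: IQ_def\<close>)
    also have "IQ * (?K * ?S) = (IQ * ?K) * ?S"
      by (rule assoc_mult_mat[symmetric, of _ n n _ n _ n]) (auto simp: IQ_def)
    also have "IQ * ?K = (1 / d) \<cdot>\<^sub>m 1\<^sub>m n" unfolding IQ_def by (rule inv)
    also have "(1 / d) \<cdot>\<^sub>m 1\<^sub>m n * ?S = (1 / d) \<cdot>\<^sub>m ?S"
      using S by (metis left_mult_one_mat mult_smult_assoc_mat one_carrier_mat)
    also have "IQ * 1\<^sub>m n + (1 / d) \<cdot>\<^sub>m ?S = mat_diag n (e h) * IT h"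
    proof -
      have [simp]: "IQ \<in> carrier_mat n n" "IT h \<in> carrier_mat n n" by (auto simp: IQ_def IT_def)
      have 2: "(d + \<eta>) / (d * v i h) = (d + \<eta>) / d * (1 + \<tau> * real (h i))" for i
        using v[of i] by (metis times_divide_times_eq mult.right_neutral)
      have 3: "e h i * T i j h = Q i j" for i j
        using r d \<eta> v_pos[of i h] by (simp add: e_def T_def)
      have 4: "mat_diag n (e h) * IT h = Matrix.mat n n (\<lambda>(i, j). e h i * IT h $$ (i, j))"
        by (rule mat_diag_mult_left) simp
      have 5: "e h i * IT h $$ (i, j) = (if i = j then e h i else 0) - Q i j" if "i < n" "j < n" for i j
        using that 3[of i j] by (simp add: IT_def right_diff_distrib)
      have 6: "e h i = 1 + 1 / d * (\<tau> * (d + \<eta>) * real (h i) + \<eta>)" for i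
        unfolding e_def 2 using d by (simp add: field_simps)
      show ?thesis
        unfolding 4
        by (rule eq_matI) (use 5 6 in \<open>auto simp: IQ_def mat_diag_def\<close>)
    qed
    finally have "Determinant.det (IQ * (1\<^sub>m n + ?K * ?S)) = Determinant.det (mat_diag n (e h) * IT h)" by simp
    also have "\<dots> = Determinant.det (mat_diag n (e h)) * Determinant.det (IT h)"
      by (rule det_mult[of _ n]) (auto simp: IT_def)
    also have "Determinant.det (mat_diag n (e h)) = (\<Prod>i<n. e h i)"
      by (subst det_upper_triangular[of _ n])
        (auto simp: mat_diag_def prod_list_diag_prod lessThan_atLeast0)
    also have "\<dots> = ((d + \<eta>) / d) ^ n * (\<Prod>i<n. 1 / v i h)"
      by (simp add: e_def prod_dividef power_divide prod.distrib)
    also have "Determinant.det (IQ * (1\<^sub>m n + ?K * ?S)) = Determinant.det IQ * D h"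
      unfolding D_def by (rule det_mult[of _ n]) (use KS in \<open>auto simp: IQ_def\<close>)
    finally show ?thesis .
  qed
  have pos: "0 < Determinant.det IQ * D h" for h
    unfolding key using IT d \<eta> v_pos by (intro mult_pos_pos prod_pos zero_less_power divide_pos_pos) auto
  \<comment> \<open>The determinant of I - Q and the powers of (d + \<eta>) / d cancel in the
    quotient. The normalisation by D at h = 0 is there because the shift makes that argument
    nonzero.\<close>
  have ratio: "(D h / D (\<lambda>_. 0)) powr (- \<alpha>) = mon (\<lambda>_. 0) h * Determinant.det (IT h) powr (- \<alpha>) /
      Determinant.det (IT (\<lambda>_. 0)) powr (- \<alpha>)" for h
  proof -
    have "D h / D (\<lambda>_. 0) = (Determinant.det IQ * D h) / (Determinant.det IQ * D (\<lambda>_. 0))"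
      using pos[of h] by (cases "Determinant.det IQ = 0") auto
    also have "\<dots> = (\<Prod>i<n. 1 / v i h) * Determinant.det (IT h) / Determinant.det (IT (\<lambda>_. 0))"
      unfolding key using d \<eta> by (simp add: v_zero)
    also have "\<dots> powr (- \<alpha>) = (\<Prod>i<n. 1 / v i h) powr (- \<alpha>) * Determinant.det (IT h) powr (- \<alpha>) /
      Determinant.det (IT (\<lambda>_. 0)) powr (- \<alpha>)"
      using IT v_pos by (simp add: powr_divide powr_mult less_imp_le prod_nonneg)
    also have "(\<Prod>i<n. 1 / v i h) powr (- \<alpha>) = mon (\<lambda>_. 0) h"
    proof -
      have "0 < (\<Prod>i<n. v i h)" using v_pos by (intro prod_pos) auto
      then show ?thesis
        unfolding mon_def using v_pos
        by (subst prod_powr_distrib[symmetric])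
          (auto simp: less_imp_le prod_dividef powr_divide powr_minus divide_simps)
    qed
    finally show ?thesis .
  qed
  have "good (\<lambda>h. Determinant.det (IT h) powr (- \<alpha>) * 1)"
    using IT good_1 unfolding pos_cone_def by blast
  then have "Lam (\<lambda>h. mon (\<lambda>_. 0) h * (Determinant.det (IT h) powr (- \<alpha>))) \<le>
    Determinant.det (IT (\<lambda>_. 0)) powr (- \<alpha>) * (1 - gamma_alt_sum 1 \<tau> m \<alpha>) ^ n"
    unfolding good_def by simp
  moreover have "Lam (\<lambda>h. (D h / D (\<lambda>_. 0)) powr (- \<alpha>)) =
      1 / Determinant.det (IT (\<lambda>_. 0)) powr (- \<alpha>) * Lam (\<lambda>h. mon (\<lambda>_. 0) h * (Determinant.det (IT h) powr (- \<alpha>)))"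
    unfolding Lam_cmult[symmetric] ratio by simp
  moreover have "Determinant.det (IT (\<lambda>_. 0)) powr (- \<alpha>) > 0" using IT by (metis powr_gt_zero less_irrefl)
  moreover have "x \<le> g" if "L \<le> c * g" "x = 1 / c * L" "c > 0" for x g c L :: real
    using that mult_le_cancel_left_pos[of c x g] by simp
  ultimately show ?thesis by blast
qed

text \<open>Both perturbations, of the kernel and of the arguments, vanish as \<eta> tends to 0. The
  rate is d = 1 / \<delta>, and the normalising determinant tends to det I = 1.\<close>

lemma Lam_det_le_of_max_principle:
  fixes K :: "nat \<Rightarrow> nat \<Rightarrow> real"
  assumes cmp: "\<And>c a. 0 \<le> a \<Longrightarrow> \<forall>i<n. 0 < c i \<longrightarrow> (\<Sum>j<n. K i j * c j) \<le> a \<Longrightarrow>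
                   \<forall>i<n. (\<Sum>j<n. K i j * c j) \<le> a"
    and diag: "\<And>i. i < n \<Longrightarrow> K i i = u"
    and off: "\<And>i j. i < n \<Longrightarrow> j < n \<Longrightarrow> i \<noteq> j \<Longrightarrow> K i j \<le> u - \<delta>"
    and n: "2 \<le> n" and \<delta>: "0 < \<delta>"
  defines "D \<equiv> \<lambda>h. Determinant.det (1\<^sub>m n + Matrix.mat n n (\<lambda>(i, j). K i j) *
      mat_diag n (\<lambda>i. \<tau> / \<delta> * real (h i)))"
  assumes D_nz: "\<And>h. D h \<noteq> 0"
  shows "Lam (\<lambda>h. D h powr (- \<alpha>)) \<le> (1 - gamma_alt_sum 1 \<tau> m \<alpha>) ^ n"
proof -
  define \<eta> where "\<eta> k = 1 / real (Suc k)" for k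
  have \<eta>: "\<eta> k > 0" for k by (simp add: \<eta>_def)
  have \<eta>_lim: "\<eta> \<longlonglongrightarrow> 0" unfolding \<eta>_def by real_asymp
  define D' where "D' k h = Determinant.det (1\<^sub>m n + Matrix.mat n n (\<lambda>(i, j). K i j + (if i = j then \<eta> k else 0)) *
      mat_diag n (\<lambda>i. \<tau> * (1 / \<delta> + \<eta> k) * real (h i) + \<eta> k))" for k h
  have "Lam (\<lambda>h. (D' k h / D' k (\<lambda>_. 0)) powr (- \<alpha>)) \<le> (1 - gamma_alt_sum 1 \<tau> m \<alpha>) ^ n" for k
  proof -
    obtain Q where Q: "\<forall>i<n. \<forall>j<n. 0 \<le> Q i j" "\<forall>i<n. (\<Sum>j<n. Q i j) \<le> 1"
      "Matrix.mat n n (\<lambda>(i, j). (if i = j then 1 else 0) - Q i j) *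
      Matrix.mat n n (\<lambda>(i, j). K i j + (if i = j then \<eta> k else 0)) = \<delta> \<cdot>\<^sub>m 1\<^sub>m n"
      using max_principle_inverse[OF cmp diag off n \<delta> \<eta>[of k]] by blast
    show ?thesis
      unfolding D'_def using Lam_det_le[of "1 / \<delta>" "\<eta> k" Q "\<lambda>i j. K i j + (if i = j then \<eta> k else 0)"] \<delta> \<eta>[of k] Q
      by simp
  qed
  moreover have "(\<lambda>k. Lam (\<lambda>h. (D' k h / D' k (\<lambda>_. 0)) powr (- \<alpha>))) \<longlonglongrightarrow> Lam (\<lambda>h. (D h / 1) powr (- \<alpha>))"
  proof (rule Lam_tendsto)
    fix h
    have 1: "(\<lambda>k. D' k h) \<longlonglongrightarrow> Determinant.det (1\<^sub>m n + Matrix.mat n n (\<lambda>(i, j). K i j + (if i = j then 0 else 0)) *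
      mat_diag n (\<lambda>i. \<tau> * (1 / \<delta> + 0) * real (h i) + 0))" for h
      unfolding D'_def one_plus_mult_mat_diag
    proof (rule tendsto_det_mat)
      fix i j :: nat
      have "(\<lambda>k. if i = j then \<eta> k else 0) \<longlonglongrightarrow> (if i = j then 0 else 0)"
        using \<eta>_lim by (cases "i = j") auto
      then show "(\<lambda>k. (if i = j then 1 else 0) + (K i j + (if i = j then \<eta> k else 0)) *
          (\<tau> * (1 / \<delta> + \<eta> k) * real (h j) + \<eta> k)) \<longlonglongrightarrow>
        (if i = j then 1 else 0) + (K i j + (if i = j then 0 else 0)) * (\<tau> * (1 / \<delta> + 0) * real (h j) + 0)"
        by (intro tendsto_intros \<eta>_lim)
    qed
    have "(\<lambda>k. D' k (\<lambda>_. 0)) \<longlonglongrightarrow> 1"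
      using 1[of "\<lambda>_. 0"] unfolding one_plus_mult_mat_diag
      by (simp add: one_mat_def[symmetric])
    moreover have "(\<lambda>k. D' k h) \<longlonglongrightarrow> D h"
      using 1[of h] unfolding D_def by simp
    ultimately show "(\<lambda>k. (D' k h / D' k (\<lambda>_. 0)) powr (- \<alpha>)) \<longlonglongrightarrow> (D h / 1) powr (- \<alpha>)"
      using D_nz by (intro tendsto_intros) auto
  qed
  ultimately show ?thesis
    by (intro LIMSEQ_le_const2) auto
qed

section \<open>Small ball probabilities of permanental processes\<close>

lemma sum_coef_exp: "(\<Sum>k\<le>m. coef k * exp (- (real k * t))) = 1 - (1 - exp (- t)) ^ m"
proof -
  have "(1 - exp (- t)) ^ m = (- exp (- t) + 1) ^ m" by simp
  also have "\<dots> = (\<Sum>k\<le>m. real (m choose k) * (- exp (- t)) ^ k * 1 ^ (m - k))"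
    by (rule binomial_ring)
  also have "\<dots> = (\<Sum>k\<le>m. (- 1) ^ k * real (m choose k) * exp (- (real k * t)))"
    by (intro sum.cong refl)
      (simp add: power_minus[of "exp (- t)"] exp_of_nat_mult[symmetric] mult_ac)
  finally have *: "(1 - exp (- t)) ^ m = (\<Sum>k\<le>m. (- 1) ^ k * real (m choose k) * exp (- (real k * t)))" .
  have "(\<Sum>k\<le>m. coef k * exp (- (real k * t))) + (1 - exp (- t)) ^ m =
      (\<Sum>k\<le>m. if k = 0 then 1 else 0)"
    unfolding * sum.distrib[symmetric] coef_def by (intro sum.cong refl) auto
  then show ?thesis by simp
qed

text \<open>Taking means on both sides brings in the Laplace transform of X at the arguments
  \<theta> * h i only, where it is given by determinants.\<close>

lemma prod_eq_Lam:
  "(\<Prod>i<n. 1 - (1 - exp (- (\<theta> * X i))) ^ m) = Lam (\<lambda>h. exp (- (\<Sum>i<n. \<theta> * real (h i) * X i)))"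
proof -
  have "(\<lambda>h. exp (- (\<Sum>i<n. \<theta> * real (h i) * X i))) = (\<lambda>h. \<Prod>i<n. exp (- (real (h i) * (\<theta> * X i))))"
    by (simp add: exp_sum[symmetric] sum_negf[symmetric] mult_ac)
  then show ?thesis
    by (simp add: Lam_prod[of "\<lambda>i k. exp (- (real k * (\<theta> * X i)))"] sum_coef_exp)
qed

end

text \<open>Markov's inequality for a product of decreasing functions: on the event each factor is
  at least its value at y, and the functional bounds the mean. The scaling \<theta> = \<tau> /
  \<delta> turns comparison variables of rate 1 / \<delta> into standard gamma variables.\<close>

lemma permanental_small_ball_mult:
  fixes X :: "real \<Rightarrow> 'b \<Rightarrow> real" and x :: "nat \<Rightarrow> real"
  assumes perm: "permanental_process N X \<alpha> k" and \<alpha>: "0 < \<alpha>"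
    and cmp: "\<And>c a. 0 \<le> a \<Longrightarrow> \<forall>i<n. 0 < c i \<longrightarrow> (\<Sum>j<n. k (x i) (x j) * c j) \<le> a \<Longrightarrow>
                   \<forall>i<n. (\<Sum>j<n. k (x i) (x j) * c j) \<le> a"
    and diag: "\<And>i. i < n \<Longrightarrow> k (x i) (x i) = u"
    and off: "\<And>i j. i < n \<Longrightarrow> j < n \<Longrightarrow> i \<noteq> j \<Longrightarrow> k (x i) (x j) \<le> u - \<delta>"
    and n: "2 \<le> n" and \<delta>: "0 < \<delta>" and m: "0 < m" and \<tau>: "0 < \<tau>"
  shows "measure N {\<omega> \<in> space N. \<forall>i<n. X (x i) \<omega> \<le> y} * (1 - (1 - exp (- (\<tau> / \<delta> * y))) ^ m) ^ n \<le>
    (1 - gamma_alt_sum 1 \<tau> m \<alpha>) ^ n"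
proof (cases "y \<ge> 0")
  case False
  have empty: "{\<omega> \<in> space N. \<forall>i<n. X (x i) \<omega> \<le> y} = {}"
    using perm False n unfolding permanental_process_def
    by (auto intro!: exI[of _ 0]) (meson not_le order.trans)
  show ?thesis unfolding empty using gamma_alt_sum_le_1[of \<alpha> \<tau> m] \<alpha> \<tau> by simp
next
  case y: True
  interpret gamma_functional \<alpha> \<tau> n m
    using \<alpha> \<tau> m by unfold_locales auto
  interpret N: prob_space N using perm by (simp add: permanental_process_def)
  have meas[measurable]: "X t \<in> borel_measurable N" for t using perm by (simp add: permanental_process_def)
  have X_nonneg: "0 \<le> X t \<omega>" if "\<omega> \<in> space N" for t \<omega> using perm that by (simp add: permanental_process_def)
  define \<theta> where "\<theta> = \<tau> / \<delta>"
  have \<theta>: "\<theta> > 0" using \<tau> \<delta> by (simp add: \<theta>_def)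
  define D where "D h = Determinant.det (1\<^sub>m n + Matrix.mat n n (\<lambda>(i, j). k (x i) (x j)) *
      mat_diag n (\<lambda>i. \<theta> * real (h i)))" for h
  have int: "integrable N (\<lambda>\<omega>. exp (- (\<Sum>i<n. \<theta> * real (h i) * X (x i) \<omega>)))" for h
    by (rule N.integrable_const_bound[where B = 1])
      (use X_nonneg \<theta> in \<open>auto intro!: AE_I2 sum_nonneg\<close>)
  have D: "N.expectation (\<lambda>\<omega>. exp (- (\<Sum>i<n. \<theta> * real (h i) * X (x i) \<omega>))) = D h powr (- \<alpha>)" for h
    using perm \<theta> unfolding permanental_process_def D_def by simp
  \<comment> \<open>By convention \<open>0 powr (- \<alpha>)\<close> is 0, so a vanishing
    determinant would make the mean of a strictly positive variable 0.\<close>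
  have D_nz: "D h \<noteq> 0" for h
  proof
    assume "D h = 0"
    then have "N.expectation (\<lambda>\<omega>. exp (- (\<Sum>i<n. \<theta> * real (h i) * X (x i) \<omega>))) = 0"
      using D[of h] by simp
    then have "AE \<omega> in N. exp (- (\<Sum>i<n. \<theta> * real (h i) * X (x i) \<omega>)) = 0"
      by (subst (asm) integral_nonneg_eq_0_iff_AE[OF int]) auto
    then have "AE \<omega> in N. False" by simp
    then show False by simp
  qed
  define Z where "Z \<omega> = (\<Prod>i<n. 1 - (1 - exp (- (\<theta> * X (x i) \<omega>))) ^ m)" for \<omega>
  have Z_int: "integrable N Z" and Z_exp: "N.expectation Z = Lam (\<lambda>h. D h powr (- \<alpha>))"
    unfolding Z_def prod_eq_Lam Lam_def D[symmetric] using int by auto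
  have "Lam (\<lambda>h. D h powr (- \<alpha>)) \<le> (1 - gamma_alt_sum 1 \<tau> m \<alpha>) ^ n"
    using Lam_det_le_of_max_principle[of "\<lambda>i j. k (x i) (x j)" u \<delta>, OF cmp diag off n \<delta>] D_nz
    unfolding D_def \<theta>_def by blast
  then have "N.expectation Z \<le> (1 - gamma_alt_sum 1 \<tau> m \<alpha>) ^ n" by (simp add: Z_exp)
  moreover have "measure N {\<omega> \<in> space N. \<forall>i<n. X (x i) \<omega> \<le> y} * (1 - (1 - exp (- (\<theta> * y))) ^ m) ^ n \<le> N.expectation Z"
  proof -
    define A where "A = {\<omega> \<in> space N. \<forall>i<n. X (x i) \<omega> \<le> y}"
    have A[measurable]: "A \<in> sets N" unfolding A_def by measurable
    define b where "b = (1 - (1 - exp (- (\<theta> * y))) ^ m) ^ n"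
    have factor: "0 \<le> 1 - (1 - exp (- (\<theta> * t))) ^ m" if "0 \<le> t" for t
      using that \<theta> by (simp add: power_le_one)
    have "measure N A * b = N.expectation (\<lambda>\<omega>. indicator A \<omega> * b)" by simp
    also have "\<dots> \<le> N.expectation Z"
    proof (rule integral_mono)
      show "integrable N (\<lambda>\<omega>. indicator A \<omega> * b)" by (simp add: N.emeasure_finite less_top[symmetric])
      fix \<omega> assume \<omega>: "\<omega> \<in> space N"
      show "indicator A \<omega> * b \<le> Z \<omega>"
      proof (cases "\<omega> \<in> A")
        case True
        have "(\<Prod>i<n. 1 - (1 - exp (- (\<theta> * y))) ^ m) \<le> Z \<omega>"
          unfolding Z_def
        proof (intro prod_mono conjI factor y diff_left_mono power_mono diff_left_mono)
          fix i assume "i \<in> {..<n}"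
          then have "X (x i) \<omega> \<le> y" using True by (simp add: A_def)
          then show "exp (- (\<theta> * y)) \<le> exp (- (\<theta> * X (x i) \<omega>))" using \<theta> by simp
          show "0 \<le> 1 - exp (- (\<theta> * X (x i) \<omega>))" using X_nonneg[OF \<omega>] \<theta> by simp
        qed
        then show ?thesis using True by (simp add: b_def)
      next
        case False
        then show ?thesis unfolding Z_def using factor X_nonneg[OF \<omega>] by (auto intro!: prod_nonneg)
      qed
    qed fact
    finally show ?thesis unfolding A_def b_def .
  qed
  ultimately show ?thesis unfolding \<theta>_def by linarith
qed

text \<open>The bound is the one for n independent variables that each exceed y with probability at
  least exp (- 2 * z - 3) / Gamma \<alpha>. It arises from the preceding one by letting m tend to
  infinity.\<close>

lemma permanental_small_ball:
  fixes X :: "real \<Rightarrow> 'b \<Rightarrow> real" and x :: "nat \<Rightarrow> real"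
  assumes perm: "permanental_process N X \<alpha> k" and \<alpha>: "0 < \<alpha>"
    and cmp: "\<And>c a. 0 \<le> a \<Longrightarrow> \<forall>i<n. 0 < c i \<longrightarrow> (\<Sum>j<n. k (x i) (x j) * c j) \<le> a \<Longrightarrow>
                   \<forall>i<n. (\<Sum>j<n. k (x i) (x j) * c j) \<le> a"
    and diag: "\<And>i. i < n \<Longrightarrow> k (x i) (x i) = u"
    and off: "\<And>i j. i < n \<Longrightarrow> j < n \<Longrightarrow> i \<noteq> j \<Longrightarrow> k (x i) (x j) \<le> u - \<delta>"
    and n: "2 \<le> n" and \<delta>: "0 < \<delta>" and z: "1 \<le> z" "2 * y / \<delta> \<le> z"
  shows "measure N {\<omega> \<in> space N. \<forall>i<n. X (x i) \<omega> \<le> y} \<le> (1 - exp (- 2 * z - 3) / Gamma \<alpha>) ^ n"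
proof -
  define P where "P = measure N {\<omega> \<in> space N. \<forall>i<n. X (x i) \<omega> \<le> y}"
  have bound: "P * (1 - (1 - real m powr (- 1 / 2)) ^ m) ^ n \<le>
      (1 - exp (- 2 * z - 2) / Gamma \<alpha> * (1 - 1 / real m) ^ m) ^ n" if m: "m \<ge> 2" for m
  proof -
    \<comment> \<open>With this choice the test function tends to 1 at \<open>y\<close> as \<open>m\<close> grows, while the
      mean of its complement under the gamma distribution keeps a positive fraction of the tail beyond \<open>z\<close>.\<close>
    define \<tau> where "\<tau> = ln (real m) / z"
    have \<tau>: "0 < \<tau>" using m z by (simp add: \<tau>_def)
    have "\<tau> * z = ln (real m)" using z by (simp add: \<tau>_def)
    then have e1: "exp (- (\<tau> * z)) = 1 / real m"
      using m by (simp add: exp_minus divide_inverse)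
    \<comment> \<open>The factor 2 between y / \<delta> and z makes the exponential at y at least
      the square root of 1 / m, its value at z: z is the edge of the limiting step and y lies
      strictly inside.\<close>
    have "\<tau> / \<delta> * y = \<tau> / 2 * (2 * y / \<delta>)" by simp
    also have "\<dots> \<le> \<tau> / 2 * z" using \<tau> z by (intro mult_left_mono) auto
    also have "\<dots> = ln (real m) / 2" using z by (simp add: \<tau>_def)
    finally have e2: "real m powr (- 1 / 2) \<le> exp (- (\<tau> / \<delta> * y))"
      using m by (simp add: powr_def)
    have "P * (1 - (1 - real m powr (- 1 / 2)) ^ m) ^ n \<le> P * (1 - (1 - exp (- (\<tau> / \<delta> * y))) ^ m) ^ n"
      if "y \<ge> 0"
    proof (intro mult_left_mono power_mono diff_left_mono)
      show "0 \<le> 1 - exp (- (\<tau> / \<delta> * y))" using that \<tau> \<delta> by simp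
      have "real m powr (- 1 / 2) \<le> 1" using m by (simp add: powr_le_one_le ge_one_powr_ge_zero powr_minus_divide)
      then show "0 \<le> 1 - (1 - real m powr (- 1 / 2)) ^ m" by (simp add: power_le_one)
    qed (use e2 in \<open>auto simp: P_def\<close>)
    moreover have "P = 0" if "\<not> y \<ge> 0"
    proof -
      have empty: "{\<omega> \<in> space N. \<forall>i<n. X (x i) \<omega> \<le> y} = {}"
        using perm that n unfolding permanental_process_def
        by (auto intro!: exI[of _ 0]) (meson not_le order.trans)
      show ?thesis unfolding P_def empty by simp
    qed
    ultimately have "P * (1 - (1 - real m powr (- 1 / 2)) ^ m) ^ n \<le> P * (1 - (1 - exp (- (\<tau> / \<delta> * y))) ^ m) ^ n"
      by (cases "y \<ge> 0") auto
    also have "\<dots> \<le> (1 - gamma_alt_sum 1 \<tau> m \<alpha>) ^ n"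
      unfolding P_def using m \<tau>
      by (intro permanental_small_ball_mult[where k = k and u = u] perm \<alpha> cmp diag off n \<delta>) auto
    also have "\<dots> \<le> (1 - exp (- 2 * z - 2) / Gamma \<alpha> * (1 - 1 / real m) ^ m) ^ n"
      using gamma_alt_sum_lower_bound[of \<alpha> \<tau> z m] gamma_alt_sum_le_1[of \<alpha> \<tau> m] \<alpha> \<tau> z e1
      by (intro power_mono) auto
    finally show ?thesis .
  qed
  \<comment> \<open>As m * m powr (- 1 / 2) tends to infinity, the factor multiplying P tends to 1;
    the limit exp (- 1) of (1 - 1 / m) ^ m turns the exponent - 2 * z - 2 into - 2 * z - 3.\<close>
  have "(\<lambda>m. P * (1 - (1 - real m powr (- 1 / 2)) ^ m) ^ n) \<longlonglongrightarrow> P * (1 - 0) ^ n"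
  proof (intro tendsto_intros)
    show "(\<lambda>m. (1 - real m powr (- 1 / 2)) ^ m) \<longlonglongrightarrow> 0" by real_asymp
  qed
  moreover have "(\<lambda>m. (1 - exp (- 2 * z - 2) / Gamma \<alpha> * (1 - 1 / real m) ^ m) ^ n) \<longlonglongrightarrow>
      (1 - exp (- 2 * z - 2) / Gamma \<alpha> * exp (- 1)) ^ n"
  proof (intro tendsto_intros)
    show "(\<lambda>m. (1 - 1 / real m) ^ m) \<longlonglongrightarrow> exp (- 1)"
      using tendsto_exp_limit_sequentially[of "- 1"] by simp
  qed
  ultimately have "P * (1 - 0) ^ n \<le> (1 - exp (- 2 * z - 2) / Gamma \<alpha> * exp (- 1)) ^ n"
    by (rule LIMSEQ_le) (use bound in blast)
  moreover have "exp (- 2 * z - 3) = exp (- 2 * z - 2) * exp (- 1)"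
    by (subst exp_add[symmetric]) (simp add: algebra_simps)
  ultimately show ?thesis by (simp add: P_def)
qed

section \<open>Levy exponents and resolvent measures\<close>

lemma has_bochner_integral_exp_complex:
  fixes c :: complex
  assumes c: "0 < Re c"
  shows "has_bochner_integral lborel (\<lambda>t. indicator {0..} t *\<^sub>R exp (- (complex_of_real t * c))) (1 / c)"
proof -
  let ?f = "\<lambda>t. exp (- (complex_of_real t * c))"
  have [simp]: "c \<noteq> 0" using c by auto
  have int: "set_integrable lborel {0..} ?f"
    unfolding set_integrable_def
  proof (rule Bochner_Integration.integrable_bound)
    show "integrable lborel (\<lambda>t. indicator {0..} t * t powr (1 - 1) * exp (- (Re c * t)))"
      using has_bochner_integral_Gamma[of 1 "Re c"] c by (simp add: has_bochner_integral_iff)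
    \<comment> \<open>By convention \<open>0 powr 0\<close> is 0, so the domination fails at the
      point 0.\<close>
    have "AE t in lborel. t \<noteq> (0::real)" by (rule AE_lborel_singleton)
    then show "AE t in lborel. norm (indicator {0..} t *\<^sub>R ?f t) \<le>
        norm (indicator {0..} t * t powr (1 - 1) * exp (- (Re c * t)))"
      by eventually_elim (auto simp: indicator_def mult.commute)
  qed auto
  have "((\<lambda>b. set_lebesgue_integral lborel {0..b} ?f) \<longlongrightarrow> set_lebesgue_integral lborel {0..} ?f) at_top"
    by (rule tendsto_set_lebesgue_integral_at_top[OF _ int]) auto
  moreover have "\<forall>\<^sub>F b in at_top. set_lebesgue_integral lborel {0..b} ?f = (1 - exp (- (complex_of_real b * c))) / c"
    using eventually_ge_at_top[of 0]
  proof eventually_elim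
    case (elim b)
    have "(\<integral>t. indicator {0..b} t *\<^sub>R ?f t \<partial>lborel) = - ?f b / c - - ?f 0 / c"
    proof (rule integral_FTC_Icc[OF elim])
      show "((\<lambda>t. - ?f t / c) has_vector_derivative ?f x) (at x within {0..b})" for x
        by (auto intro!: derivative_eq_intros has_vector_derivative_real_field simp: field_simps)
    qed (intro continuous_intros)
    then show ?case by (simp add: set_lebesgue_integral_def field_simps)
  qed
  ultimately have "((\<lambda>b. (1 - exp (- (complex_of_real b * c))) / c) \<longlongrightarrow> set_lebesgue_integral lborel {0..} ?f) at_top"
    by (rule Lim_transform_eventually)
  moreover have "((\<lambda>b. (1 - exp (- (complex_of_real b * c))) / c) \<longlongrightarrow> (1 - 0) / c) at_top"
  proof (intro tendsto_intros)
    have "((\<lambda>b. exp (- (Re c * b))) \<longlongrightarrow> 0) at_top" using c by real_asymp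
    then show "((\<lambda>b. exp (- (complex_of_real b * c))) \<longlongrightarrow> 0) at_top"
      by (rule Lim_null_comparison[rotated]) (auto simp: mult.commute)
  qed simp
  ultimately have "set_lebesgue_integral lborel {0..} ?f = 1 / c"
    by (intro tendsto_unique[of at_top]) auto
  then show ?thesis using int by (simp add: has_bochner_integral_iff set_integrable_def set_lebesgue_integral_def)
qed

lemma integral_cos_sin_eq_char:
  assumes "real_distribution M"
  shows "(\<integral>x. cos (v * x) \<partial>M) = Re (char M v)" "(\<integral>x. sin (v * x) \<partial>M) = Im (char M v)"
proof -
  interpret real_distribution M by fact
  have "integrable M (\<lambda>x. iexp (v * x))" by (intro integrable_iexp) auto
  then show "(\<integral>x. cos (v * x) \<partial>M) = Re (char M v)" "(\<integral>x. sin (v * x) \<partial>M) = Im (char M v)"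
    unfolding char_def by (subst integral_Re[symmetric] integral_Im[symmetric]; simp add: Re_exp Im_exp)+
qed

lemma integral_distr_add:
  fixes h :: "real \<Rightarrow> 'a :: {banach, second_countable_topology}"
  assumes \<kappa>: "real_distribution \<kappa>" and \<rho>: "real_distribution \<rho>"
    and h[measurable]: "h \<in> borel_measurable borel" and bd: "\<And>x. norm (h x) \<le> B"
  shows "(\<integral>z. h z \<partial>distr (\<kappa> \<Otimes>\<^sub>M \<rho>) borel (\<lambda>(x, y). x + y)) = (\<integral>x. (\<integral>y. h (x + y) \<partial>\<rho>) \<partial>\<kappa>)"
proof -
  interpret \<kappa>: real_distribution \<kappa> by fact
  interpret \<rho>: real_distribution \<rho> by fact
  interpret pair: pair_prob_space \<kappa> \<rho> ..
  have "integrable (\<kappa> \<Otimes>\<^sub>M \<rho>) (\<lambda>(x, y). h (x + y))"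
    by (rule pair.P.integrable_const_bound[where B = B]) (auto simp: bd)
  from pair.integral_fst'[OF this] show ?thesis
    by (subst integral_distr) (auto simp: case_prod_beta')
qed

text \<open>By uniqueness of characteristic functions, \<rho> is the law of one step of law
  \<kappa>, after which one stops with probability p and otherwise adds an independent variable of
  law \<rho>. The formula is this first-step decomposition.\<close>

lemma integral_add_mixture:
  fixes f :: "real \<Rightarrow> real"
  assumes \<kappa>: "real_distribution \<kappa>" and \<rho>: "real_distribution \<rho>" and p: "0 < p" "p < 1"
    and char_eq: "\<And>v. char \<rho> v = p * char \<kappa> v + (1 - p) * (char \<kappa> v * char \<rho> v)"
    and f[measurable]: "f \<in> borel_measurable borel" and bd: "\<And>x. \<bar>f x\<bar> \<le> b"
  shows "(\<integral>x. f x \<partial>\<rho>) = p * (\<integral>x. f x \<partial>\<kappa>) + (1 - p) * (\<integral>x. (\<integral>y. f (x + y) \<partial>\<rho>) \<partial>\<kappa>)"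
proof -
  interpret \<kappa>: real_distribution \<kappa> by fact
  interpret \<rho>: real_distribution \<rho> by fact
  interpret pair: pair_prob_space \<kappa> \<rho> ..
  define conv where "conv = distr (\<kappa> \<Otimes>\<^sub>M \<rho>) borel (\<lambda>(x, y). x + y)"
  interpret conv: real_distribution conv
    unfolding conv_def by (rule pair.real_distribution_distr) measurable
  note fubini = integral_distr_add[OF \<kappa> \<rho>, folded conv_def]
  have char_conv: "char conv v = char \<kappa> v * char \<rho> v" for v
  proof -
    have "char conv v = (\<integral>x. (\<integral>y. iexp (v * x) * iexp (v * y) \<partial>\<rho>) \<partial>\<kappa>)"
      unfolding char_def by (subst fubini[where B = 1]) (auto simp: distrib_left exp_add)
    then show ?thesis by (simp add: char_def)
  qed
  define mix where "mix = measure_pmf (bernoulli_pmf p) \<bind> (\<lambda>b. if b then \<kappa> else conv)"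
  have sub: "(\<lambda>b. if b then \<kappa> else conv) \<in> measure_pmf (bernoulli_pmf p) \<rightarrow>\<^sub>M subprob_algebra borel"
    by (auto simp: space_subprob_algebra prob_space_imp_subprob_space \<kappa>.prob_space_axioms conv.prob_space_axioms)
  have mix_int: "(\<integral>x. h x \<partial>mix) = p * (\<integral>x. h x \<partial>\<kappa>) + (1 - p) * (\<integral>x. h x \<partial>conv)"
    if [measurable]: "h \<in> borel_measurable borel" and "\<And>x. \<bar>h x\<bar> \<le> B" for h :: "real \<Rightarrow> real" and B
  proof -
    have 1: "emeasure (if b then \<kappa> else conv) (space (if b then \<kappa> else conv)) \<le> ennreal 1" for b
      using \<kappa>.emeasure_space_1 conv.emeasure_space_1 by (cases b) simp_all
    have "(\<integral>x. h x \<partial>mix) = (\<integral>b. (\<integral>x. h x \<partial>(if b then \<kappa> else conv)) \<partial>bernoulli_pmf p)"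
      unfolding mix_def
      by (rule integral_bind[where K = borel and B = B and B' = 1, OF _ _ sub])
        (use 1 in \<open>auto simp: that(2) measure_pmf.finite_measure_axioms simp del: space_borel split del: if_split intro!: AE_I2\<close>)
    also have "\<dots> = p * (\<integral>x. h x \<partial>\<kappa>) + (1 - p) * (\<integral>x. h x \<partial>conv)"
      using p by (subst integral_bernoulli_pmf) auto
    finally show ?thesis .
  qed
  have mix_rd: "real_distribution mix"
  proof -
    have "prob_space mix" unfolding mix_def
      by (rule measure_pmf.prob_space_bind[OF _ sub])
        (auto intro!: AE_I2 \<kappa>.prob_space_axioms conv.prob_space_axioms)
    moreover have "sets mix = sets borel" unfolding mix_def
      by (subst sets_bind[where N = borel]) auto
    ultimately show ?thesis by (simp add: real_distribution_def real_distribution_axioms_def)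
  qed
  have "char mix = char \<rho>"
  proof
    fix v
    have "Re (char mix v) = p * Re (char \<kappa> v) + (1 - p) * Re (char conv v)"
      unfolding integral_cos_sin_eq_char[OF mix_rd, symmetric] integral_cos_sin_eq_char[OF \<kappa>, symmetric]
        integral_cos_sin_eq_char[OF conv.real_distribution_axioms, symmetric]
      by (rule mix_int[OF _ abs_cos_le_one]) auto
    moreover have "Im (char mix v) = p * Im (char \<kappa> v) + (1 - p) * Im (char conv v)"
      unfolding integral_cos_sin_eq_char[OF mix_rd, symmetric] integral_cos_sin_eq_char[OF \<kappa>, symmetric]
        integral_cos_sin_eq_char[OF conv.real_distribution_axioms, symmetric]
      by (rule mix_int[OF _ abs_sin_le_one]) auto
    ultimately show "char mix v = char \<rho> v"
      by (subst char_eq) (simp add: complex_eq_iff char_conv)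
  qed
  from Levy_uniqueness[OF mix_rd \<rho> this] have "mix = \<rho>" .
  then show ?thesis using mix_int[OF f bd] fubini[of f b] bd by simp
qed

locale char_semigroup =
  fixes \<mu> :: "real \<Rightarrow> real measure" and \<psi> :: "real \<Rightarrow> complex"
  assumes distr: "\<And>t. 0 \<le> t \<Longrightarrow> real_distribution (\<mu> t)"
    and char: "\<And>t v. 0 \<le> t \<Longrightarrow> char (\<mu> t) v = exp (- (complex_of_real t * \<psi> v))"
begin

lemma Re_nonneg: "0 \<le> Re (\<psi> v)"
proof -
  interpret real_distribution "\<mu> 1" by (rule distr) simp
  have "norm (char (\<mu> 1) v) \<le> 1" by (rule cmod_char_le_1)
  then show ?thesis by (simp add: char)
qed

lemma denominator_nonzero: "0 < q \<Longrightarrow> complex_of_real q + \<psi> v \<noteq> 0"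
  using Re_nonneg[of v] by (auto simp: complex_eq_iff)

text \<open>The derivative of the characteristic functions at time 0 recovers \<psi> without any
  choice of a complex logarithm.\<close>

lemma tendsto_generator: "(\<lambda>k. real (Suc k) * (1 - char (\<mu> (1 / real (Suc k))) v)) \<longlonglongrightarrow> \<psi> v"
proof (cases "\<psi> v = 0")
  case True
  then show ?thesis by (simp add: char)
next
  case False
  define h where "h k = - (\<psi> v / real (Suc k))" for k
  have h0: "h \<longlonglongrightarrow> 0"
    unfolding h_def using LIMSEQ_Suc[OF lim_const_over_n[of "\<psi> v"]] by (auto intro: tendsto_minus_cancel)
  have "((\<lambda>h. (exp (0 + h) - exp 0) / h) \<longlongrightarrow> exp (0 :: complex)) (at 0)"
    using DERIV_exp[of "0 :: complex"] unfolding DERIV_def .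
  moreover have "filterlim h (at 0) sequentially"
    using h0 False by (auto simp: filterlim_at h_def simp del: of_nat_Suc)
  ultimately have "(\<lambda>k. (exp (h k) - 1) / h k) \<longlonglongrightarrow> 1"
    by (auto dest: filterlim_compose)
  then have "(\<lambda>k. \<psi> v * ((exp (h k) - 1) / h k)) \<longlonglongrightarrow> \<psi> v * 1"
    by (intro tendsto_intros)
  moreover have "\<psi> v * ((exp (h k) - 1) / h k) = real (Suc k) * (1 - char (\<mu> (1 / real (Suc k))) v)" for k
  proof -
    have "char (\<mu> (1 / real (Suc k))) v = exp (h k)" by (simp add: char h_def)
    then show ?thesis using False by (simp add: h_def divide_simps del: of_nat_Suc) (simp add: algebra_simps)
  qed
  ultimately show ?thesis by simp
qed

text \<open>The expression 1 - e^(iax) - e^(isx) + e^(i(a+s)x) factors as (1 - e^(iax)) (1 -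
  e^(isx)), and |1 - e^(it)|^2 = 2 (1 - cos t). The weighted inequality 2xy \<le> r x^2 + y^2 / r is
  averaged over the law at a small time and passed to the generator, so no Levy-Khintchine
  representation enters.\<close>

lemma norm_increment_le:
  assumes r: "0 < r"
  shows "norm (\<psi> (a + s) - \<psi> a - \<psi> s) \<le> r * Re (\<psi> a) + Re (\<psi> s) / r"
proof -
  let ?\<phi> = "\<lambda>k. char (\<mu> (1 / real (Suc k)))"
  have bound: "norm (1 - ?\<phi> k a - ?\<phi> k s + ?\<phi> k (a + s)) \<le> r * (1 - Re (?\<phi> k a)) + (1 - Re (?\<phi> k s)) / r" for k
  proof -
    define M where "M = \<mu> (1 / real (Suc k))"
    interpret real_distribution M unfolding M_def by (rule distr) simp
    have i: "integrable M (\<lambda>x. iexp (v * x))" for v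
    proof (rule integrable_iexp)
      show "(\<lambda>x. complex_of_real (v * x)) \<in> borel_measurable M" by measurable
    qed simp
    have ic: "integrable M (\<lambda>x. cos (v * x))" for v
    proof (rule integrable_const_bound[where B = 1])
      show "(\<lambda>x. cos (v * x)) \<in> borel_measurable M" by measurable
    qed simp
    have "1 - char M a - char M s + char M (a + s) =
        (\<integral>x. 1 - iexp (a * x) - iexp (s * x) + iexp ((a + s) * x) \<partial>M)"
      unfolding char_def using i[of a] i[of s] i[of "a + s"] prob_space by simp
    also have "norm \<dots> \<le> (\<integral>x. norm (1 - iexp (a * x) - iexp (s * x) + iexp ((a + s) * x)) \<partial>M)"
      by (rule integral_norm_bound)
    also have "\<dots> \<le> (\<integral>x. r * (1 - cos (a * x)) + (1 - cos (s * x)) / r \<partial>M)"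
    proof (rule integral_mono)
      fix x
      have e: "(norm (1 - iexp t))\<^sup>2 = 2 * (1 - cos t)" for t
        using sin_cos_squared_add[of t] by (simp add: cmod_power2 Re_exp Im_exp power2_diff)
      have "1 - iexp (a * x) - iexp (s * x) + iexp ((a + s) * x) = (1 - iexp (a * x)) * (1 - iexp (s * x))"
        by (simp add: algebra_simps exp_add)
      then have "norm (1 - iexp (a * x) - iexp (s * x) + iexp ((a + s) * x)) =
          norm (1 - iexp (a * x)) * norm (1 - iexp (s * x))" by (simp only: norm_mult)
      also have "\<dots> \<le> (r * (norm (1 - iexp (a * x)))\<^sup>2 + (norm (1 - iexp (s * x)))\<^sup>2 / r) / 2"
      proof -
        have "0 \<le> (r * norm (1 - iexp (a * x)) - norm (1 - iexp (s * x)))\<^sup>2" by simp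
        also have "\<dots> = r * (r * (norm (1 - iexp (a * x)))\<^sup>2 + (norm (1 - iexp (s * x)))\<^sup>2 / r) -
            2 * r * (norm (1 - iexp (a * x)) * norm (1 - iexp (s * x)))"
          using r by (simp add: power2_diff power_mult_distrib field_simps power2_eq_square)
        finally have "r * (2 * (norm (1 - iexp (a * x)) * norm (1 - iexp (s * x)))) \<le>
            r * (r * (norm (1 - iexp (a * x)))\<^sup>2 + (norm (1 - iexp (s * x)))\<^sup>2 / r)"
          by (simp only: mult_ac)
        then show ?thesis using r by simp
      qed
      also have "\<dots> = r * (1 - cos (a * x)) + (1 - cos (s * x)) / r"
        unfolding e using r by (simp add: field_simps)
      finally show "norm (1 - iexp (a * x) - iexp (s * x) + iexp ((a + s) * x)) \<le>
        r * (1 - cos (a * x)) + (1 - cos (s * x)) / r" .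
    next
      show "integrable M (\<lambda>x. norm (1 - iexp (a * x) - iexp (s * x) + iexp ((a + s) * x)))"
        by (intro integrable_norm Bochner_Integration.integrable_add Bochner_Integration.integrable_diff integrable_const i)
      show "integrable M (\<lambda>x. r * (1 - cos (a * x)) + (1 - cos (s * x)) / r)"
        by (intro Bochner_Integration.integrable_add Bochner_Integration.integrable_diff
            integrable_mult_right integrable_divide_zero integrable_const ic)
    qed
    also have "\<dots> = r * (1 - Re (char M a)) + (1 - Re (char M s)) / r"
      using ic[of a] ic[of s] prob_space by (simp add: integral_cos_sin_eq_char[OF real_distribution_axioms])
    finally show ?thesis unfolding M_def .
  qed
  have "(\<lambda>k. norm (real (Suc k) * (1 - ?\<phi> k a) + real (Suc k) * (1 - ?\<phi> k s) - real (Suc k) * (1 - ?\<phi> k (a + s))))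
      \<longlonglongrightarrow> norm (\<psi> a + \<psi> s - \<psi> (a + s))"
    by (intro tendsto_intros tendsto_generator)
  moreover have "(\<lambda>k. r * Re (real (Suc k) * (1 - ?\<phi> k a)) + Re (real (Suc k) * (1 - ?\<phi> k s)) / r)
      \<longlonglongrightarrow> r * Re (\<psi> a) + Re (\<psi> s) / r"
    using r by (intro tendsto_intros tendsto_generator) auto
  moreover have "norm (real (Suc k) * (1 - ?\<phi> k a) + real (Suc k) * (1 - ?\<phi> k s) - real (Suc k) * (1 - ?\<phi> k (a + s)))
      \<le> r * Re (real (Suc k) * (1 - ?\<phi> k a)) + Re (real (Suc k) * (1 - ?\<phi> k s)) / r" for k
  proof -
    have "real (Suc k) * (1 - ?\<phi> k a) + real (Suc k) * (1 - ?\<phi> k s) - real (Suc k) * (1 - ?\<phi> k (a + s)) =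
        of_real (real (Suc k)) * (1 - ?\<phi> k a - ?\<phi> k s + ?\<phi> k (a + s))"
      by (simp add: algebra_simps)
    then have "norm (real (Suc k) * (1 - ?\<phi> k a) + real (Suc k) * (1 - ?\<phi> k s) - real (Suc k) * (1 - ?\<phi> k (a + s))) =
        real (Suc k) * norm (1 - ?\<phi> k a - ?\<phi> k s + ?\<phi> k (a + s))"
      by (simp only: norm_mult norm_of_real abs_of_nat)
    also have "\<dots> \<le> real (Suc k) * (r * (1 - Re (?\<phi> k a)) + (1 - Re (?\<phi> k s)) / r)"
      by (intro mult_left_mono bound) auto
    also have "\<dots> = r * Re (real (Suc k) * (1 - ?\<phi> k a)) + Re (real (Suc k) * (1 - ?\<phi> k s)) / r"
      using r by (simp add: field_simps)
    finally show ?thesis .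
  qed
  ultimately have "norm (\<psi> a + \<psi> s - \<psi> (a + s)) \<le> r * Re (\<psi> a) + Re (\<psi> s) / r"
    by (intro LIMSEQ_le) auto
  moreover have "\<psi> (a + s) - \<psi> a - \<psi> s = - (\<psi> a + \<psi> s - \<psi> (a + s))" by simp
  ultimately show ?thesis by (simp only: norm_minus_cancel)
qed

section \<open>Laws at independent exponential times\<close>

definition kernel :: "real \<Rightarrow> real measure" where
  "kernel t = \<mu> (max 0 t)"

lemma kernel_rd: "real_distribution (kernel t)"
  by (simp add: kernel_def distr)

lemma continuous_integral_kernel:
  fixes f :: "real \<Rightarrow> real"
  assumes "\<And>x. isCont f x" "\<And>x. norm (f x) \<le> B"
  shows "continuous_on UNIV (\<lambda>t. \<integral>x. f x \<partial>kernel t)"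
  unfolding continuous_on_sequentially
proof (safe)
  fix T t assume T: "T \<longlonglongrightarrow> (t :: real)"
  have "weak_conv_m (\<lambda>k. kernel (T k)) (kernel t)"
  proof (rule levy_continuity[OF kernel_rd kernel_rd])
    fix v
    have "(\<lambda>k. exp (- (complex_of_real (max 0 (T k)) * \<psi> v))) \<longlonglongrightarrow> exp (- (complex_of_real (max 0 t) * \<psi> v))"
      by (intro tendsto_intros T)
    then show "(\<lambda>k. char (kernel (T k)) v) \<longlonglongrightarrow> char (kernel t) v"
      by (simp add: kernel_def char)
  qed
  then show "((\<lambda>t. \<integral>x. f x \<partial>kernel t) \<circ> T) \<longlonglongrightarrow> (\<integral>x. f x \<partial>kernel t)"
    unfolding comp_def
    by (rule weak_conv_imp_integral_bdd_continuous_conv[OF kernel_rd kernel_rd _ assms])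
qed

text \<open>Half-lines generate the Borel sets, and their masses are limits of integrals of
  continuous ramps, which depend continuously on t by Levy's continuity theorem.\<close>

lemma measurable_kernel: "kernel \<in> borel \<rightarrow>\<^sub>M subprob_algebra borel"
proof (rule measurable_subprob_algebra_generated[where \<Omega> = UNIV and G = "range (\<lambda>a. {..a})"])
  show "sets borel = sigma_sets UNIV (range (\<lambda>a::real. {..a}))"
    by (subst borel_eq_atMost) simp
  show "Int_stable (range (\<lambda>a::real. {..a}))"
    by (auto simp: Int_stable_def)
  show "subprob_space (kernel t)" for t
    using kernel_rd[of t] by (simp add: real_distribution_def prob_space_imp_subprob_space)
  show "sets (kernel t) = sets borel" for t
    using kernel_rd[of t] by (simp add: real_distribution.events_eq_borel)
  have "emeasure (kernel t) UNIV = 1" for t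
    using kernel_rd[of t] prob_space.emeasure_space_1[of "kernel t"]
    by (simp add: real_distribution_def real_distribution.space_eq_univ[OF kernel_rd])
  then show "(\<lambda>t. emeasure (kernel t) UNIV) \<in> borel_measurable borel" by simp
  fix A assume "A \<in> range (\<lambda>a::real. {..a})"
  then obtain a where A: "A = {..a}" by auto
  define f where "f k x = max 0 (min 1 (1 - real k * (x - a)))" for k x
  have "(\<lambda>t. measure (kernel t) {..a}) \<in> borel_measurable borel"
  proof (rule borel_measurable_LIMSEQ_real)
    show "(\<lambda>t. \<integral>x. f k x \<partial>kernel t) \<in> borel_measurable borel" for k
      by (intro borel_measurable_continuous_onI continuous_integral_kernel[where B = 1])
        (auto simp: f_def intro!: continuous_intros)
    fix t
    interpret K: real_distribution "kernel t" by (rule kernel_rd)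
    have "(\<lambda>k. \<integral>x. f k x \<partial>kernel t) \<longlonglongrightarrow> (\<integral>x. indicator {..a} x \<partial>kernel t)"
    proof (rule integral_dominated_convergence[where w = "\<lambda>_. 1"])
      show "AE x in kernel t. (\<lambda>k. f k x) \<longlonglongrightarrow> indicator {..a} x"
      proof (rule AE_I2)
        fix x
        show "(\<lambda>k. f k x) \<longlonglongrightarrow> indicator {..a} x"
        proof (cases "x \<le> a")
          case True
          then have "f k x = 1" for k by (auto simp: f_def mult_nonneg_nonpos)
          then show ?thesis using True by simp
        next
          case False
          have "\<forall>\<^sub>F k in sequentially. real k \<ge> 1 / (x - a)"
            using filterlim_real_sequentially by (simp add: filterlim_at_top)
          then have "\<forall>\<^sub>F k in sequentially. f k x = 0"
            by eventually_elim (use False in \<open>auto simp: f_def field_simps\<close>)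
          then show ?thesis using False by (auto intro: tendsto_eventually)
        qed
      qed
    qed (auto simp: f_def)
    then show "(\<lambda>k. \<integral>x. f k x \<partial>kernel t) \<longlonglongrightarrow> measure (kernel t) {..a}" by simp
  qed
  moreover have "emeasure (kernel t) {..a} = ennreal (measure (kernel t) {..a})" for t
  proof -
    interpret K: real_distribution "kernel t" by (rule kernel_rd)
    show ?thesis by (rule K.emeasure_eq_measure)
  qed
  ultimately show "(\<lambda>t. emeasure (kernel t) A) \<in> borel_measurable borel"
    unfolding A by simp
qed auto

text \<open>The law of the process at an independent exponential time of rate q, that is, q times
  its q-potential measure. The extension of the kernel to negative times carries no mass.\<close>

definition resolvent :: "real \<Rightarrow> real measure" where
  "resolvent q = density lborel (exponential_density q) \<bind> kernel"

lemma resolvent_rd: assumes "0 < q" shows "real_distribution (resolvent q)"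
proof -
  interpret E: prob_space "density lborel (exponential_density q)"
    by (rule prob_space_exponential_density) fact
  have "prob_space (resolvent q)" unfolding resolvent_def
    by (rule E.prob_space_bind[where S = borel])
      (use kernel_rd measurable_kernel in \<open>auto intro!: AE_I2 simp: real_distribution_def\<close>)
  moreover have "sets (resolvent q) = sets borel" unfolding resolvent_def
    using kernel_rd by (subst sets_bind[where N = borel]) (auto simp: real_distribution.events_eq_borel)
  ultimately show ?thesis by (simp add: real_distribution_def real_distribution_axioms_def)
qed

lemma char_resolvent:
  assumes q: "0 < q"
  shows "char (resolvent q) v = of_real q / (of_real q + \<psi> v)"
proof -
  interpret E: prob_space "density lborel (exponential_density q)"
    by (rule prob_space_exponential_density) fact
  have bind: "(\<integral>x. f x \<partial>resolvent q) = (\<integral>t. (\<integral>x. f x \<partial>kernel t) \<partial>density lborel (exponential_density q))"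
    if [measurable]: "f \<in> borel_measurable borel" and "\<And>x. \<bar>f x\<bar> \<le> 1" for f :: "real \<Rightarrow> real"
    unfolding resolvent_def
    by (rule integral_bind[where K = borel and B = 1 and B' = 1])
      (use that measurable_kernel kernel_rd in \<open>auto intro!: AE_I2 E.finite_measure_axioms
        simp: real_distribution_def prob_space.emeasure_space_1\<close>)
  have ck: "char (kernel t) v = exp (- (complex_of_real (max 0 t) * \<psi> v))" for t
    by (simp add: kernel_def char)
  have "has_bochner_integral lborel
     (\<lambda>t. of_real q * (indicator {0..} t *\<^sub>R exp (- (complex_of_real t * (of_real q + \<psi> v)))))
     (of_real q * (1 / (of_real q + \<psi> v)))"
    using q Re_nonneg[of v] by (intro has_bochner_integral_mult_right has_bochner_integral_exp_complex) auto
  moreover have "of_real q * (indicator {0..} t *\<^sub>R exp (- (complex_of_real t * (of_real q + \<psi> v)))) =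
     exponential_density q t *\<^sub>R char (kernel t) v" for t
    unfolding ck by (auto simp: exponential_density_def indicator_def exp_add exp_minus ring_distribs
      scaleR_conv_of_real exp_of_real[symmetric] exp_diff divide_inverse mult_ac)
  ultimately have hb: "has_bochner_integral lborel (\<lambda>t. exponential_density q t *\<^sub>R char (kernel t) v)
      (of_real q / (of_real q + \<psi> v))" by simp
  have meas: "(\<lambda>t. char (kernel t) v) \<in> borel_measurable borel"
    unfolding ck by measurable
  have int: "integrable (density lborel (exponential_density q)) (\<lambda>t. char (kernel t) v)"
    and val: "(\<integral>t. char (kernel t) v \<partial>density lborel (exponential_density q)) = of_real q / (of_real q + \<psi> v)"
    using hb meas exponential_density_nonneg[OF q]
    by (auto simp: integrable_density integral_density has_bochner_integral_iff)
  show ?thesis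
  proof (rule complex_eqI)
    show "Re (char (resolvent q) v) = Re (of_real q / (of_real q + \<psi> v))"
      unfolding integral_cos_sin_eq_char[OF resolvent_rd[OF q], symmetric] val[symmetric]
      by (subst bind) (use int in \<open>auto simp: integral_cos_sin_eq_char[OF kernel_rd]\<close>)
    show "Im (char (resolvent q) v) = Im (of_real q / (of_real q + \<psi> v))"
      unfolding integral_cos_sin_eq_char[OF resolvent_rd[OF q], symmetric] val[symmetric]
      by (subst bind) (use int in \<open>auto simp: integral_cos_sin_eq_char[OF kernel_rd]\<close>)
  qed
qed

end

section \<open>The potential density\<close>

text \<open>The integral over an unbounded set is tested on large boxes; once a box contains 0 its
  lower end is irrelevant, and only the upper end T remains.\<close>

lemma has_integral_improper_atLeast:
  fixes f :: "real \<Rightarrow> real"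
  assumes cont: "continuous_on UNIV f" and lim: "((\<lambda>T. integral {0..T} f) \<longlongrightarrow> l) at_top"
  shows "(f has_integral l) {0..}"
  unfolding has_integral_alt'
proof (intro conjI allI impI)
  have int: "f integrable_on {a..b}" for a b
    by (intro integrable_continuous_real continuous_on_subset[OF cont]) auto
  have eq: "(\<lambda>x. if x \<in> {0..} then f x else 0) integrable_on cbox a b \<and>
    integral (cbox a b) (\<lambda>x. if x \<in> {0..} then f x else 0) = integral {max a 0..b} f" for a b
  proof -
    have 1: "{0..} \<inter> cbox a b = {max a 0..b}" by auto
    show ?thesis
      using int integrable_restrict_Int[of "{0..}" f "cbox a b"] integral_restrict_Int[of "cbox a b" "{0..}" f]
      by (simp add: 1 Int_commute max.commute)
  qed
  show "(\<lambda>x. if x \<in> {0..} then f x else 0) integrable_on cbox a b" for a b using eq by blast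
  fix e :: real assume "e > 0"
  then obtain B where B: "\<And>T. T \<ge> B \<Longrightarrow> dist (integral {0..T} f) l < e"
    using lim unfolding tendsto_iff eventually_at_top_linorder by meson
  show "\<exists>B>0. \<forall>a b. ball 0 B \<subseteq> cbox a b \<longrightarrow>
      norm (integral (cbox a b) (\<lambda>x. if x \<in> {0..} then f x else 0) - l) < e"
  proof (intro exI[of _ "max B 1 + 1"] conjI allI impI)
    fix a b :: real assume *: "ball 0 (max B 1 + 1) \<subseteq> cbox a b"
    have "0 \<in> ball 0 (max B 1 + 1)" "max B 1 \<in> ball 0 (max B 1 + 1)" by (auto simp: dist_real_def)
    then have "0 \<in> cbox a b" "max B 1 \<in> cbox a b" using * by blast+
    then have "max a 0 = 0" "b \<ge> B" by auto
    then show "norm (integral (cbox a b) (\<lambda>x. if x \<in> {0..} then f x else 0) - l) < e"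
      using B[of b] eq[of a b] by (simp add: dist_norm)
  qed auto
qed

lemma integrable_on_Icc:
  fixes f :: "real \<Rightarrow> 'a :: {banach, real_normed_vector}"
  shows "continuous_on UNIV f \<Longrightarrow> f integrable_on {A..B}"
  by (intro integrable_continuous_real) (rule continuous_on_subset, auto)

lemma integral_split:
  fixes f :: "real \<Rightarrow> real"
  shows "continuous_on UNIV f \<Longrightarrow> 0 \<le> A \<Longrightarrow> A \<le> B \<Longrightarrow> integral {0..B} f = integral {0..A} f + integral {A..B} f"
  by (intro Henstock_Kurzweil_Integration.integral_combine[symmetric] integrable_on_Icc)

locale resolvent_density = char_semigroup +
  fixes \<beta> :: real
  assumes \<beta>: "0 < \<beta>" and integrable_re: "set_integrable lborel {0..} (resolvent_re \<beta> \<psi>)"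
begin

definition g :: "real \<Rightarrow> complex" where
  "g v = 1 / (complex_of_real \<beta> + \<psi> v)"

lemma resolvent_re_eq: "resolvent_re \<beta> \<psi> = (\<lambda>v. Re (g v))"
  and resolvent_im_eq: "resolvent_im \<beta> \<psi> = (\<lambda>v. Im (g v))"
  by (auto simp: resolvent_re_def resolvent_im_def g_def)

lemma char_\<beta>: "char (resolvent \<beta>) v = \<beta> * g v"
  by (simp add: char_resolvent \<beta> g_def)

lemma cont_g: "continuous_on A g"
proof -
  interpret real_distribution "resolvent \<beta>" by (rule resolvent_rd[OF \<beta>])
  have "continuous_on A (\<lambda>v. char (resolvent \<beta>) v / \<beta>)"
    by (intro continuous_intros continuous_at_imp_continuous_on ballI isCont_char) (use \<beta> in auto)
  then show ?thesis using \<beta> by (simp add: char_\<beta>)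
qed

lemma g_minus: "g (- v) = cnj (g v)"
proof -
  have "char (resolvent \<beta>) (- v) = cnj (char (resolvent \<beta>) v)"
    unfolding complex_eq_iff
    using integral_cos_sin_eq_char[OF resolvent_rd[OF \<beta>], of v]
      integral_cos_sin_eq_char[OF resolvent_rd[OF \<beta>], of "- v"] by simp
  then show ?thesis using \<beta> by (simp add: char_\<beta>)
qed

lemma Re_g: "Re (g v) = (\<beta> + Re (\<psi> v)) * (norm (g v))\<^sup>2"
proof -
  have "norm (complex_of_real \<beta> + \<psi> v) \<noteq> 0" using denominator_nonzero[OF \<beta>, of v] by simp
  then show ?thesis
    by (simp add: g_def norm_divide power_divide Re_divide cmod_power2)
qed

lemma norm_g_pos: "norm (g v) > 0"
  using denominator_nonzero[OF \<beta>, of v] by (simp add: g_def)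

text \<open>These put |g|^2 and Re \<psi> |g|^2 under the integrable function Re g. For |g| itself
  there is only control through its square.\<close>

lemma norm_g_sq: "\<beta> * (norm (g v))\<^sup>2 \<le> Re (g v)" and psi_g_sq: "Re (\<psi> v) * (norm (g v))\<^sup>2 \<le> Re (g v)"
  unfolding Re_g using Re_nonneg[of v] \<beta> by (auto simp: distrib_right)

lemma Re_g_nonneg: "0 \<le> Re (g v)"
  unfolding Re_g using Re_nonneg[of v] \<beta> by simp

text \<open>
  The choice \<open>r = norm (g a) / norm (g (a + s))\<close> in the increment estimate for the exponent makes both
  terms on its right-hand side integrable against the product of the two resolvents.
\<close>

lemma norm_g_diff_le: "norm (g a - g (a + s)) \<le> (1 + 2 * norm (\<psi> s) / \<beta>) * (Re (g a) + Re (g (a + s)))"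
proof -
  let ?x = "norm (g a)" and ?y = "norm (g (a + s))"
  have pos: "?x > 0" "?y > 0" by (rule norm_g_pos)+
  have "g a - g (a + s) = (\<psi> (a + s) - \<psi> a) * (g a * g (a + s))"
    using denominator_nonzero[OF \<beta>, of a] denominator_nonzero[OF \<beta>, of "a + s"]
    by (simp add: g_def divide_simps)
  then have "norm (g a - g (a + s)) = norm (\<psi> (a + s) - \<psi> a) * (?x * ?y)"
    by (simp add: norm_mult)
  also have "norm (\<psi> (a + s) - \<psi> a) \<le> norm (\<psi> s) + (?x / ?y * Re (\<psi> a) + Re (\<psi> s) / (?x / ?y))"
    using norm_increment_le[of "?x / ?y" a s] pos norm_triangle_ineq[of "\<psi> s" "\<psi> (a + s) - \<psi> a - \<psi> s"]
    by simp
  also have "(norm (\<psi> s) + (?x / ?y * Re (\<psi> a) + Re (\<psi> s) / (?x / ?y))) * (?x * ?y) =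
      norm (\<psi> s) * (?x * ?y) + Re (\<psi> a) * ?x\<^sup>2 + Re (\<psi> s) * ?y\<^sup>2"
    using pos by (simp add: field_simps power2_eq_square)
  also have "\<dots> \<le> norm (\<psi> s) * ((Re (g a) + Re (g (a + s))) / \<beta>) + (Re (g a) + Re (g (a + s))) +
      norm (\<psi> s) * ((Re (g a) + Re (g (a + s))) / \<beta>)"
  proof (intro add_mono)
    have x: "?x\<^sup>2 \<le> Re (g a) / \<beta>" and y: "?y\<^sup>2 \<le> Re (g (a + s)) / \<beta>"
      using norm_g_sq[of a] norm_g_sq[of "a + s"] \<beta> by (auto simp: field_simps)
    have "0 \<le> (?x - ?y)\<^sup>2" by simp
    then have "?x * ?y \<le> (?x\<^sup>2 + ?y\<^sup>2) / 2" by (simp add: power2_diff)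
    also have "\<dots> \<le> ?x\<^sup>2 + ?y\<^sup>2" by simp
    also have "\<dots> \<le> (Re (g a) + Re (g (a + s))) / \<beta>" using x y by (simp add: add_divide_distrib)
    finally show "norm (\<psi> s) * (?x * ?y) \<le> norm (\<psi> s) * ((Re (g a) + Re (g (a + s))) / \<beta>)"
      by (intro mult_left_mono) auto
    show "Re (\<psi> a) * ?x\<^sup>2 \<le> Re (g a) + Re (g (a + s))"
      using psi_g_sq[of a] Re_g_nonneg[of "a + s"] by simp
    have "Re (\<psi> s) * ?y\<^sup>2 \<le> norm (\<psi> s) * ?y\<^sup>2"
      by (intro mult_right_mono complex_Re_le_cmod) auto
    also have "\<dots> \<le> norm (\<psi> s) * ((Re (g a) + Re (g (a + s))) / \<beta>)"
      using y Re_g_nonneg[of a] \<beta>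
      by (intro mult_left_mono) (auto simp: add_divide_distrib intro: order.trans)
    finally show "Re (\<psi> s) * ?y\<^sup>2 \<le> norm (\<psi> s) * ((Re (g a) + Re (g (a + s))) / \<beta>)" .
  qed
  also have "\<dots> = (1 + 2 * norm (\<psi> s) / \<beta>) * (Re (g a) + Re (g (a + s)))"
    using \<beta> by (simp add: field_simps)
  finally show ?thesis using pos by (simp add: mult_right_mono)
qed

section \<open>Tail estimates and cancellation in the oscillating integral\<close>

definition tail :: "real \<Rightarrow> real" where
  "tail A = integral {A..} (\<lambda>v. Re (g v))"

lemma integrable_Re_g: "0 \<le> A \<Longrightarrow> (\<lambda>v. Re (g v)) integrable_on {A..}"
  using set_integrable_subset[OF integrable_re, of "{A..}"]
  by (auto simp: resolvent_re_eq dest: set_borel_integral_eq_integral(1))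

lemma integral_Re_g_le_tail:
  assumes "0 \<le> A" "A \<le> A'"
  shows "integral {A'..B} (\<lambda>v. Re (g v)) \<le> tail A"
  unfolding tail_def
  by (rule integral_subset_le)
    (use assms Re_g_nonneg in \<open>auto intro!: integrable_Re_g integrable_on_Icc continuous_intros cont_g\<close>)

lemma tail_nonneg: "0 \<le> A \<Longrightarrow> 0 \<le> tail A"
  unfolding tail_def by (intro integral_nonneg integrable_Re_g) (auto simp: Re_g_nonneg)

lemma tail_tendsto_0: "(tail \<longlongrightarrow> 0) at_top"
proof -
  have "((\<lambda>b. set_lebesgue_integral lborel {0..b} (\<lambda>v. Re (g v))) \<longlongrightarrow> set_lebesgue_integral lborel {0..} (\<lambda>v. Re (g v))) at_top"
    by (rule tendsto_set_lebesgue_integral_at_top) (use integrable_re in \<open>auto simp: resolvent_re_eq\<close>)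
  moreover have "set_lebesgue_integral lborel {0..b} (\<lambda>v. Re (g v)) = integral {0..b} (\<lambda>v. Re (g v))" for b
    using set_integrable_subset[OF integrable_re, of "{0..b}"]
    by (auto simp: resolvent_re_eq dest: set_borel_integral_eq_integral(2))
  moreover have "set_lebesgue_integral lborel {0..} (\<lambda>v. Re (g v)) = tail 0"
    unfolding tail_def using integrable_re by (simp add: resolvent_re_eq set_borel_integral_eq_integral(2))
  ultimately have "((\<lambda>b. tail 0 - integral {0..b} (\<lambda>v. Re (g v))) \<longlongrightarrow> tail 0 - tail 0) at_top"
    by (intro tendsto_intros) simp
  moreover have "\<forall>\<^sub>F b in at_top. tail 0 - integral {0..b} (\<lambda>v. Re (g v)) = tail b"
    using eventually_ge_at_top[of 0]
  proof eventually_elim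
    case (elim b)
    have "((\<lambda>v. Re (g v)) has_integral (integral {0..b} (\<lambda>v. Re (g v)) + tail b)) ({0..b} \<union> {b..})"
      unfolding tail_def
      by (intro has_integral_Un integrable_integral integrable_Re_g elim integrable_on_Icc continuous_intros cont_g)
        (auto intro: negligible_subset[of "{b}"])
    moreover have "{0..b} \<union> {b..} = {0..}" using elim by auto
    ultimately show ?case unfolding tail_def by (simp add: integral_unique)
  qed
  ultimately show ?thesis by (auto intro: Lim_transform_eventually)
qed

text \<open>From 2 \<delta> |g| \<le> \<delta>^2 + |g|^2: on a window of length s the first term is
  small by the choice of \<delta> and the second by the smallness of the tail, wherever the window
  lies beyond A.\<close>

lemma integral_norm_g_le:
  assumes "0 \<le> A" "A \<le> A'" "0 \<le> s" "0 < \<delta>"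
  shows "integral {A'..A' + s} (\<lambda>v. norm (g v)) \<le> s * \<delta> / 2 + tail A / (2 * \<delta> * \<beta>)"
proof -
  have le: "norm (g v) \<le> \<delta> / 2 + Re (g v) / (2 * \<delta> * \<beta>)" for v
  proof -
    have "0 \<le> (norm (g v) - \<delta>)\<^sup>2" by simp
    then have "2 * \<delta> * norm (g v) \<le> \<delta>\<^sup>2 + (norm (g v))\<^sup>2" by (simp add: power2_diff mult_ac)
    also have "\<dots> \<le> \<delta>\<^sup>2 + Re (g v) / \<beta>" using norm_g_sq[of v] \<beta> by (simp add: field_simps)
    finally show ?thesis using \<open>0 < \<delta>\<close> \<beta> by (simp add: field_simps power2_eq_square)
  qed
  have "integral {A'..A' + s} (\<lambda>v. norm (g v)) \<le> integral {A'..A' + s} (\<lambda>v. \<delta> / 2 + Re (g v) / (2 * \<delta> * \<beta>))"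
    by (intro integral_le le integrable_on_Icc continuous_intros cont_g) (use \<beta> assms in auto)
  also have "\<dots> = s * \<delta> / 2 + integral {A'..A' + s} (\<lambda>v. Re (g v)) / (2 * \<delta> * \<beta>)"
    using assms \<beta> by (subst integral_add) (auto intro!: integrable_on_Icc continuous_intros cont_g)
  also have "\<dots> \<le> s * \<delta> / 2 + tail A / (2 * \<delta> * \<beta>)"
    using assms \<beta> by (intro add_left_mono divide_right_mono integral_Re_g_le_tail) auto
  finally show ?thesis .
qed

definition osc :: "real \<Rightarrow> real \<Rightarrow> complex" where
  "osc z v = exp (- (\<i> * complex_of_real (v * z))) * g v"

lemma cont_osc: "continuous_on A (osc z)"
  unfolding osc_def by (intro continuous_intros cont_g)

lemma norm_osc: "norm (osc z v) = norm (g v)"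
  by (simp add: osc_def norm_mult)

text \<open>Shifting by half a period changes the sign of the exponential factor.\<close>

lemma norm_integral_osc_le:
  assumes A: "0 \<le> A" "A \<le> B" and z: "0 < z" and \<delta>: "0 < \<delta>"
  shows "norm (integral {A..B} (osc z)) \<le>
    (1 + 2 * norm (\<psi> (pi / z)) / \<beta>) * tail A + (pi / z * \<delta> / 2 + tail A / (2 * \<delta> * \<beta>))"
proof -
  define s where "s = pi / z"
  have s: "0 < s" using z by (simp add: s_def)
  have sz: "s * z = pi" using z by (simp add: s_def)
  let ?J = "\<lambda>a b. integral {a..b} (osc z)"
  have int[intro]: "osc z integrable_on {a..b}" for a b
    by (intro integrable_on_Icc cont_osc)
  have shift: "osc z (v + s) = - (exp (- (\<i> * complex_of_real (v * z))) * g (v + s))" for v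
  proof -
    have "exp (- (\<i> * complex_of_real ((v + s) * z))) = exp (- (\<i> * complex_of_real (v * z))) * exp (- (\<i> * complex_of_real pi))"
      by (simp add: distrib_right sz exp_add[symmetric] distrib_left)
    also have "exp (- (\<i> * complex_of_real pi)) = - 1"
      by (simp add: exp_minus mult.commute)
    finally show ?thesis by (simp add: osc_def)
  qed
  have "?J (A + s) (B + s) = integral {A..B} (\<lambda>v. osc z (v + s))"
    using integral_shift_real_ivl[of "A + s" s "B + s" "osc z"] by simp
  then have "?J A B + ?J (A + s) (B + s) = integral {A..B} (\<lambda>v. osc z v + osc z (v + s))"
    by (subst integral_add)
      (auto intro!: integrable_on_Icc continuous_on_compose2[OF cont_osc] continuous_intros)
  \<comment> \<open>The integral up to B + s is split in two ways. Twice the integral over {A..B}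
    thus becomes an integral of increments of g plus two windows of length s at the ends.\<close>
  moreover have "?J A (A + s) + ?J (A + s) (B + s) = ?J A B + ?J B (B + s)"
    using A s by (simp add: Henstock_Kurzweil_Integration.integral_combine int)
  moreover have "2 * x = y + p - q" if "x + w = y" "p + w = x + q" for x y w p q :: complex
  proof -
    have "y = x + w" "p = x + q - w" using that by (auto simp: eq_diff_eq)
    then show ?thesis by simp
  qed
  ultimately have eq2: "2 * ?J A B = integral {A..B} (\<lambda>v. osc z v + osc z (v + s)) + ?J A (A + s) - ?J B (B + s)"
    by blast
  have "norm (2 * ?J A B) \<le> norm (integral {A..B} (\<lambda>v. osc z v + osc z (v + s))) + norm (?J A (A + s)) + norm (?J B (B + s))"
    unfolding eq2
    using norm_triangle_ineq4[of "integral {A..B} (\<lambda>v. osc z v + osc z (v + s)) + ?J A (A + s)" "?J B (B + s)"]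
      norm_triangle_ineq[of "integral {A..B} (\<lambda>v. osc z v + osc z (v + s))" "?J A (A + s)"]
    by linarith
  moreover have "norm (integral {A..B} (\<lambda>v. osc z v + osc z (v + s))) \<le>
      (1 + 2 * norm (\<psi> s) / \<beta>) * (tail A + tail A)"
  proof -
    have "norm (integral {A..B} (\<lambda>v. osc z v + osc z (v + s))) \<le>
        integral {A..B} (\<lambda>v. (1 + 2 * norm (\<psi> s) / \<beta>) * (Re (g v) + Re (g (v + s))))"
    proof (rule Henstock_Kurzweil_Integration.integral_norm_bound_integral)
      fix v
      have "osc z v + osc z (v + s) = exp (- (\<i> * complex_of_real (v * z))) * (g v - g (v + s))"
        unfolding shift unfolding osc_def by (simp only: right_diff_distrib) simp
      then have "norm (osc z v + osc z (v + s)) = norm (g v - g (v + s))" by (simp add: norm_mult)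
      then show "norm (osc z v + osc z (v + s)) \<le> (1 + 2 * norm (\<psi> s) / \<beta>) * (Re (g v) + Re (g (v + s)))"
        using norm_g_diff_le by simp
    qed (use \<beta> in \<open>auto intro!: integrable_on_Icc continuous_on_compose2[OF cont_osc]
      continuous_on_compose2[OF cont_g] continuous_intros cont_osc cont_g\<close>)
    also have "\<dots> = (1 + 2 * norm (\<psi> s) / \<beta>) * (integral {A..B} (\<lambda>v. Re (g v)) + integral {A..B} (\<lambda>v. Re (g (v + s))))"
      by (subst integral_mult_right, subst integral_add)
        (auto intro!: integrable_on_Icc continuous_on_compose2[OF cont_g] continuous_intros cont_g)
    also have "integral {A..B} (\<lambda>v. Re (g (v + s))) = integral {A + s..B + s} (\<lambda>v. Re (g v))"
      using integral_shift_real_ivl[of "A + s" s "B + s" "\<lambda>v. Re (g v)"] by simp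
    also have "(1 + 2 * norm (\<psi> s) / \<beta>) * (integral {A..B} (\<lambda>v. Re (g v)) + integral {A + s..B + s} (\<lambda>v. Re (g v))) \<le>
        (1 + 2 * norm (\<psi> s) / \<beta>) * (tail A + tail A)"
      using A s \<beta> by (intro mult_left_mono add_mono integral_Re_g_le_tail) auto
    finally show ?thesis .
  qed
  moreover have "norm (?J A' (A' + s)) \<le> s * \<delta> / 2 + tail A / (2 * \<delta> * \<beta>)" if "A \<le> A'" for A'
  proof -
    have "norm (?J A' (A' + s)) \<le> integral {A'..A' + s} (\<lambda>v. norm (g v))"
      by (rule Henstock_Kurzweil_Integration.integral_norm_bound_integral)
        (auto simp: norm_osc intro!: integrable_on_Icc continuous_intros cont_g cont_osc)
    also have "\<dots> \<le> s * \<delta> / 2 + tail A / (2 * \<delta> * \<beta>)"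
      by (rule integral_norm_g_le) (use A s \<delta> that in auto)
    finally show ?thesis .
  qed
  note part = this
  from calculation part[OF order_refl] part[OF A(2)]
  have "2 * norm (?J A B) \<le> (1 + 2 * norm (\<psi> s) / \<beta>) * (tail A + tail A) + (s * \<delta> / 2 + tail A / (2 * \<delta> * \<beta>)) +
     (s * \<delta> / 2 + tail A / (2 * \<delta> * \<beta>))"
    using norm_mult[of 2 "?J A B"] by (simp only: norm_numeral)
  then show ?thesis unfolding s_def[symmetric] distrib_left by linarith
qed

section \<open>Locally uniform convergence of the truncated Fourier integrals\<close>

definition cpart :: "real \<Rightarrow> real \<Rightarrow> real" where
  "cpart T z = integral {0..T} (\<lambda>v. cos (v * z) * Re (g v))"

definition spart :: "real \<Rightarrow> real \<Rightarrow> real" where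
  "spart T z = integral {0..T} (\<lambda>v. sin (v * z) * Im (g v))"

definition upart :: "real \<Rightarrow> real \<Rightarrow> real" where
  "upart T z = (cpart T z + spart T z) / pi"

abbreviation u :: "real \<Rightarrow> real" where
  "u \<equiv> potential_density \<beta> \<psi>"

lemma cont_cos: "continuous_on A (\<lambda>v. cos (v * z) * Re (g v))"
  and cont_sin: "continuous_on A (\<lambda>v. sin (v * z) * Im (g v))"
  by (intro continuous_intros cont_g)+

lemma abs_integral_cos_le:
  assumes "0 \<le> A" shows "\<bar>integral {A..B} (\<lambda>v. cos (v * z) * Re (g v))\<bar> \<le> tail A"
proof -
  have "norm (integral {A..B} (\<lambda>v. cos (v * z) * Re (g v))) \<le> integral {A..B} (\<lambda>v. Re (g v))"
    by (rule Henstock_Kurzweil_Integration.integral_norm_bound_integral)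
      (auto intro!: integrable_on_Icc cont_cos continuous_intros cont_g mult_left_le_one_le
        simp: abs_mult Re_g_nonneg)
  also have "\<dots> \<le> tail A" by (rule integral_Re_g_le_tail) (use assms in auto)
  finally show ?thesis by simp
qed

lemma Re_integral_osc: "Re (integral {A..B} (osc z)) =
  integral {A..B} (\<lambda>v. cos (v * z) * Re (g v)) + integral {A..B} (\<lambda>v. sin (v * z) * Im (g v))"
proof -
  have "Re (integral {A..B} (osc z)) = integral {A..B} (Re \<circ> osc z)"
    by (rule integral_linear[symmetric]) (auto intro!: integrable_on_Icc cont_osc bounded_linear_Re)
  also have "Re \<circ> osc z = (\<lambda>v. cos (v * z) * Re (g v) + sin (v * z) * Im (g v))"
    by (auto simp: osc_def Re_exp Im_exp)
  finally show ?thesis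
    by (subst (asm) integral_add) (auto intro!: integrable_on_Icc cont_cos cont_sin)
qed

lemma cont_psi: "continuous_on A \<psi>"
proof -
  have "continuous_on A (\<lambda>v. 1 / g v - \<beta>)"
    using norm_g_pos by (intro continuous_intros cont_g) auto
  moreover have "1 / g v - \<beta> = \<psi> v" for v by (simp add: g_def)
  ultimately show ?thesis by simp
qed

text \<open>The half-period pi / |z| stays in a compact interval, on which \<psi> is bounded, so the
  oscillation estimate is uniform in z. Its real part contains the cosine integral as well, which
  converges absolutely and is subtracted.\<close>

lemma uniform_small_sin:
  assumes ab: "0 < a" "a \<le> b" and \<epsilon>: "0 < \<epsilon>"
  shows "\<exists>T0\<ge>0. \<forall>A\<ge>T0. \<forall>B\<ge>A. \<forall>z. a \<le> \<bar>z\<bar> \<and> \<bar>z\<bar> \<le> b \<longrightarrow>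
     \<bar>integral {A..B} (\<lambda>v. sin (v * z) * Im (g v))\<bar> \<le> \<epsilon>"
proof -
  have "bounded (\<psi> ` {pi / b..pi / a})"
    by (intro compact_imp_bounded compact_continuous_image cont_psi) auto
  then obtain M where M: "0 < M" "\<And>s. s \<in> {pi / b..pi / a} \<Longrightarrow> norm (\<psi> s) \<le> M"
    unfolding bounded_pos by auto
  \<comment> \<open>This value bounds the window term by \<epsilon> / 4; c below collects the
    coefficients of \<open>tail A\<close>, its last summand coming from the cosine part.\<close>
  define \<delta> where "\<delta> = \<epsilon> * a / (2 * pi)"
  have \<delta>: "0 < \<delta>" using ab \<epsilon> by (simp add: \<delta>_def)
  define c where "c = (1 + 2 * M / \<beta>) + 1 / (2 * \<delta> * \<beta>) + 1"
  have c: "c > 0" unfolding c_def using M \<beta> \<delta> by (auto intro!: add_pos_pos)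
  have "\<forall>\<^sub>F A in at_top. tail A < \<epsilon> / (2 * c)"
    using tail_tendsto_0 c \<epsilon> by (intro order_tendstoD(2)) auto
  then obtain T where T: "\<And>A. A \<ge> T \<Longrightarrow> tail A < \<epsilon> / (2 * c)"
    unfolding eventually_at_top_linorder by auto
  have pos: "\<bar>integral {A..B} (\<lambda>v. sin (v * z) * Im (g v))\<bar> \<le> \<epsilon>"
    if A: "A \<ge> max T 0" "B \<ge> A" and z: "a \<le> z" "z \<le> b" for A B z
  proof -
    have t: "0 \<le> tail A" "tail A * c \<le> \<epsilon> / 2"
      using tail_nonneg[of A] T[of A] A c by (auto simp: field_simps)
    have z0: "0 < z" using z ab by simp
    have "pi / z \<in> {pi / b..pi / a}" using z ab by (auto simp: frac_le)
    then have s: "norm (\<psi> (pi / z)) \<le> M" "pi / z \<le> pi / a" using M by auto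
    have "norm (integral {A..B} (osc z)) \<le>
        (1 + 2 * norm (\<psi> (pi / z)) / \<beta>) * tail A + (pi / z * \<delta> / 2 + tail A / (2 * \<delta> * \<beta>))"
      by (rule norm_integral_osc_le) (use A z0 \<delta> in auto)
    also have "\<dots> \<le> (1 + 2 * M / \<beta>) * tail A + (pi / a * \<delta> / 2 + tail A / (2 * \<delta> * \<beta>))"
      using s t \<beta> \<delta> by (intro add_mono mult_right_mono divide_right_mono order_refl) auto
    also have "pi / a * \<delta> / 2 = \<epsilon> / 4" using ab by (simp add: \<delta>_def field_simps)
    finally have "norm (integral {A..B} (osc z)) \<le> (1 + 2 * M / \<beta>) * tail A + (\<epsilon> / 4 + tail A / (2 * \<delta> * \<beta>))" .
    then have "\<bar>Re (integral {A..B} (osc z))\<bar> \<le> (1 + 2 * M / \<beta>) * tail A + (\<epsilon> / 4 + tail A / (2 * \<delta> * \<beta>))"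
      using abs_Re_le_cmod[of "integral {A..B} (osc z)"] by linarith
    moreover have "\<bar>integral {A..B} (\<lambda>v. cos (v * z) * Re (g v))\<bar> \<le> tail A"
      by (rule abs_integral_cos_le) (use A in auto)
    moreover have "(1 + 2 * M / \<beta>) * tail A + tail A / (2 * \<delta> * \<beta>) + tail A = tail A * c"
      by (simp add: c_def algebra_simps)
    ultimately show ?thesis
      unfolding Re_integral_osc using t \<epsilon> by linarith
  qed
  have neg: "integral {A..B} (\<lambda>v. sin (v * - z) * Im (g v)) = - integral {A..B} (\<lambda>v. sin (v * z) * Im (g v))" for A B z
    by simp
  show ?thesis
  proof (intro exI[of _ "max T 0"] conjI allI impI)
    fix A B z assume *: "max T 0 \<le> A" "A \<le> B" "a \<le> \<bar>z\<bar> \<and> \<bar>z\<bar> \<le> b"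
    show "\<bar>integral {A..B} (\<lambda>v. sin (v * z) * Im (g v))\<bar> \<le> \<epsilon>"
    proof (cases "z \<ge> 0")
      case True then show ?thesis using pos[of A B z] * by auto
    next
      case False then show ?thesis using pos[of A B "- z"] * unfolding neg by auto
    qed
  qed auto
qed

definition slim :: "real \<Rightarrow> real" where
  "slim z = lim (\<lambda>n. spart (real n) z)"

lemma spart_uniform:
  assumes ab: "0 < a" "a \<le> b" and \<epsilon>: "0 < \<epsilon>"
  shows "\<exists>T0\<ge>0. \<forall>T\<ge>T0. \<forall>z. a \<le> \<bar>z\<bar> \<and> \<bar>z\<bar> \<le> b \<longrightarrow> \<bar>spart T z - slim z\<bar> \<le> \<epsilon>"
proof -
  have conv: "(\<lambda>n. spart (real n) z) \<longlonglongrightarrow> slim z" if z: "a \<le> \<bar>z\<bar> \<and> \<bar>z\<bar> \<le> b" for z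
  proof -
    have "Cauchy (\<lambda>n. spart (real n) z)"
    proof (rule CauchyI')
      fix e :: real assume "e > 0"
      then obtain T0 where T0: "T0 \<ge> 0" "\<forall>A\<ge>T0. \<forall>B\<ge>A. \<forall>z. a \<le> \<bar>z\<bar> \<and> \<bar>z\<bar> \<le> b \<longrightarrow>
          \<bar>integral {A..B} (\<lambda>v. sin (v * z) * Im (g v))\<bar> \<le> e / 2"
        using uniform_small_sin[OF ab, of "e / 2"] by auto
      show "\<exists>N. \<forall>m\<ge>N. \<forall>n>m. dist (spart (real m) z) (spart (real n) z) < e"
      proof (intro exI[of _ "nat \<lceil>T0\<rceil>"] allI impI)
        fix m n assume mn: "nat \<lceil>T0\<rceil> \<le> m" "m < n"
        then have "T0 \<le> real m" by linarith
        moreover have "spart (real n) z = spart (real m) z + integral {real m..real n} (\<lambda>v. sin (v * z) * Im (g v))"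
          unfolding spart_def using mn by (intro integral_split cont_sin) auto
        ultimately show "dist (spart (real m) z) (spart (real n) z) < e"
          using T0(2)[rule_format, of "real m" "real n" z] z mn \<open>e > 0\<close> by (simp add: dist_real_def)
      qed
    qed
    then show ?thesis unfolding slim_def by (simp add: Cauchy_convergent_iff convergent_LIMSEQ_iff)
  qed
  obtain T0 where T0: "T0 \<ge> 0" "\<forall>A\<ge>T0. \<forall>B\<ge>A. \<forall>z. a \<le> \<bar>z\<bar> \<and> \<bar>z\<bar> \<le> b \<longrightarrow>
      \<bar>integral {A..B} (\<lambda>v. sin (v * z) * Im (g v))\<bar> \<le> \<epsilon>"
    using uniform_small_sin[OF ab \<epsilon>] by auto
  show ?thesis
  proof (intro exI[of _ T0] conjI allI impI T0(1))
    fix T z assume T: "T0 \<le> T" and z: "a \<le> \<bar>z\<bar> \<and> \<bar>z\<bar> \<le> b"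
    have "(\<lambda>n. \<bar>spart T z - spart (real n) z\<bar>) \<longlonglongrightarrow> \<bar>spart T z - slim z\<bar>"
      by (intro tendsto_intros conv z)
    moreover have "\<exists>N. \<forall>n\<ge>N. \<bar>spart T z - spart (real n) z\<bar> \<le> \<epsilon>"
    proof (intro exI[of _ "nat \<lceil>T\<rceil>"] allI impI)
      fix n assume "nat \<lceil>T\<rceil> \<le> n"
      then have n: "T \<le> real n" by linarith
      have "spart (real n) z = spart T z + integral {T..real n} (\<lambda>v. sin (v * z) * Im (g v))"
        unfolding spart_def using n T T0(1) by (intro integral_split cont_sin) auto
      then show "\<bar>spart T z - spart (real n) z\<bar> \<le> \<epsilon>"
        using T0(2)[rule_format, of T "real n" z] z n T by simp
    qed
    ultimately show "\<bar>spart T z - slim z\<bar> \<le> \<epsilon>" by (rule LIMSEQ_le_const2)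
  qed
qed

text \<open>Convergence along all real T, and not only along the integers used in
  \<open>slim\<close>, identifies the limit with the improper integral.\<close>

lemma H_part_eq: "H_part \<beta> \<psi> z = slim z / pi"
proof (cases "z = 0")
  case True
  then show ?thesis by (simp add: H_part_def slim_def spart_def)
next
  case False
  have "((\<lambda>T. spart T z) \<longlongrightarrow> slim z) at_top"
  proof (rule tendstoI)
    fix e :: real assume "e > 0"
    then obtain T0 where "\<forall>T\<ge>T0. \<bar>spart T z - slim z\<bar> \<le> e / 2"
      using spart_uniform[of "\<bar>z\<bar>" "\<bar>z\<bar>" "e / 2"] False by auto
    then show "\<forall>\<^sub>F T in at_top. dist (spart T z) (slim z) < e"
      unfolding eventually_at_top_linorder dist_real_def using \<open>e > 0\<close> by fastforce
  qed
  then have "((\<lambda>v. sin (v * z) * Im (g v)) has_integral slim z) {0..}"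
    unfolding spart_def by (intro has_integral_improper_atLeast cont_sin)
  then show ?thesis unfolding H_part_def resolvent_im_eq by (simp add: integral_unique)
qed

lemma cpart_uniform: "0 \<le> T \<Longrightarrow> \<bar>cpart T z - pi * R_part \<beta> \<psi> z\<bar> \<le> tail T"
proof -
  assume T: "0 \<le> T"
  have int: "set_integrable lborel {0..} (\<lambda>v. cos (v * z) * Re (g v))"
    using integrable_re unfolding set_integrable_def resolvent_re_eq
  proof (rule Bochner_Integration.integrable_bound)
    have [measurable]: "(\<lambda>v. cos (v * z) * Re (g v)) \<in> borel_measurable borel"
      by (intro borel_measurable_continuous_onI cont_cos)
    show "(\<lambda>v. indicat_real {0..} v *\<^sub>R (cos (v * z) * Re (g v))) \<in> borel_measurable lborel"
      by measurable
  qed (auto intro!: AE_I2 mult_left_le_one_le simp: indicator_def abs_mult)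
  have eq: "set_lebesgue_integral lborel {0..b} (\<lambda>v. cos (v * z) * Re (g v)) = cpart b z" for b
    unfolding cpart_def using set_integrable_subset[OF int, of "{0..b}"]
    by (auto dest: set_borel_integral_eq_integral(2))
  have "((\<lambda>b. cpart b z) \<longlongrightarrow> set_lebesgue_integral lborel {0..} (\<lambda>v. cos (v * z) * Re (g v))) at_top"
    unfolding eq[symmetric] by (rule tendsto_set_lebesgue_integral_at_top[OF _ int]) auto
  moreover have "set_lebesgue_integral lborel {0..} (\<lambda>v. cos (v * z) * Re (g v)) = pi * R_part \<beta> \<psi> z"
    by (simp add: R_part_def resolvent_re_eq)
  ultimately have "((\<lambda>b. \<bar>cpart T z - cpart b z\<bar>) \<longlongrightarrow> \<bar>cpart T z - pi * R_part \<beta> \<psi> z\<bar>) at_top"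
    by (intro tendsto_intros) simp
  moreover have "\<forall>\<^sub>F b in at_top. \<bar>cpart T z - cpart b z\<bar> \<le> tail T"
    using eventually_ge_at_top[of T]
  proof eventually_elim
    case (elim b)
    have "cpart b z = cpart T z + integral {T..b} (\<lambda>v. cos (v * z) * Re (g v))"
      unfolding cpart_def using elim T by (intro integral_split cont_cos) auto
    then show ?case using abs_integral_cos_le[OF T, of b z] by simp
  qed
  ultimately show ?thesis by (intro tendsto_upperbound[of _ _ at_top]) auto
qed

lemma upart_uniform:
  assumes ab: "0 < a" "a \<le> b" and \<epsilon>: "0 < \<epsilon>"
  shows "\<exists>T0\<ge>0. \<forall>T\<ge>T0. \<forall>z. a \<le> \<bar>z\<bar> \<and> \<bar>z\<bar> \<le> b \<longrightarrow> \<bar>upart T z - u z\<bar> \<le> \<epsilon>"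
proof -
  obtain T0 where T0: "T0 \<ge> 0" "\<forall>T\<ge>T0. \<forall>z. a \<le> \<bar>z\<bar> \<and> \<bar>z\<bar> \<le> b \<longrightarrow> \<bar>spart T z - slim z\<bar> \<le> \<epsilon> / 2"
    using spart_uniform[OF ab, of "\<epsilon> / 2"] \<epsilon> by auto
  have "\<forall>\<^sub>F A in at_top. tail A < \<epsilon> / 2"
    using tail_tendsto_0 \<epsilon> by (intro order_tendstoD(2)) auto
  then obtain T1 where T1: "\<And>A. A \<ge> T1 \<Longrightarrow> tail A < \<epsilon> / 2"
    unfolding eventually_at_top_linorder by auto
  show ?thesis
  proof (intro exI[of _ "max T0 T1"] conjI allI impI)
    fix T z assume T: "max T0 T1 \<le> T" and z: "a \<le> \<bar>z\<bar> \<and> \<bar>z\<bar> \<le> b"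
    have "\<bar>cpart T z - pi * R_part \<beta> \<psi> z\<bar> \<le> \<epsilon> / 2"
      using cpart_uniform[of T z] T1[of T] T T0(1) by linarith
    moreover have "\<bar>spart T z - slim z\<bar> \<le> \<epsilon> / 2" using T0(2) T z by auto
    ultimately have "\<bar>(cpart T z - pi * R_part \<beta> \<psi> z) + (spart T z - slim z)\<bar> \<le> \<epsilon>" by linarith
    moreover have "upart T z - u z = ((cpart T z - pi * R_part \<beta> \<psi> z) + (spart T z - slim z)) / pi"
      by (simp add: upart_def potential_density_def H_part_eq field_simps)
    ultimately have "\<bar>upart T z - u z\<bar> \<le> \<epsilon> / pi"
      by (simp add: abs_divide divide_right_mono)
    also have "\<dots> \<le> \<epsilon> / 1" using pi_gt3 \<epsilon> by (intro divide_left_mono) auto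
    finally show "\<bar>upart T z - u z\<bar> \<le> \<epsilon>" by simp
  qed (use T0 in auto)
qed

lemma cont_cpart: "continuous_on A (cpart T)"
  and cont_spart: "continuous_on A (spart T)"
proof -
  have "continuous_on A (\<lambda>z. integral (cbox 0 T) (\<lambda>v. cos (v * z) * Re (g v)))"
    by (rule integral_continuous_on_param)
      (auto simp: split_beta intro!: continuous_intros continuous_on_compose2[OF cont_g])
  then show "continuous_on A (cpart T)" by (simp add: cpart_def[abs_def])
  have "continuous_on A (\<lambda>z. integral (cbox 0 T) (\<lambda>v. sin (v * z) * Im (g v)))"
    by (rule integral_continuous_on_param)
      (auto simp: split_beta intro!: continuous_intros continuous_on_compose2[OF cont_g])
  then show "continuous_on A (spart T)" by (simp add: spart_def[abs_def])
qed

lemma cont_upart: "continuous_on A (upart T)"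
  unfolding upart_def[abs_def] by (intro continuous_intros cont_cpart cont_spart) auto

lemma isCont_u: assumes "z \<noteq> 0" shows "isCont u z"
proof -
  let ?A = "{x. \<bar>z\<bar> / 2 < \<bar>x\<bar> \<and> \<bar>x\<bar> < 2 * \<bar>z\<bar>}"
  have "continuous_on ?A u"
  proof (rule uniform_limit_theorem[of _ _ at_top])
    show "uniform_limit ?A upart u at_top"
    proof (rule uniform_limitI)
      fix e :: real assume "e > 0"
      then obtain T0 where "\<forall>T\<ge>T0. \<forall>x. \<bar>z\<bar> / 2 \<le> \<bar>x\<bar> \<and> \<bar>x\<bar> \<le> 2 * \<bar>z\<bar> \<longrightarrow> \<bar>upart T x - u x\<bar> \<le> e / 2"
        using upart_uniform[of "\<bar>z\<bar> / 2" "2 * \<bar>z\<bar>" "e / 2"] assms by auto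
      note T0 = this
      have "\<forall>T\<ge>T0. \<forall>x\<in>?A. dist (upart T x) (u x) < e"
      proof (intro allI impI ballI)
        fix T x assume "T \<ge> T0" "x \<in> ?A"
        then have "\<bar>upart T x - u x\<bar> \<le> e / 2" using T0 by auto
        then show "dist (upart T x) (u x) < e" using \<open>e > 0\<close> by (simp add: dist_real_def)
      qed
      then show "\<forall>\<^sub>F T in at_top. \<forall>x\<in>?A. dist (upart T x) (u x) < e"
        unfolding eventually_at_top_linorder by blast
    qed
  qed (auto intro!: always_eventually cont_upart)
  moreover have "open ?A" by (intro open_Collect_conj open_Collect_less continuous_intros)
  ultimately show ?thesis using assms by (simp add: continuous_on_eq_continuous_at)
qed

section \<open>Identification of the density by Levy inversion\<close>

abbreviation \<rho> :: "real measure" where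
  "\<rho> \<equiv> resolvent \<beta>"

lemma rho_rd: "real_distribution \<rho>"
  by (rule resolvent_rd[OF \<beta>])

lemma integral_osc_symmetric:
  assumes "0 \<le> T"
  shows "integral {- T..T} (\<lambda>t. iexp (- (t * x)) * g t) = complex_of_real (2 * pi * upart T x)"
proof -
  let ?h = "\<lambda>t. iexp (- (t * x)) * g t"
  have h: "?h = osc x" by (auto simp: osc_def)
  have "integral {- T..T} ?h = integral {- T..0} ?h + integral {0..T} ?h"
    unfolding h using assms by (intro Henstock_Kurzweil_Integration.integral_combine[symmetric] integrable_on_Icc cont_osc) auto
  also have "integral {- T..0} ?h = integral {0..T} (\<lambda>t. ?h (- t))"
    using Henstock_Kurzweil_Integration.integral_reflect_real[of T 0 "\<lambda>t. ?h (- t)"] by simp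
  also have "(\<lambda>t. ?h (- t)) = cnj \<circ> ?h"
    by (auto simp: g_minus exp_cnj)
  also have "integral {0..T} (cnj \<circ> ?h) = cnj (integral {0..T} ?h)"
    unfolding h by (intro integral_linear integrable_on_Icc cont_osc bounded_linear_cnj)
  also have "cnj (integral {0..T} ?h) + integral {0..T} ?h = complex_of_real (2 * Re (integral {0..T} ?h))"
    by (simp add: complex_eq_iff)
  also have "Re (integral {0..T} ?h) = pi * upart T x"
    unfolding h Re_integral_osc by (simp add: upart_def cpart_def spart_def)
  finally show ?thesis by (simp add: mult_ac)
qed

text \<open>Levy's formula for char \<rho> = \<beta> g. Its quotient is the integral of iexp (- (t *
  x)) over x in {a..b}; exchanging the integrals over a compact rectangle leaves the truncations of
  u.\<close>

lemma inversion:
  assumes ab: "a < b" and atoms: "measure \<rho> {a} = 0" "measure \<rho> {b} = 0"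
  shows "(\<lambda>T::nat. \<beta> * integral {a..b} (upart T)) \<longlonglongrightarrow> measure \<rho> {a<..b}"
proof -
  interpret real_distribution \<rho> by (rule rho_rd)
  have "1 / (2 * pi) * (CLBINT t=- real T..real T. (iexp (- (t * a)) - iexp (- (t * b))) / (\<i> * t) * char \<rho> t) =
      complex_of_real (\<beta> * integral {a..b} (upart T))" for T :: nat
  proof -
    \<comment> \<open>\<open>E\<close> is continuous also at t = 0, where the quotient is 0 by the
      convention on division; this changes a null set only.\<close>
    define E where "E t = integral {a..b} (\<lambda>x. iexp (- (t * x)))" for t
    have E: "(iexp (- (t * a)) - iexp (- (t * b))) / (\<i> * t) = E t" if "t \<noteq> 0" for t
    proof -
      have "((\<lambda>x. iexp (- (t * x))) has_integral
          (- iexp (- (t * b)) / (\<i> * t) - - iexp (- (t * a)) / (\<i> * t))) {a..b}"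
      proof (rule fundamental_theorem_of_calculus)
        show "a \<le> b" using ab by simp
        show "((\<lambda>x. - iexp (- (t * x)) / (\<i> * t)) has_vector_derivative iexp (- (t * x))) (at x within {a..b})" for x
          using that by (auto intro!: derivative_eq_intros has_vector_derivative_real_field simp: field_simps)
      qed
      then show ?thesis unfolding E_def by (simp add: integral_unique diff_divide_distrib)
    qed
    have cE: "continuous_on UNIV E"
    proof -
      have "continuous_on UNIV (\<lambda>t. integral (cbox a b) (\<lambda>x. iexp (- (t * x))))"
        by (rule integral_continuous_on_param) (auto simp: split_beta intro!: continuous_intros)
      then show ?thesis by (simp add: E_def[abs_def])
    qed
    have "(CLBINT t=- real T..real T. (iexp (- (t * a)) - iexp (- (t * b))) / (\<i> * t) * char \<rho> t) =
        (CLBINT t:{- real T..real T}. (iexp (- (t * a)) - iexp (- (t * b))) / (\<i> * t) * char \<rho> t)"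
      using interval_integral_Icc[of "- real T" "real T"] by simp
    also have "\<dots> = (CLBINT t:{- real T..real T}. E t * (\<beta> * g t))"
      unfolding set_lebesgue_integral_def
    proof (rule Bochner_Integration.integral_cong_AE)
      have "AE t in lborel. t \<noteq> (0::real)" by (rule AE_lborel_singleton)
      then show "AE t in lborel. indicator {- real T..real T} t *\<^sub>R
          ((iexp (- (t * a)) - iexp (- (t * b))) / (\<i> * t) * char \<rho> t) =
        indicator {- real T..real T} t *\<^sub>R (E t * (\<beta> * g t))"
        by eventually_elim (simp only: E char_\<beta> not_False_eq_True)
      have [measurable]: "E \<in> borel_measurable borel" "g \<in> borel_measurable borel"
        by (auto intro!: borel_measurable_continuous_onI cE cont_g)
      show "(\<lambda>t. indicator {- real T..real T} t *\<^sub>R (E t * (\<beta> * g t))) \<in> borel_measurable lborel"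
        by measurable
      show "(\<lambda>t. indicator {- real T..real T} t *\<^sub>R
          ((iexp (- (t * a)) - iexp (- (t * b))) / (\<i> * t) * char \<rho> t)) \<in> borel_measurable lborel"
        by measurable
    qed
    also have "\<dots> = integral {- real T..real T} (\<lambda>t. E t * (\<beta> * g t))"
    proof (rule set_borel_integral_eq_integral(2))
      show "set_integrable lborel {- real T..real T} (\<lambda>t. E t * (\<beta> * g t))"
        by (intro borel_integrable_atLeastAtMost' continuous_intros cont_g continuous_on_subset[OF cE]) auto
    qed
    also have "\<dots> = integral (cbox (- real T) (real T)) (\<lambda>t. integral (cbox a b) (\<lambda>x. \<beta> * (iexp (- (t * x)) * g t)))"
      unfolding E_def cbox_interval
      by (intro integral_cong) (subst integral_mult_left[symmetric], simp add: mult_ac)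
    also have "\<dots> = integral (cbox a b) (\<lambda>x. integral (cbox (- real T) (real T)) (\<lambda>t. \<beta> * (iexp (- (t * x)) * g t)))"
      by (rule integral_swap_continuous)
        (auto simp: split_beta intro!: continuous_intros continuous_on_compose2[OF cont_g])
    also have "\<dots> = integral {a..b} (\<lambda>x. complex_of_real (\<beta> * (2 * pi * upart T x)))"
      unfolding cbox_interval integral_mult_right integral_osc_symmetric[OF of_nat_0_le_iff] by simp
    also have "\<dots> = complex_of_real (integral {a..b} (\<lambda>x. \<beta> * (2 * pi * upart T x)))"
    proof -
      have "integral {a..b} (complex_of_real \<circ> (\<lambda>x. \<beta> * (2 * pi * upart T x))) =
          complex_of_real (integral {a..b} (\<lambda>x. \<beta> * (2 * pi * upart T x)))"
        by (intro integral_linear integrable_on_Icc bounded_linear_of_real continuous_intros cont_upart)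
      then show ?thesis by (simp only: o_def)
    qed
    also have "integral {a..b} (\<lambda>x. \<beta> * (2 * pi * upart T x)) = 2 * pi * (\<beta> * integral {a..b} (upart T))"
      by simp
    finally show ?thesis by simp
  qed
  then have "(\<lambda>T::nat. complex_of_real (\<beta> * integral {a..b} (upart T))) \<longlonglongrightarrow> complex_of_real (measure \<rho> {a<..b})"
    using Levy_Inversion[OF less_imp_le[OF ab] atoms] by simp
  then show ?thesis by (simp only: tendsto_of_real_iff)
qed

text \<open>The interval avoids 0, so the truncations converge uniformly on it. A constant w in
  place of an integral of u lets the bound pass to intervals meeting 0, where u is not yet known to
  be continuous.\<close>

lemma measure_interval_bound_nonatomic:
  assumes ab: "a < b" "0 < a \<or> b < 0" and atoms: "measure \<rho> {a} = 0" "measure \<rho> {b} = 0"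
    and bd: "\<And>x. x \<in> {a..b} \<Longrightarrow> \<bar>u x - w\<bar> \<le> \<eta>"
  shows "\<bar>measure \<rho> {a<..b} - \<beta> * w * (b - a)\<bar> \<le> \<beta> * \<eta> * (b - a)"
proof (rule field_le_epsilon)
  fix e :: real assume e: "0 < e"
  define \<epsilon> where "\<epsilon> = e / (\<beta> * (b - a))"
  have \<epsilon>: "0 < \<epsilon>" using e ab \<beta> by (simp add: \<epsilon>_def)
  obtain T0 where T0: "\<forall>T\<ge>T0. \<forall>z. min \<bar>a\<bar> \<bar>b\<bar> \<le> \<bar>z\<bar> \<and> \<bar>z\<bar> \<le> max \<bar>a\<bar> \<bar>b\<bar> \<longrightarrow> \<bar>upart T z - u z\<bar> \<le> \<epsilon>"
    using upart_uniform[of "min \<bar>a\<bar> \<bar>b\<bar>" "max \<bar>a\<bar> \<bar>b\<bar>" \<epsilon>] ab \<epsilon> by auto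
  have "(\<lambda>T::nat. \<bar>\<beta> * integral {a..b} (upart T) - \<beta> * w * (b - a)\<bar>) \<longlonglongrightarrow>
      \<bar>measure \<rho> {a<..b} - \<beta> * w * (b - a)\<bar>"
    by (intro tendsto_intros inversion ab atoms)
  moreover have "\<exists>N. \<forall>T\<ge>N. \<bar>\<beta> * integral {a..b} (upart (real T)) - \<beta> * w * (b - a)\<bar> \<le> \<beta> * \<eta> * (b - a) + e"
  proof (intro exI[of _ "nat \<lceil>T0\<rceil>"] allI impI)
    fix T assume "nat \<lceil>T0\<rceil> \<le> T"
    then have T: "T0 \<le> real T" by linarith
    have "norm (integral {a..b} (\<lambda>x. upart T x - w)) \<le> (\<eta> + \<epsilon>) * (b - a)"
    proof (rule integral_bound)
      show "a \<le> b" using ab by simp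
      show "continuous_on {a..b} (\<lambda>x. upart T x - w)" by (intro continuous_intros cont_upart)
      fix x assume x: "x \<in> {a..b}"
      then have "min \<bar>a\<bar> \<bar>b\<bar> \<le> \<bar>x\<bar> \<and> \<bar>x\<bar> \<le> max \<bar>a\<bar> \<bar>b\<bar>" using ab(2) by auto
      then have "\<bar>upart T x - u x\<bar> \<le> \<epsilon>" using T0 T by blast
      then show "norm (upart T x - w) \<le> \<eta> + \<epsilon>" using bd[OF x] by simp
    qed
    moreover have "integral {a..b} (\<lambda>x. upart T x - w) = integral {a..b} (upart T) - w * (b - a)"
      using ab by (subst integral_diff) (auto intro!: integrable_on_Icc cont_upart simp: mult.commute)
    ultimately have "\<beta> * \<bar>integral {a..b} (upart T) - w * (b - a)\<bar> \<le> \<beta> * ((\<eta> + \<epsilon>) * (b - a))"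
      using \<beta> by (intro mult_left_mono) auto
    also have "\<dots> = \<beta> * \<eta> * (b - a) + e"
      using ab \<beta> by (simp add: \<epsilon>_def field_simps)
    also have "\<beta> * \<bar>integral {a..b} (upart T) - w * (b - a)\<bar> = \<bar>\<beta> * integral {a..b} (upart T) - \<beta> * w * (b - a)\<bar>"
      using \<beta> by (simp add: abs_mult[symmetric] right_diff_distrib mult.assoc abs_mult_pos')
    finally show "\<bar>\<beta> * integral {a..b} (upart (real T)) - \<beta> * w * (b - a)\<bar> \<le> \<beta> * \<eta> * (b - a) + e" .
  qed
  ultimately show "\<bar>measure \<rho> {a<..b} - \<beta> * w * (b - a)\<bar> \<le> \<beta> * \<eta> * (b - a) + e"
    by (rule LIMSEQ_le_const2)
qed

text \<open>Atoms are countable. A point and its mirror image are found together because the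
  argument at 0 uses symmetric intervals.\<close>

lemma exists_nonatom:
  assumes "a < b"
  shows "\<exists>x\<in>{a<..<b}. measure \<rho> {x} = 0 \<and> measure \<rho> {- x} = 0"
proof -
  interpret real_distribution \<rho> by (rule rho_rd)
  let ?A = "{x. measure \<rho> {x} \<noteq> 0}"
  have "countable (?A \<union> uminus ` ?A)" using countable_support by auto
  then have "\<not> {a<..<b} \<subseteq> ?A \<union> uminus ` ?A"
    using uncountable_open_interval[of a b] assms countable_subset by blast
  then obtain x where "x \<in> {a<..<b}" "x \<notin> ?A" "x \<notin> uminus ` ?A" by blast
  then show ?thesis by (intro bexI[of _ x]) (auto, metis (mono_tags, lifting) image_eqI mem_Collect_eq minus_minus)
qed

text \<open>Over a symmetric interval the odd sine part integrates to 0 and the cosine part is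
  bounded by \<open>tail 0\<close>, so the mass near 0 is at most of the order of the length,
  although u is not controlled there.\<close>

lemma no_atom_0: "measure \<rho> {0} = 0"
proof -
  interpret real_distribution \<rho> by (rule rho_rd)
  define c where "c = \<beta> * (tail 0 / pi) * 2"
  have c: "0 \<le> c" unfolding c_def using \<beta> tail_nonneg[of 0] by simp
  have bound: "measure \<rho> {0} \<le> c * \<kappa>" if \<kappa>: "0 < \<kappa>" "measure \<rho> {\<kappa>} = 0" "measure \<rho> {- \<kappa>} = 0" for \<kappa>
  proof -
    have le: "\<beta> * integral {- \<kappa>..\<kappa>} (upart T) \<le> c * \<kappa>" if "0 \<le> T" for T
    proof -
      have "integral {- \<kappa>..\<kappa>} (spart T) = integral {- \<kappa>..\<kappa>} (\<lambda>x. spart T (- x))"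
        using Henstock_Kurzweil_Integration.integral_reflect_real[of \<kappa> "- \<kappa>" "spart T"] by simp
      also have "(\<lambda>x. spart T (- x)) = (\<lambda>x. - spart T x)" by (simp add: spart_def)
      also have "integral {- \<kappa>..\<kappa>} (\<lambda>x. - spart T x) = - integral {- \<kappa>..\<kappa>} (spart T)" by simp
      finally have s0: "integral {- \<kappa>..\<kappa>} (spart T) = 0" by simp
      have c0: "norm (integral {- \<kappa>..\<kappa>} (cpart T)) \<le> tail 0 * (\<kappa> - - \<kappa>)"
      proof (rule integral_bound)
        show "norm (cpart T x) \<le> tail 0" for x
          unfolding cpart_def by (simp add: abs_integral_cos_le)
      qed (use \<kappa> cont_cpart in auto)
      have "integral {- \<kappa>..\<kappa>} (upart T) = (integral {- \<kappa>..\<kappa>} (cpart T) + integral {- \<kappa>..\<kappa>} (spart T)) / pi"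
        unfolding upart_def by (subst integral_add[symmetric]) (auto intro!: integrable_on_Icc cont_spart cont_cpart)
      also have "\<dots> \<le> tail 0 * (\<kappa> - - \<kappa>) / pi"
        using c0 unfolding s0 by (intro divide_right_mono) auto
      finally have "\<beta> * integral {- \<kappa>..\<kappa>} (upart T) \<le> \<beta> * (tail 0 * (\<kappa> - - \<kappa>) / pi)"
        using \<beta> by (intro mult_left_mono) auto
      then show ?thesis by (simp add: c_def mult_ac)
    qed
    have "measure \<rho> {- \<kappa><..\<kappa>} \<le> c * \<kappa>"
      using inversion[of "- \<kappa>" \<kappa>] \<kappa> le by (intro LIMSEQ_le_const2) auto
    moreover have "measure \<rho> {0} \<le> measure \<rho> {- \<kappa><..\<kappa>}"
      using \<kappa> by (intro finite_measure_mono) auto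
    ultimately show ?thesis by simp
  qed
  have "measure \<rho> {0} \<le> 0 + e" if e: "0 < e" for e
  proof -
    obtain \<kappa> where \<kappa>: "\<kappa> \<in> {0<..<e / (c + 1)}" "measure \<rho> {\<kappa>} = 0" "measure \<rho> {- \<kappa>} = 0"
      using exists_nonatom[of 0 "e / (c + 1)"] e c by auto
    have "c * \<kappa> \<le> (c + 1) * \<kappa>" using \<kappa> by (intro mult_right_mono) auto
    also have "\<dots> \<le> e" using \<kappa> c by (auto simp: field_simps)
    finally show ?thesis using bound[of \<kappa>] \<kappa> by simp
  qed
  then have "measure \<rho> {0} \<le> 0" by (rule field_le_epsilon)
  then show ?thesis by (simp add: measure_le_0_iff)
qed

lemma no_atom: "measure \<rho> {z} = 0"
proof (cases "z = 0")
  case True then show ?thesis using no_atom_0 by simp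
next
  case False
  interpret real_distribution \<rho> by (rule rho_rd)
  have "\<exists>d>0. \<forall>x. \<bar>x - z\<bar> < d \<longrightarrow> \<bar>u x - u z\<bar> < 1"
    using isCont_u[OF False] unfolding continuous_at_eps_delta dist_real_def
    by (rule allE[of _ 1]) auto
  then obtain d where d: "d > 0" "\<And>x. \<bar>x - z\<bar> < d \<Longrightarrow> \<bar>u x - u z\<bar> < 1"
    by blast
  define c where "c = \<beta> * \<bar>u z\<bar> + \<beta>"
  have c: "0 < c" unfolding c_def using \<beta> by (intro add_nonneg_pos) auto
  have "measure \<rho> {z} \<le> 0 + e" if e: "0 < e" for e
  proof -
    define r where "r = min (min d \<bar>z\<bar>) (e / (2 * c))"
    have r: "0 < r" "r \<le> d" "r \<le> \<bar>z\<bar>" "r \<le> e / (2 * c)" unfolding r_def using d False e c by auto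
    obtain a where a: "a \<in> {z - r<..<z}" "measure \<rho> {a} = 0" using exists_nonatom[of "z - r" z] r by auto
    obtain b where b: "b \<in> {z<..<z + r}" "measure \<rho> {b} = 0" using exists_nonatom[of z "z + r"] r by auto
    have "\<bar>measure \<rho> {a<..b} - \<beta> * u z * (b - a)\<bar> \<le> \<beta> * 1 * (b - a)"
    proof (rule measure_interval_bound_nonatomic)
      show "\<bar>u x - u z\<bar> \<le> 1" if "x \<in> {a..b}" for x
        using that a b r by (intro less_imp_le d(2)) auto
    qed (use a b r in auto)
    then have "measure \<rho> {a<..b} \<le> \<beta> * u z * (b - a) + \<beta> * (b - a)" by linarith
    also have "\<dots> \<le> \<beta> * \<bar>u z\<bar> * (b - a) + \<beta> * (b - a)"
      using \<beta> a b by (intro add_right_mono mult_right_mono mult_left_mono) auto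
    also have "\<dots> = c * (b - a)" by (simp add: c_def algebra_simps)
    also have "\<dots> \<le> c * (2 * r)" using a b c by (intro mult_left_mono) auto
    also have "\<dots> \<le> e" using r c by (simp add: field_simps)
    finally have "measure \<rho> {a<..b} \<le> e" .
    moreover have "measure \<rho> {z} \<le> measure \<rho> {a<..b}" using a b by (intro finite_measure_mono) auto
    ultimately show ?thesis by simp
  qed
  then have "measure \<rho> {z} \<le> 0" by (rule field_le_epsilon)
  then show ?thesis by (simp add: measure_le_0_iff)
qed

text \<open>Without atoms the distribution function is continuous: an interval ending at 0 is a
  limit of intervals avoiding it, and one containing 0 is cut there. The value of u at 0 is not
  consulted.\<close>

lemma measure_interval_bound:
  assumes ab: "a < b" and bd: "\<And>x. x \<in> {a..b} \<Longrightarrow> x \<noteq> 0 \<Longrightarrow> \<bar>u x - w\<bar> \<le> \<eta>"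
  shows "\<bar>measure \<rho> {a<..b} - \<beta> * w * (b - a)\<bar> \<le> \<beta> * \<eta> * (b - a)"
proof -
  interpret real_distribution \<rho> by (rule rho_rd)
  have cont: "isCont (cdf \<rho>) x" for x
    unfolding isCont_cdf by (rule no_atom)
  have away: "\<bar>cdf \<rho> q - cdf \<rho> p - \<beta> * w * (q - p)\<bar> \<le> \<beta> * \<eta> * (q - p)"
    if "a \<le> p" "p < q" "q \<le> b" "0 < p \<or> q < 0" for p q
    using measure_interval_bound_nonatomic[of p q w \<eta>] that bd no_atom by (auto simp: cdf_diff_eq)
  have right: "\<bar>cdf \<rho> q - cdf \<rho> 0 - \<beta> * w * (q - 0)\<bar> \<le> \<beta> * \<eta> * (q - 0)" if "a \<le> 0" "0 < q" "q \<le> b" for q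
  proof (rule tendsto_le[of "at_right 0"])
    show "((\<lambda>p. \<bar>cdf \<rho> q - cdf \<rho> p - \<beta> * w * (q - p)\<bar>) \<longlongrightarrow> \<bar>cdf \<rho> q - cdf \<rho> 0 - \<beta> * w * (q - 0)\<bar>) (at_right 0)"
      using cont[of 0] by (intro tendsto_intros) (simp add: isCont_def filterlim_at_split)
    show "((\<lambda>p. \<beta> * \<eta> * (q - p)) \<longlongrightarrow> \<beta> * \<eta> * (q - 0)) (at_right 0)" by (intro tendsto_intros)
    show "\<forall>\<^sub>F p in at_right 0. \<bar>cdf \<rho> q - cdf \<rho> p - \<beta> * w * (q - p)\<bar> \<le> \<beta> * \<eta> * (q - p)"
      unfolding eventually_at_right_field using that by (intro exI[of _ q]) (auto intro!: away)
  qed simp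
  have left: "\<bar>cdf \<rho> 0 - cdf \<rho> p - \<beta> * w * (0 - p)\<bar> \<le> \<beta> * \<eta> * (0 - p)" if "a \<le> p" "p < 0" "0 \<le> b" for p
  proof (rule tendsto_le[of "at_left 0"])
    show "((\<lambda>q. \<bar>cdf \<rho> q - cdf \<rho> p - \<beta> * w * (q - p)\<bar>) \<longlongrightarrow> \<bar>cdf \<rho> 0 - cdf \<rho> p - \<beta> * w * (0 - p)\<bar>) (at_left 0)"
      using cont[of 0] by (intro tendsto_intros) (simp add: isCont_def filterlim_at_split)
    show "((\<lambda>q. \<beta> * \<eta> * (q - p)) \<longlongrightarrow> \<beta> * \<eta> * (0 - p)) (at_left 0)" by (intro tendsto_intros)
    show "\<forall>\<^sub>F q in at_left 0. \<bar>cdf \<rho> q - cdf \<rho> p - \<beta> * w * (q - p)\<bar> \<le> \<beta> * \<eta> * (q - p)"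
      unfolding eventually_at_left_field using that by (intro exI[of _ p]) (auto intro!: away)
  qed simp
  consider "0 < a \<or> b < 0" | "a = 0" | "b = 0" | "a < 0" "0 < b" using ab by linarith
  then have "\<bar>cdf \<rho> b - cdf \<rho> a - \<beta> * w * (b - a)\<bar> \<le> \<beta> * \<eta> * (b - a)"
  proof cases
    case 1 then show ?thesis using away[of a b] ab by simp
  next
    case 2 then show ?thesis using right[of b] ab by simp
  next
    case 3 then show ?thesis using left[of a] ab by simp
  next
    case 4
    have "\<beta> * w * (b - a) = \<beta> * w * (b - 0) + \<beta> * w * (0 - a)"
      "\<beta> * \<eta> * (b - a) = \<beta> * \<eta> * (b - 0) + \<beta> * \<eta> * (0 - a)"
      by (simp_all add: algebra_simps)
    then show ?thesis using right[of b] left[of a] 4 by linarith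
  qed
  then show ?thesis using cdf_diff_eq[OF ab] by simp
qed

section \<open>The maximum principle for the potential density\<close>

text \<open>
  With \<open>\<kappa> = resolvent (\<beta> / p)\<close>, the resolvent equation writes \<open>\<rho>\<close> as the law of a random walk with steps
  \<open>\<kappa>\<close> stopped at a geometric time of parameter \<open>p\<close>, for which the maximum principle is elementary up to
  an error \<open>p * b\<close>.
\<close>

lemma max_principle:
  fixes f :: "real \<Rightarrow> real"
  assumes f[measurable]: "f \<in> borel_measurable borel" and bd: "\<And>x. \<bar>f x\<bar> \<le> b"
    and a: "0 \<le> a" and le: "\<And>x. 0 < f x \<Longrightarrow> (\<integral>y. f (x + y) \<partial>\<rho>) \<le> a"
  shows "(\<integral>y. f (x + y) \<partial>\<rho>) \<le> a"
proof -
  interpret \<rho>: real_distribution \<rho> by (rule rho_rd)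
  define h where "h x = (\<integral>y. f (x + y) \<partial>\<rho>)" for x
  have b: "0 \<le> b" using bd[of 0] by linarith
  have h_meas[measurable]: "h \<in> borel_measurable borel" unfolding h_def by measurable
  have int_f: "integrable \<rho> (\<lambda>y. f (x + y))" for x
    by (rule \<rho>.integrable_const_bound[where B = b]) (auto simp: bd)
  have h_bd: "\<bar>h x\<bar> \<le> b" for x
  proof -
    have "norm (h x) \<le> (\<integral>y. b \<partial>\<rho>)"
      unfolding h_def by (rule Bochner_Integration.integral_norm_bound_integral[OF int_f]) (auto simp: bd)
    then show ?thesis using \<rho>.prob_space by simp
  qed
  have step: "h x \<le> p * b + (1 - p) * a" if p: "0 < p" "p < 1" for p x
  proof -
    define q where "q = \<beta> / p"
    have q: "0 < q" "p * q = \<beta>" using \<beta> p by (auto simp: q_def)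
    define \<kappa> where "\<kappa> = resolvent q"
    have \<kappa>_rd: "real_distribution \<kappa>" unfolding \<kappa>_def by (rule resolvent_rd[OF q(1)])
    interpret \<kappa>: real_distribution \<kappa> by (rule \<kappa>_rd)
    have char_eq: "char \<rho> v = p * char \<kappa> v + (1 - complex_of_real p) * (char \<kappa> v * char \<rho> v)" for v
    proof -
      have d: "complex_of_real q + \<psi> v \<noteq> 0" "complex_of_real \<beta> + \<psi> v \<noteq> 0"
        using denominator_nonzero q \<beta> by auto
      have "complex_of_real p * complex_of_real q = complex_of_real \<beta>" using q(2) by (metis of_real_mult)
      then have "complex_of_real p * (of_real q / (of_real q + \<psi> v)) +
          (1 - complex_of_real p) * ((of_real q / (of_real q + \<psi> v)) * (of_real \<beta> / (of_real \<beta> + \<psi> v))) =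
        of_real \<beta> / (of_real \<beta> + \<psi> v)"
        using d by (simp add: divide_simps) (simp add: algebra_simps)
      then show ?thesis unfolding \<kappa>_def char_resolvent[OF q(1)] char_resolvent[OF \<beta>] by simp
    qed
    \<comment> \<open>V is the payoff of stopping at x with probability p and continuing otherwise,
      and h averages V over one step of law \<kappa>.\<close>
    define V where "V x = p * f x + (1 - p) * h x" for x
    have [measurable]: "V \<in> borel_measurable borel" unfolding V_def by measurable
    have V_bd: "\<bar>V x\<bar> \<le> b" for x
    proof -
      have "\<bar>V x\<bar> \<le> p * \<bar>f x\<bar> + (1 - p) * \<bar>h x\<bar>"
        unfolding V_def using p by (intro order.trans[OF abs_triangle_ineq]) (simp add: abs_mult)
      also have "\<dots> \<le> p * b + (1 - p) * b"
        using p bd h_bd by (intro add_mono mult_left_mono) auto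
      finally show ?thesis by (simp add: algebra_simps)
    qed
    have int_V: "integrable \<kappa> (\<lambda>y. V (x + y))" for x
      by (rule \<kappa>.integrable_const_bound[where B = b]) (auto simp: V_bd)
    have hV: "h x = (\<integral>y. V (x + y) \<partial>\<kappa>)" for x
    proof -
      have "h x = p * (\<integral>y. f (x + y) \<partial>\<kappa>) + (1 - p) * (\<integral>y. (\<integral>z. f (x + (y + z)) \<partial>\<rho>) \<partial>\<kappa>)"
        unfolding h_def by (rule integral_add_mixture[where b = b, OF \<kappa>_rd rho_rd p char_eq]) (auto simp: bd)
      also have "\<dots> = p * (\<integral>y. f (x + y) \<partial>\<kappa>) + (1 - p) * (\<integral>y. h (x + y) \<partial>\<kappa>)"
        by (simp add: h_def add.assoc)
      also have "\<dots> = (\<integral>y. V (x + y) \<partial>\<kappa>)"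
      proof -
        have "integrable \<kappa> (\<lambda>y. f (x + y))" "integrable \<kappa> (\<lambda>y. h (x + y))"
          by (rule \<kappa>.integrable_const_bound[where B = b]; auto simp: bd h_bd)+
        then show ?thesis unfolding V_def by simp
      qed
      finally show ?thesis .
    qed
    define m where "m = p * b + (1 - p) * a"
    have m: "0 \<le> m" unfolding m_def using p a b by simp
    define S where "S = Sup (range V)"
    have bdd: "bdd_above (range V)" using V_bd by (intro bdd_aboveI[of _ b]) (auto simp: abs_le_iff)
    have V_le: "V x \<le> S" for x unfolding S_def by (rule cSUP_upper[OF _ bdd]) simp
    have h_le: "h x \<le> S" for x
    proof -
      have "(\<integral>y. V (x + y) \<partial>\<kappa>) \<le> (\<integral>y. S \<partial>\<kappa>)"
        by (rule integral_mono[OF int_V]) (auto simp: V_le)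
      then show ?thesis unfolding hV using \<kappa>.prob_space by simp
    qed
    \<comment> \<open>At a point where V nearly attains S, either f is positive and the hypothesis
      bounds V by m, or f is at most 0 and V is at most (1 - p) * S, which is less than S.\<close>
    have "S \<le> m"
    proof (rule ccontr)
      assume "\<not> S \<le> m"
      then have S: "m < S" "0 < S" using m by auto
      have "(1 - p) * S < S" using S p by (simp add: algebra_simps)
      then have "max m ((1 - p) * S) < Sup (range V)" using S by (simp add: S_def)
      then obtain x where x: "max m ((1 - p) * S) < V x"
        by (subst (asm) less_cSUP_iff[OF _ bdd]) auto
      show False
      proof (cases "0 < f x")
        case True
        have "V x \<le> p * b + (1 - p) * a"
          unfolding V_def using p bd[of x] le[OF True]
          by (intro add_mono mult_left_mono) (auto simp: h_def)
        then show False using x by (simp add: m_def)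
      next
        case False
        then have "V x \<le> 0 + (1 - p) * S"
          unfolding V_def using p h_le by (intro add_mono mult_left_mono) (auto simp: mult_le_0_iff)
        then show False using x by simp
      qed
    qed
    then show ?thesis using h_le[of x] by (simp add: m_def)
  qed
  \<comment> \<open>Now p = 1 / (k + 2) tends to 0; the offset 2 keeps p strictly below 1.\<close>
  have "(\<lambda>k. 1 / real (k + 2) * b + (1 - 1 / real (k + 2)) * a) \<longlonglongrightarrow> 0 * b + (1 - 0) * a"
  proof (intro tendsto_intros)
    show "(\<lambda>k. 1 / real (k + 2)) \<longlonglongrightarrow> 0" "(\<lambda>k. 1 / real (k + 2)) \<longlonglongrightarrow> 0" by real_asymp+
  qed
  then have "h x \<le> 0 * b + (1 - 0) * a"
    by (rule LIMSEQ_le_const) (intro exI[of _ 0] allI impI step, auto)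
  then show ?thesis by (simp add: h_def)
qed

text \<open>Point masses at the \<open>x j\<close> are replaced by uniform densities on short intervals.\<close>

lemma max_principle_points:
  fixes x c :: "nat \<Rightarrow> real"
  assumes cont: "\<And>z. isCont u z" and a: "0 \<le> a"
    and le: "\<forall>i<n. 0 < c i \<longrightarrow> (\<Sum>j<n. u (x j - x i) * c j) \<le> a"
  shows "\<forall>i<n. (\<Sum>j<n. u (x j - x i) * c j) \<le> a"
proof (intro allI impI)
  fix i0 assume i0: "i0 < n"
  interpret \<rho>: real_distribution \<rho> by (rule rho_rd)
  define B where "B = (\<Sum>j<n. \<bar>c j\<bar>)"
  have B: "0 \<le> B" by (simp add: B_def sum_nonneg)
  \<comment> \<open>One \<eta> * B is lost in carrying the hypothesis to the smoothed charge,
    another in carrying the conclusion back to the points.\<close>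
  have main: "(\<Sum>j<n. u (x j - x i0) * c j) \<le> a + 2 * \<eta> * B" if \<eta>: "0 < \<eta>" for \<eta>
  proof -
    have "\<forall>\<^sub>F \<epsilon> in at_right 0. \<forall>y. \<bar>y - z\<bar> \<le> 2 * \<epsilon> \<longrightarrow> \<bar>u y - u z\<bar> \<le> \<eta>" for z
    proof -
      obtain d where d: "0 < d" "\<forall>y. \<bar>y - z\<bar> < d \<longrightarrow> \<bar>u y - u z\<bar> < \<eta>"
        using cont[of z] \<eta> unfolding continuous_at_eps_delta dist_real_def by meson
      show ?thesis unfolding eventually_at_right_field
        by (intro exI[of _ "d / 2"]) (use d in \<open>auto intro!: less_imp_le d(2)[rule_format]\<close>)
    qed
    then have "\<forall>\<^sub>F \<epsilon> in at_right 0. \<forall>i\<in>{..<n}. \<forall>j\<in>{..<n}. \<forall>y.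
        \<bar>y - (x j - x i)\<bar> \<le> 2 * \<epsilon> \<longrightarrow> \<bar>u y - u (x j - x i)\<bar> \<le> \<eta>"
      by (intro eventually_ball_finite ballI finite_lessThan)
    then have "\<forall>\<^sub>F \<epsilon> in at_right (0::real). 0 < \<epsilon> \<and> (\<forall>i\<in>{..<n}. \<forall>j\<in>{..<n}. \<forall>y.
        \<bar>y - (x j - x i)\<bar> \<le> 2 * \<epsilon> \<longrightarrow> \<bar>u y - u (x j - x i)\<bar> \<le> \<eta>)"
      using eventually_at_right_less[of "0::real"] by (rule eventually_conj[rotated])
    then have "\<exists>\<epsilon>>0. \<forall>i\<in>{..<n}. \<forall>j\<in>{..<n}. \<forall>y.
        \<bar>y - (x j - x i)\<bar> \<le> 2 * \<epsilon> \<longrightarrow> \<bar>u y - u (x j - x i)\<bar> \<le> \<eta>"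
      by (rule eventually_happens'[OF trivial_limit_at_right_real])
    then obtain \<epsilon> where \<epsilon>: "0 < \<epsilon>" "\<And>i j y. i < n \<Longrightarrow> j < n \<Longrightarrow>
        \<bar>y - (x j - x i)\<bar> \<le> 2 * \<epsilon> \<Longrightarrow> \<bar>u y - u (x j - x i)\<bar> \<le> \<eta>"
      by auto
    define f where "f t = (\<Sum>j<n. c j / (2 * \<epsilon>) * indicator {x j - \<epsilon><..x j + \<epsilon>} t)" for t :: real
    have [measurable]: "f \<in> borel_measurable borel" unfolding f_def by measurable
    have f_bd: "\<bar>f t\<bar> \<le> B / (2 * \<epsilon>)" for t
    proof -
      have "\<bar>f t\<bar> \<le> (\<Sum>j<n. \<bar>c j / (2 * \<epsilon>) * indicator {x j - \<epsilon><..x j + \<epsilon>} t\<bar>)"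
        unfolding f_def by (rule sum_abs)
      also have "\<dots> \<le> (\<Sum>j<n. \<bar>c j\<bar> / (2 * \<epsilon>))"
        using \<epsilon>(1) by (intro sum_mono) (auto simp: indicator_def)
      finally show ?thesis by (simp add: B_def sum_divide_distrib)
    qed
    have h_eq: "(\<integral>y. f (t + y) \<partial>\<rho>) = (\<Sum>j<n. c j / (2 * \<epsilon>) * measure \<rho> {x j - \<epsilon> - t<..x j + \<epsilon> - t})" for t
    proof -
      have "f (t + y) = (\<Sum>j<n. c j / (2 * \<epsilon>) * indicator {x j - \<epsilon> - t<..x j + \<epsilon> - t} y)" for y
        unfolding f_def by (intro sum.cong refl) (auto simp: indicator_def algebra_simps)
      moreover have "integrable \<rho> (indicator {x j - \<epsilon> - t<..x j + \<epsilon> - t} :: real \<Rightarrow> real)" for j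
        by (rule \<rho>.integrable_const_bound[where B = 1]) (auto simp: indicator_def)
      ultimately show ?thesis by simp
    qed
    \<comment> \<open>Seen from a t within \<epsilon> of x i, the interval around x j lies within 2
      * \<epsilon> of x j - x i, where u varies by at most \<eta>; here \<beta> * u acts as the
      density of \<rho>.\<close>
    have near: "\<bar>(\<integral>y. f (t + y) \<partial>\<rho>) - \<beta> * (\<Sum>j<n. u (x j - x i) * c j)\<bar> \<le> \<beta> * \<eta> * B"
      if i: "i < n" "\<bar>t - x i\<bar> \<le> \<epsilon>" for t i
    proof -
      have "\<bar>(\<integral>y. f (t + y) \<partial>\<rho>) - \<beta> * (\<Sum>j<n. u (x j - x i) * c j)\<bar> =
        \<bar>\<Sum>j<n. c j / (2 * \<epsilon>) * (measure \<rho> {x j - \<epsilon> - t<..x j + \<epsilon> - t} - \<beta> * u (x j - x i) * (2 * \<epsilon>))\<bar>"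
        unfolding h_eq sum_distrib_left sum_subtractf[symmetric]
        using \<epsilon>(1) by (intro arg_cong[of _ _ abs] sum.cong refl) (simp add: field_simps)
      also have "\<dots> \<le> (\<Sum>j<n. \<bar>c j\<bar> / (2 * \<epsilon>) * (\<beta> * \<eta> * (2 * \<epsilon>)))"
      proof (rule order.trans[OF sum_abs], rule sum_mono)
        fix j assume j: "j \<in> {..<n}"
        have "\<bar>measure \<rho> {x j - \<epsilon> - t<..x j + \<epsilon> - t} - \<beta> * u (x j - x i) * ((x j + \<epsilon> - t) - (x j - \<epsilon> - t))\<bar> \<le>
            \<beta> * \<eta> * ((x j + \<epsilon> - t) - (x j - \<epsilon> - t))"
          by (rule measure_interval_bound) (use \<epsilon>(1) i j in \<open>auto intro!: \<epsilon>(2)\<close>)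
        then show "\<bar>c j / (2 * \<epsilon>) * (measure \<rho> {x j - \<epsilon> - t<..x j + \<epsilon> - t} - \<beta> * u (x j - x i) * (2 * \<epsilon>))\<bar> \<le>
            \<bar>c j\<bar> / (2 * \<epsilon>) * (\<beta> * \<eta> * (2 * \<epsilon>))"
          unfolding abs_mult using \<epsilon>(1) by (intro mult_mono) (auto simp: algebra_simps)
      qed
      also have "\<dots> = \<beta> * \<eta> * B"
        using \<epsilon>(1) by (simp add: B_def sum_distrib_left mult_ac)
      finally show ?thesis .
    qed
    have "(\<integral>y. f (x i0 + y) \<partial>\<rho>) \<le> \<beta> * (a + \<eta> * B)"
    proof (rule max_principle[OF _ f_bd])
      show "0 \<le> \<beta> * (a + \<eta> * B)" using \<beta> a \<eta> B by simp
      fix t assume "0 < f t"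
      \<comment> \<open>A positive value of f forces t into the interval of some positive charge,
        and \<open>le\<close> holds at its centre.\<close>
      then have "\<exists>j<n. 0 < c j / (2 * \<epsilon>) * indicator {x j - \<epsilon><..x j + \<epsilon>} t"
        using sum_nonpos[of "{..<n}" "\<lambda>j. c j / (2 * \<epsilon>) * indicator {x j - \<epsilon><..x j + \<epsilon>} t"]
        unfolding f_def by (force simp: not_less)
      then obtain j where j: "j < n" "0 < c j" "t \<in> {x j - \<epsilon><..x j + \<epsilon>}"
        using \<epsilon>(1) by (auto simp: zero_less_divide_iff zero_less_mult_iff split: split_indicator_asm)
      then have "\<bar>(\<integral>y. f (t + y) \<partial>\<rho>) - \<beta> * (\<Sum>k<n. u (x k - x j) * c k)\<bar> \<le> \<beta> * \<eta> * B"
        by (intro near) auto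
      moreover have "\<beta> * (\<Sum>k<n. u (x k - x j) * c k) \<le> \<beta> * a"
        using le j \<beta> by (intro mult_left_mono) auto
      ultimately show "(\<integral>y. f (t + y) \<partial>\<rho>) \<le> \<beta> * (a + \<eta> * B)" by (simp add: algebra_simps)
    qed measurable
    moreover have "\<bar>(\<integral>y. f (x i0 + y) \<partial>\<rho>) - \<beta> * (\<Sum>j<n. u (x j - x i0) * c j)\<bar> \<le> \<beta> * \<eta> * B"
      by (rule near) (use i0 \<epsilon>(1) in auto)
    ultimately have "\<beta> * (\<Sum>j<n. u (x j - x i0) * c j) \<le> \<beta> * (a + 2 * \<eta> * B)"
      by (simp add: algebra_simps)
    then show ?thesis using \<beta> by simp
  qed
  show "(\<Sum>j<n. u (x j - x i0) * c j) \<le> a"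
  proof (rule field_le_epsilon)
    fix e :: real assume e: "0 < e"
    have "2 * (e / (2 * (B + 1))) * B \<le> e" using B e by (simp add: field_simps)
    then show "(\<Sum>j<n. u (x j - x i0) * c j) \<le> a + e"
      using main[of "e / (2 * (B + 1))"] B e by auto
  qed
qed

section \<open>Behaviour of u and sigma near 0\<close>

lemma R_part_minus: "R_part \<beta> \<psi> (- z) = R_part \<beta> \<psi> z"
  by (simp add: R_part_def)

lemma H_part_minus: "H_part \<beta> \<psi> (- z) = - H_part \<beta> \<psi> z"
  by (simp add: H_part_def)

lemma R_part_le: "R_part \<beta> \<psi> z \<le> R_part \<beta> \<psi> 0"
proof -
  have "pi * R_part \<beta> \<psi> z \<le> pi * R_part \<beta> \<psi> 0"
  proof (rule tendsto_le[of at_top])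
    have lim: "((\<lambda>T. cpart T z) \<longlongrightarrow> pi * R_part \<beta> \<psi> z) at_top" for z
    proof (rule Lim_null[THEN iffD2], rule Lim_null_comparison[OF _ tail_tendsto_0])
      show "\<forall>\<^sub>F T in at_top. norm (cpart T z - pi * R_part \<beta> \<psi> z) \<le> tail T"
        using eventually_ge_at_top[of 0] by eventually_elim (simp add: cpart_uniform)
    qed
    show "((\<lambda>T. cpart T z) \<longlongrightarrow> pi * R_part \<beta> \<psi> z) at_top"
      "((\<lambda>T. cpart T 0) \<longlongrightarrow> pi * R_part \<beta> \<psi> 0) at_top" by (rule lim)+
    have "cos (v * z) * Re (g v) \<le> cos (v * 0) * Re (g v)" for v
      using mult_right_mono[OF cos_le_one Re_g_nonneg] by simp
    then show "\<forall>\<^sub>F T in at_top. cpart T z \<le> cpart T 0"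
      unfolding cpart_def by (intro always_eventually allI integral_le integrable_on_Icc cont_cos)
  qed simp
  then show ?thesis by simp
qed

lemma isCont_R_part: "isCont (R_part \<beta> \<psi>) z"
proof -
  have "continuous_on UNIV (\<lambda>z. pi * R_part \<beta> \<psi> z)"
  proof (rule uniform_limit_theorem[of _ _ at_top])
    show "uniform_limit UNIV cpart (\<lambda>z. pi * R_part \<beta> \<psi> z) at_top"
    proof (rule uniform_limitI)
      fix e :: real assume e: "0 < e"
      have "\<forall>\<^sub>F T in at_top. tail T < e" using tail_tendsto_0 e by (rule order_tendstoD(2))
      then show "\<forall>\<^sub>F T in at_top. \<forall>z\<in>UNIV. dist (cpart T z) (pi * R_part \<beta> \<psi> z) < e"
        using eventually_ge_at_top[of 0]
      proof eventually_elim
        case (elim T)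
        then show ?case using cpart_uniform[of T] by (auto simp: dist_real_def intro: le_less_trans)
      qed
    qed
  qed (auto intro!: always_eventually cont_cpart)
  then have "isCont (\<lambda>z. pi * R_part \<beta> \<psi> z) z"
    by (simp add: continuous_on_eq_continuous_at)
  then have "isCont (\<lambda>z. 1 / pi * (pi * R_part \<beta> \<psi> z)) z"
    by (rule continuous_mult[OF continuous_const])
  moreover have "(\<lambda>z. 1 / pi * (pi * R_part \<beta> \<psi> z)) = R_part \<beta> \<psi>" by (rule ext) simp
  ultimately show ?thesis by (simp only:)
qed

lemma H_part_0: "H_part \<beta> \<psi> 0 = 0"
  by (simp add: H_part_def)

text \<open>The odd part H cancels in the symmetrised difference, and the argument of the square
  root is nonnegative because R is largest at 0.\<close>

lemma sigma_pot_sq: "(sigma_pot \<beta> \<psi> z)\<^sup>2 = 2 * (R_part \<beta> \<psi> 0 - R_part \<beta> \<psi> z)"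
  using R_part_le[of z]
  by (simp add: sigma_pot_def potential_density_def R_part_minus H_part_minus H_part_0)

lemma u_0_minus_u: "u 0 - u z = (sigma_pot \<beta> \<psi> z)\<^sup>2 / 2 - H_part \<beta> \<psi> z"
  unfolding sigma_pot_sq by (simp add: potential_density_def H_part_0)

text \<open>At 0, where uniform convergence is not at hand, the hypothesis bounds |H| by a multiple
  of sigma^2, which tends to 0 by the continuity of R.\<close>

lemma isCont_u_everywhere:
  assumes "\<forall>\<^sub>F z in nhds 0. \<bar>H_part \<beta> \<psi> z\<bar> \<le> C * (sigma_pot \<beta> \<psi> z)\<^sup>2"
  shows "isCont u z"
proof (cases "z = 0")
  case False then show ?thesis by (rule isCont_u)
next
  case True
  have R: "(R_part \<beta> \<psi> \<longlongrightarrow> R_part \<beta> \<psi> 0) (at 0)" using isCont_R_part[of 0] by (simp add: isCont_def)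
  have "(H_part \<beta> \<psi> \<longlongrightarrow> 0) (at 0)"
  proof (rule Lim_null_comparison)
    show "\<forall>\<^sub>F z in at 0. norm (H_part \<beta> \<psi> z) \<le> C * (2 * (R_part \<beta> \<psi> 0 - R_part \<beta> \<psi> z))"
      using assms unfolding sigma_pot_sq eventually_at_filter by eventually_elim simp
    have "((\<lambda>z. C * (2 * (R_part \<beta> \<psi> 0 - R_part \<beta> \<psi> z))) \<longlongrightarrow> C * (2 * (R_part \<beta> \<psi> 0 - R_part \<beta> \<psi> 0))) (at 0)"
      by (intro tendsto_intros R)
    then show "((\<lambda>z. C * (2 * (R_part \<beta> \<psi> 0 - R_part \<beta> \<psi> z))) \<longlongrightarrow> 0) (at 0)" by simp
  qed
  with R have "((\<lambda>z. R_part \<beta> \<psi> z + H_part \<beta> \<psi> z) \<longlongrightarrow> R_part \<beta> \<psi> 0 + 0) (at 0)"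
    by (intro tendsto_intros)
  then show ?thesis unfolding True isCont_def potential_density_def by (simp add: H_part_0)
qed

end

section \<open>Unboundedness\<close>

lemma frequently_of_limsup_eq_infty:
  fixes a :: "nat \<Rightarrow> real"
  assumes "limsup (\<lambda>n. ereal (a n)) = \<infinity>"
  shows "\<exists>\<^sub>F n in sequentially. B < a n"
proof (rule ccontr)
  assume "\<not> (\<exists>\<^sub>F n in sequentially. B < a n)"
  then have "\<forall>\<^sub>F n in sequentially. ereal (a n) \<le> ereal B"
    by (simp add: not_frequently not_less)
  then have "limsup (\<lambda>n. ereal (a n)) \<le> ereal B" by (rule Limsup_bounded)
  with assms show False by simp
qed

context resolvent_density
begin

text \<open>About \<delta> n points i / n have all their differences below \<delta>, where the local
  hypotheses hold. With z = ln n / 4 each counts with an exceedance probability of order n powr (- 1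
  / 2), so the small ball probability decays like the exponential of a negative multiple of n powr
  (1 / 2).\<close>

lemma permanental_bounded_event_le:
  assumes C: "C < 1 / 2"
    and H: "\<forall>\<^sub>F z in nhds 0. \<bar>H_part \<beta> \<psi> z\<bar> \<le> C * (sigma_pot \<beta> \<psi> z)\<^sup>2"
    and f: "mono_on {0..} f" "\<forall>\<^sub>F z in nhds 0. f \<bar>z\<bar> \<le> (sigma_pot \<beta> \<psi> z)\<^sup>2"
    and lim: "limsup (\<lambda>n. ereal (f (1 / real n) * ln (real n))) = \<infinity>"
    and \<alpha>: "0 < \<alpha>" and perm: "permanental_process N X \<alpha> (\<lambda>x y. u (y - x))" and e: "0 < e"
  shows "\<exists>n N0. measure N {\<omega> \<in> space N. \<forall>i<N0. X (real i / real n) \<omega> \<le> y} \<le> e"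
proof -
  have "\<forall>\<^sub>F z in nhds 0. \<bar>H_part \<beta> \<psi> z\<bar> \<le> C * (sigma_pot \<beta> \<psi> z)\<^sup>2 \<and> f \<bar>z\<bar> \<le> (sigma_pot \<beta> \<psi> z)\<^sup>2"
    using H f(2) by (rule eventually_conj)
  then obtain \<delta> where \<delta>: "0 < \<delta>" "\<And>z. \<bar>z\<bar> < \<delta> \<Longrightarrow> \<bar>H_part \<beta> \<psi> z\<bar> \<le> C * (sigma_pot \<beta> \<psi> z)\<^sup>2"
    "\<And>z. \<bar>z\<bar> < \<delta> \<Longrightarrow> f \<bar>z\<bar> \<le> (sigma_pot \<beta> \<psi> z)\<^sup>2"
    unfolding eventually_nhds_metric by (auto simp: dist_real_def)
  define c where "c = exp (- 3) / Gamma \<alpha>"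
  have c: "0 < c" using Gamma_real_pos[OF \<alpha>] by (simp add: c_def)
  \<comment> \<open>Chosen so that f (1 / n) * ln n > B gives \<delta>' * ln n > 8 * (\<bar>y\<bar>
    + 1) below, hence 2 * y / \<delta>' \<le> ln n / 4.\<close>
  define B where "B = 8 * (\<bar>y\<bar> + 1) / (1 / 2 - C)"
  have B: "0 < B" using C by (simp add: B_def)
  have "\<forall>\<^sub>F n in sequentially. 1 \<le> ln (real n) / 4" by real_asymp
  moreover have "\<forall>\<^sub>F n in sequentially. c * real n powr (- 1 / 2) \<le> 1"
  proof -
    have "(\<lambda>n. c * real n powr (- 1 / 2)) \<longlonglongrightarrow> 0" by real_asymp
    then have "\<forall>\<^sub>F n in sequentially. c * real n powr (- 1 / 2) < 1" by (rule order_tendstoD(2)) simp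
    then show ?thesis by eventually_elim simp
  qed
  moreover have "\<forall>\<^sub>F n in sequentially. 4 \<le> \<delta> * real n" using \<delta>(1) by real_asymp
  moreover have "\<forall>\<^sub>F n in sequentially. exp (- (\<delta> * real n / 2 * (c * real n powr (- 1 / 2)))) < e"
  proof -
    have "(\<lambda>n. exp (- (\<delta> * real n / 2 * (c * real n powr (- 1 / 2))))) \<longlonglongrightarrow> 0"
      using \<delta>(1) c by real_asymp
    then show ?thesis using e by (rule order_tendstoD(2))
  qed
  ultimately have "\<forall>\<^sub>F n in sequentially. 1 \<le> ln (real n) / 4 \<and> c * real n powr (- 1 / 2) \<le> 1 \<and> 4 \<le> \<delta> * real n \<and>
      exp (- (\<delta> * real n / 2 * (c * real n powr (- 1 / 2)))) < e"
    by eventually_elim simp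
  \<comment> \<open>The limsup gives its bound only infinitely often, the other conditions hold
    eventually; one n with all of them suffices.\<close>
  from frequently_eventually_frequently[OF frequently_of_limsup_eq_infty[OF lim, of B] this]
  obtain n where n: "B < f (1 / real n) * ln (real n)" "1 \<le> ln (real n) / 4" "c * real n powr (- 1 / 2) \<le> 1"
    "4 \<le> \<delta> * real n" "exp (- (\<delta> * real n / 2 * (c * real n powr (- 1 / 2)))) < e"
    using frequently_ex by fast
  have n0: "0 < real n" using n(4) \<delta>(1) by (cases "n = 0") auto
  have ln0: "0 < ln (real n)" using n(2) by simp
  define N0 where "N0 = nat \<lfloor>\<delta> * real n\<rfloor>"
  have N0: "real N0 \<le> \<delta> * real n" "\<delta> * real n - 1 < real N0"
    using n(4) unfolding N0_def by (auto simp: of_nat_nat)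
  have N0_half: "\<delta> * real n / 2 \<le> real N0" "2 \<le> N0" using N0 n(4) by linarith+
  define \<delta>' where "\<delta>' = (1 / 2 - C) * f (1 / real n)"
  have "0 < f (1 / real n) * ln (real n)" using n(1) B by linarith
  then have f0: "0 < f (1 / real n)" using ln0 by (simp add: zero_less_mult_iff)
  have \<delta>': "0 < \<delta>'" using C f0 by (simp add: \<delta>'_def)
  define x where "x i = real i / real n" for i :: nat
  define k where "k s t = u (t - s)" for s t :: real
  define z where "z = ln (real n) / 4"
  have "measure N {\<omega> \<in> space N. \<forall>i<N0. X (x i) \<omega> \<le> y} \<le> (1 - exp (- 2 * z - 3) / Gamma \<alpha>) ^ N0"
  proof (rule permanental_small_ball[where k = k and u = "u 0" and \<delta> = \<delta>'])
    show "permanental_process N X \<alpha> k" using perm by (simp add: k_def[abs_def])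
    show "\<forall>i<N0. (\<Sum>j<N0. k (x i) (x j) * c j) \<le> a"
      if "0 \<le> a" "\<forall>i<N0. 0 < c i \<longrightarrow> (\<Sum>j<N0. k (x i) (x j) * c j) \<le> a" for a and c :: "nat \<Rightarrow> real"
      using max_principle_points[OF isCont_u_everywhere[OF H], of a N0 c x] that by (simp add: k_def)
    show "k (x i) (x i) = u 0" for i by (simp add: k_def)
    show "k (x i) (x j) \<le> u 0 - \<delta>'" if ij: "i < N0" "j < N0" "i \<noteq> j" for i j
    proof -
      define t where "t = x j - x i"
      have t_eq: "\<bar>t\<bar> = \<bar>real j - real i\<bar> / real n"
        using n0 by (simp add: t_def x_def diff_divide_distrib[symmetric] abs_divide)
      have "1 \<le> \<bar>real j - real i\<bar>" using ij by linarith
      then have t1: "1 / real n \<le> \<bar>t\<bar>" unfolding t_eq using n0 by (intro divide_right_mono) auto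
      have "\<bar>real j - real i\<bar> < real N0" using ij by linarith
      then have "\<bar>t\<bar> < real N0 / real n" unfolding t_eq using n0 by (intro divide_strict_right_mono) auto
      also have "\<dots> \<le> \<delta>" using N0(1) n0 by (simp add: field_simps)
      finally have t2: "\<bar>t\<bar> < \<delta>" .
      have "f (1 / real n) \<le> f \<bar>t\<bar>" using t1 by (intro mono_onD[OF f(1)]) auto
      also have "\<dots> \<le> (sigma_pot \<beta> \<psi> t)\<^sup>2" by (rule \<delta>(3)[OF t2])
      finally have "\<delta>' \<le> (1 / 2 - C) * (sigma_pot \<beta> \<psi> t)\<^sup>2"
        unfolding \<delta>'_def using C by (intro mult_left_mono) auto
      also have "\<dots> \<le> u 0 - u t"
        unfolding u_0_minus_u using \<delta>(2)[OF t2] by (simp add: algebra_simps)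
      finally show ?thesis by (simp add: k_def t_def)
    qed
    show "1 \<le> z" using n(2) by (simp add: z_def)
    show "2 * y / \<delta>' \<le> z"
    proof -
      have "8 * (\<bar>y\<bar> + 1) < \<delta>' * ln (real n)"
        using n(1) C unfolding B_def \<delta>'_def by (simp add: divide_less_eq mult_ac)
      then have "2 * y \<le> z * \<delta>'" unfolding z_def by (simp add: mult_ac)
      then show ?thesis using \<delta>' by (simp add: divide_le_eq)
    qed
  qed (use \<alpha> N0_half \<delta>' in auto)
  also have "exp (- 2 * z - 3) / Gamma \<alpha> = c * real n powr (- 1 / 2)"
  proof -
    have "- 2 * z - 3 = - 3 + (- 1 / 2) * ln (real n)" by (simp add: z_def)
    then have "exp (- 2 * z - 3) = exp (- 3) * exp ((- 1 / 2) * ln (real n))" by (simp only: exp_add)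
    moreover have "real n powr (- 1 / 2) = exp ((- 1 / 2) * ln (real n))" using n0 by (simp add: powr_def)
    ultimately show ?thesis by (simp add: c_def)
  qed
  also have "(1 - c * real n powr (- 1 / 2)) ^ N0 \<le> exp (- (c * real n powr (- 1 / 2))) ^ N0"
    using n(3) exp_ge_add_one_self[of "- (c * real n powr (- 1 / 2))"] by (intro power_mono) auto
  also have "\<dots> = exp (- (real N0 * (c * real n powr (- 1 / 2))))"
    by (simp add: exp_of_nat_mult[symmetric])
  also have "\<dots> \<le> exp (- (\<delta> * real n / 2 * (c * real n powr (- 1 / 2))))"
    unfolding exp_le_cancel_iff neg_le_iff_le using c by (intro mult_right_mono N0_half(1)) simp
  also have "\<dots> < e" by (rule n(5))
  finally show ?thesis unfolding x_def by (intro exI[of _ n] exI[of _ N0]) simp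
qed

text \<open>The points i / n are rational, so boundedness by k on the rationals is a measurable
  event contained in all the events just estimated, hence null. The supremum over the reals can only
  be larger.\<close>

lemma permanental_unbounded:
  assumes "C < 1 / 2"
    and "\<forall>\<^sub>F z in nhds 0. \<bar>H_part \<beta> \<psi> z\<bar> \<le> C * (sigma_pot \<beta> \<psi> z)\<^sup>2"
    and "mono_on {0..} f" "\<forall>\<^sub>F z in nhds 0. f \<bar>z\<bar> \<le> (sigma_pot \<beta> \<psi> z)\<^sup>2"
    and "limsup (\<lambda>n. ereal (f (1 / real n) * ln (real n))) = \<infinity>"
    and \<alpha>: "0 < \<alpha>" and perm: "permanental_process N X \<alpha> (\<lambda>x y. u (y - x))"
  shows "AE \<omega> in N. (SUP x. ereal (X x \<omega>)) = \<infinity>"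
proof -
  interpret N: prob_space N using perm by (simp add: permanental_process_def)
  have meas[measurable]: "X t \<in> borel_measurable N" for t using perm by (simp add: permanental_process_def)
  have "AE \<omega> in N. \<exists>r::rat. real k < X (of_rat r) \<omega>" for k :: nat
  proof -
    define A where "A = {\<omega> \<in> space N. \<forall>r::rat. X (of_rat r) \<omega> \<le> real k}"
    have A[measurable]: "A \<in> sets N" unfolding A_def by measurable
    have "measure N A \<le> 0 + e" if "0 < e" for e
    proof -
      obtain n N0 where *: "measure N {\<omega> \<in> space N. \<forall>i<N0. X (real i / real n) \<omega> \<le> real k} \<le> e"
        using permanental_bounded_event_le[OF assms \<open>0 < e\<close>] by blast
      have "A \<subseteq> {\<omega> \<in> space N. \<forall>i<N0. X (real i / real n) \<omega> \<le> real k}"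
      proof
        fix \<omega> assume \<omega>: "\<omega> \<in> A"
        have "X (real i / real n) \<omega> \<le> real k" for i
        proof -
          have "real i / real n = of_rat (of_nat i / of_nat n)" by (simp add: of_rat_divide)
          then show ?thesis using \<omega> unfolding A_def by (simp only: mem_Collect_eq)
        qed
        then show "\<omega> \<in> {\<omega> \<in> space N. \<forall>i<N0. X (real i / real n) \<omega> \<le> real k}"
          using \<omega> by (simp add: A_def)
      qed
      then have "measure N A \<le> measure N {\<omega> \<in> space N. \<forall>i<N0. X (real i / real n) \<omega> \<le> real k}"
        by (rule N.finite_measure_mono) measurable
      with * show ?thesis by simp
    qed
    then have "measure N A \<le> 0" by (rule field_le_epsilon)
    then have "A \<in> null_sets N" by (auto simp: null_sets_def N.emeasure_eq_measure measure_le_0_iff)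
    then show ?thesis by (rule AE_I') (auto simp: A_def not_less)
  qed
  then have "AE \<omega> in N. \<forall>k::nat. \<exists>r::rat. real k < X (of_rat r) \<omega>" by (simp add: AE_all_countable)
  then show ?thesis
  proof eventually_elim
    case (elim \<omega>)
    show ?case
    proof (rule ereal_top)
      fix b :: real
      obtain k :: nat where "b \<le> real k" using real_arch_simple by blast
      moreover obtain r :: rat where "real k < X (of_rat r) \<omega>" using elim by blast
      ultimately have "ereal b \<le> ereal (X (of_rat r) \<omega>)" by simp
      also have "\<dots> \<le> (SUP x. ereal (X x \<omega>))" by (rule SUP_upper) simp
      finally show "ereal b \<le> (SUP x. ereal (X x \<omega>))" .
    qed
  qed
qed

end

theorem theorem1p5:
  fixes M :: "'a measure" and Y :: "real \<Rightarrow> 'a \<Rightarrow> real"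
    and \<psi> :: "real \<Rightarrow> complex" and \<beta> C :: real and f :: "real \<Rightarrow> real"
  assumes "levy_process M Y"
    and "characteristic_exponent M Y \<psi>"
    and "\<beta> > 0"
    and "set_integrable lborel {0..} (resolvent_re \<beta> \<psi>)"
    and "C < 1 / 2"
    and "\<forall>\<^sub>F z in nhds 0. \<bar>H_part \<beta> \<psi> z\<bar> \<le> C * (sigma_pot \<beta> \<psi> z)\<^sup>2"
    and "mono_on {0..} f"
    and "\<forall>\<^sub>F z in nhds 0. (sigma_pot \<beta> \<psi> z)\<^sup>2 \<ge> f \<bar>z\<bar>"
    and "limsup (\<lambda>n. ereal (f (1 / real n) * ln (real n))) = \<infinity>"
  shows "\<forall>\<alpha>>0. \<forall>(N :: 'b measure) (X :: real \<Rightarrow> 'b \<Rightarrow> real).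
           permanental_process N X \<alpha> (\<lambda>x y. potential_density \<beta> \<psi> (y - x)) \<longrightarrow>
           (AE \<omega> in N. (SUP x. ereal (X x \<omega>)) = \<infinity>)"
proof (intro allI impI)
  fix \<alpha> :: real and N :: "'b measure" and X :: "real \<Rightarrow> 'b \<Rightarrow> real"
  assume "\<alpha> > 0" and perm: "permanental_process N X \<alpha> (\<lambda>x y. potential_density \<beta> \<psi> (y - x))"
  interpret resolvent_density "\<lambda>t. distr M borel (Y t)" \<psi> \<beta>
  proof (intro resolvent_density.intro char_semigroup.intro resolvent_density_axioms.intro, goal_cases)
    case (1 t)
    then show ?case
      using assms(1) by (auto simp: levy_process_def intro: prob_space.real_distribution_distr)
  next
    case (2 t v)
    then show ?case using assms(2) unfolding characteristic_exponent_def by blast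
  qed (use assms(3,4) in auto)
  show "AE \<omega> in N. (SUP x. ereal (X x \<omega>)) = \<infinity>"
    by (rule permanental_unbounded[OF assms(5-9) \<open>\<alpha> > 0\<close> perm])
qed

end
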